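(* In dimension $n=2$ for jet order $\kappa=5$, the algebra $UE_5^2$ of jet polynomials ${\sf P}(j^5f_1,j^5f_2)$ invariant by reparametrization and under the unipotent action is generated by the $17$ mutually independent bi-invariants $$f_1',\ \Lambda^3,\ \Lambda^5,\ \Lambda^7,\ \Lambda^9,\ M^8,\ M^{10},\ K^{12},\ N^{12},\ H^{14},\ F^{16},\ X^{18},\ X^{19},\ X^{21},\ X^{23},\ X^{25},\ Y^{27}.$$ As a consequence, the full algebra $E_5^2$ of jet polynomials ${\sf P}(j^5f)$ invariant by reparametrization is generated by the polarizations $$f_i',\ \Lambda^3,\ \Lambda_i^5,\ \Lambda_{i,j}^7,\ \Lambda_{i,j,k}^9,\ M^8,\ M_i^{10},\ K_{i,j}^{12},\ N^{12},\ H_i^{14},\ F_{i,j}^{16},\ X_{i,j,k}^{18},\ X_i^{19},\ X^{21},\ X_i^{23},\ X_{i,j}^{25},\ Y_{i,j,k}^{27}$$ of these $17$ bi-invariants, where the indices $i,j,k$ vary in $\{1,2\}$, so that the total number of these (labelled) invariants is $$2+1+2+4+8+1+2+4+1+2+4+8+2+1+2+4+8=56.$$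
   Context: $\mathbb{C}[j^5f]$ is the polynomial ring in $f_i^{(\lambda)}$, $i=1,2$, $1\le\lambda\le5$ (jet coordinates of germs $f:(\mathbb{C},0)\to\mathbb{C}^2$). ${\sf P}$ is invariant by reparametrization of weight $m$ if ${\sf P}(j^5(f\circ\phi))=(\phi')^m{\sf P}((j^5f)\circ\phi)$ for all local biholomorphisms $\phi$ of $(\mathbb{C},0)$; $E_5^2=\oplus_mE_{5,m}^2$ is the algebra of these. It is invariant under the unipotent action if it is unchanged by $f_1^{(\lambda)}\mapsto f_1^{(\lambda)}$, $f_2^{(\lambda)}\mapsto f_2^{(\lambda)}+uf_1^{(\lambda)}$ (all $\lambda$ simultaneously) for all $u\in\mathbb{C}$; $UE_5^2\subset E_5^2$ is the subalgebra of bi-invariants. A list is mutually independent if no member is a polynomial in the others. Upper indices are weights. With ${\sf D}=\sum_{k,\lambda}f_k^{(\lambda+1)}\partial/\partial f_k^{(\lambda)}$ and $[{\sf P},{\sf Q}]=q\,{\sf D}{\sf P}\cdot{\sf Q}-p\,{\sf P}\cdot{\sf D}{\sf Q}$ for invariants of weights $p,q$, the bi-invariants are (all the quotients are polynomials): $\Lambda^3=f_1'f_2''-f_1''f_2'$, $\Lambda^5=[\Lambda^3,f_1']$, $\Lambda^7=[\Lambda^5,f_1']$, $\Lambda^9=[\Lambda^7,f_1']$, $M^8=(3\Lambda^3\Lambda^7-5\Lambda^5\Lambda^5)/(f_1')^2$, $M^{10}=[M^8,f_1']$, $N^{12}=[M^8,\Lambda^3]$, $K^{12}=[\Lambda^7,\Lambda^5]/f_1'$,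 $H^{14}=[M^8,\Lambda^5]$, $F^{16}=[M^8,\Lambda^7]$, $X^{18}=(-5\Lambda^9M^{10}+56\Lambda^7K^{12})/f_1'$, $X^{19}=(-5M^{10}M^{10}+64M^8K^{12})/f_1'$, $X^{21}=(-5M^{10}N^{12}+8M^8H^{14})/f_1'$, $X^{23}=(-7N^{12}K^{12}+M^8F^{16})/f_1'$, $X^{25}=(-56K^{12}H^{14}+5M^{10}F^{16})/f_1'$, $Y^{27}=(-56K^{12}F^{16}+M^{10}X^{18})/f_1'$. Polarizations: each bi-invariant ${\sf P}$ above is a highest weight vector for the action of $GL_2(\mathbb{C})$ by linear substitution simultaneously at each jet level; with $r$ the number of lower indices attached to ${\sf P}$ in the list of polarizations, ${\sf P}={\sf P}_{1,\dots,1}$ and, for $i_1,\dots,i_r\in\{1,2\}$ with exactly $s$ indices equal to $2$, ${\sf P}_{i_1,\dots,i_r}=\frac{(r-s)!}{r!}\,\mathcal{E}^s{\sf P}$, where $\mathcal{E}=\sum_\lambda f_2^{(\lambda)}\partial/\partial f_1^{(\lambda)}$. (So the polarizations of ${\sf P}$ span the linear span of its $GL_2(\mathbb{C})$-orbit; labelled polarizations need not be pairwise distinct.) *)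

theory Defs
  imports "HOL-Complex_Analysis.Complex_Analysis" "HOL-Library.Poly_Mapping"
begin

section \<open>Polynomials in the jet coordinates\<close>

text \<open>
  \<open>Jet k l\<close> is the coordinate $f_k^{(l)}$. Only $k \in \{1,2\}$ and $l \ge 1$ are meaningful; the
  polynomial rings of interest are carved out by \<open>jet_ring\<close> below. All jet orders live in one type,
  so that the total derivative \<open>D\<close> is an operation on it. The linear order serves only to make the
  polynomials an integral domain by the library instances.
\<close>

datatype jet_coord = Jet (component: nat) (level: nat)

instantiation jet_coord :: linorder
begin

definition less_eq_jet_coord :: "jet_coord \<Rightarrow> jet_coord \<Rightarrow> bool" where
  "a \<le> b \<longleftrightarrow> component a < component b \<or> component a = component b \<and> level a \<le> level b"

definition less_jet_coord :: "jet_coord \<Rightarrow> jet_coord \<Rightarrow> bool" where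
  "a < b \<longleftrightarrow> component a < component b \<or> component a = component b \<and> level a < level b"

instance
  by standard (auto simp: less_eq_jet_coord_def less_jet_coord_def intro: jet_coord.expand)

end

type_synonym jet_poly = "(jet_coord \<Rightarrow>\<^sub>0 nat) \<Rightarrow>\<^sub>0 complex"

definition Const :: "complex \<Rightarrow> jet_poly" where
  "Const c = Poly_Mapping.single 0 c"

definition coord :: "nat \<Rightarrow> nat \<Rightarrow> jet_poly" where
  "coord k l = Poly_Mapping.single (Poly_Mapping.single (Jet k l) 1) 1"

definition jet_vars :: "jet_poly \<Rightarrow> jet_coord set" where
  "jet_vars P = (\<Union>m\<in>Poly_Mapping.keys P. Poly_Mapping.keys m)"

text \<open>The ring $\mathbb{C}[j^\kappa f]$ for $f$ with two components.\<close>

definition jet_ring :: "nat \<Rightarrow> jet_poly set" where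
  "jet_ring \<kappa> = {P. jet_vars P \<subseteq> {Jet k l |k l. k \<in> {1, 2} \<and> l \<in> {1..\<kappa>}}}"

text \<open>
  Value of \<open>P\<close> when each coordinate \<open>v\<close> is replaced by \<open>x v\<close> and the coefficients are mapped by \<open>h\<close>:
  evaluation at a point for \<open>h = id\<close>, substitution of polynomials for \<open>h = Const\<close>.
\<close>

definition jet_subst ::
    "(complex \<Rightarrow> 'a) \<Rightarrow> (jet_coord \<Rightarrow> 'a) \<Rightarrow> jet_poly \<Rightarrow> 'a::comm_semiring_1" where
  "jet_subst h x P =
     (\<Sum>m\<in>Poly_Mapping.keys P. h (Poly_Mapping.lookup P m) *
        (\<Prod>v\<in>Poly_Mapping.keys m. x v ^ Poly_Mapping.lookup m v))"

definition partial :: "jet_coord \<Rightarrow> jet_poly \<Rightarrow> jet_poly" where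
  "partial v P =
     (\<Sum>m\<in>Poly_Mapping.keys P.
        Poly_Mapping.single (m - Poly_Mapping.single v 1)
          (of_nat (Poly_Mapping.lookup m v) * Poly_Mapping.lookup P m))"

text \<open>The derivation $\sum_v g(v)\,\partial/\partial v$; only the coordinates occurring in \<open>P\<close> contribute.\<close>

definition derivation :: "(jet_coord \<Rightarrow> jet_poly) \<Rightarrow> jet_poly \<Rightarrow> jet_poly" where
  "derivation g P = (\<Sum>v\<in>jet_vars P. g v * partial v P)"

inductive_set generated_algebra :: "jet_poly set \<Rightarrow> jet_poly set" for S where
  const: "Const c \<in> generated_algebra S"
| gen: "P \<in> S \<Longrightarrow> P \<in> generated_algebra S"
| add: "P \<in> generated_algebra S \<Longrightarrow> Q \<in> generated_algebra S \<Longrightarrow> P + Q \<in> generated_algebra S"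
| mult: "P \<in> generated_algebra S \<Longrightarrow> Q \<in> generated_algebra S \<Longrightarrow> P * Q \<in> generated_algebra S"

text \<open>Being a polynomial in some elements means lying in the algebra they generate.\<close>

definition mutually_independent :: "jet_poly list \<Rightarrow> bool" where
  "mutually_independent Ps \<longleftrightarrow>
     (\<forall>i<length Ps. Ps ! i \<notin> generated_algebra {Ps ! j |j. j < length Ps \<and> j \<noteq> i})"


section \<open>Invariance\<close>

definition local_biholomorphism :: "(complex \<Rightarrow> complex) \<Rightarrow> bool" where
  "local_biholomorphism \<phi> \<longleftrightarrow> \<phi> 0 = 0 \<and>
     (\<exists>U V \<psi>. open U \<and> 0 \<in> U \<and> open V \<and> \<phi> holomorphic_on U \<and> \<psi> holomorphic_on V \<and>
        (\<forall>z\<in>U. \<phi> z \<in> V \<and> \<psi> (\<phi> z) = z) \<and> (\<forall>w\<in>V. \<psi> w \<in> U \<and> \<phi> (\<psi> w) = w))"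

definition jet :: "(nat \<Rightarrow> complex \<Rightarrow> complex) \<Rightarrow> complex \<Rightarrow> jet_coord \<Rightarrow> complex" where
  "jet f t v = (deriv ^^ level v) (f (component v)) t"

text \<open>
  The invariance is an identity between germs of functions of \<open>t\<close> at \<open>0\<close>. Since no polynomial in
  \<open>jet_ring\<close> involves $f_k^{(0)}$, the value \<open>f k 0\<close> is unrestricted.
\<close>

definition reparametrization_invariant :: "nat \<Rightarrow> jet_poly \<Rightarrow> bool" where
  "reparametrization_invariant m P \<longleftrightarrow>
     (\<forall>f \<phi>. (\<forall>k\<in>{1, 2}. f k analytic_on {0}) \<and> local_biholomorphism \<phi> \<longrightarrow>
        (\<forall>\<^sub>F t in nhds 0.
           jet_subst id (jet (\<lambda>k. f k \<circ> \<phi>) t) P = deriv \<phi> t ^ m * jet_subst id (jet f (\<phi> t)) P))"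

definition E_weight :: "nat \<Rightarrow> nat \<Rightarrow> jet_poly set" where
  "E_weight \<kappa> m = {P \<in> jet_ring \<kappa>. reparametrization_invariant m P}"

text \<open>$E_\kappa^2 = \bigoplus_m E_{\kappa,m}^2$, as the set of finite sums.\<close>

definition E :: "nat \<Rightarrow> jet_poly set" where
  "E \<kappa> = {\<Sum>m\<in>I. P m |I P. finite I \<and> (\<forall>m\<in>I. P m \<in> E_weight \<kappa> m)}"

definition unipotent_action :: "complex \<Rightarrow> jet_poly \<Rightarrow> jet_poly" where
  "unipotent_action u =
     jet_subst Const (\<lambda>v. if component v = 2 then coord 2 (level v) + Const u * coord 1 (level v)
                          else coord (component v) (level v))"

definition UE :: "nat \<Rightarrow> jet_poly set" where
  "UE \<kappa> = {P \<in> E \<kappa>. \<forall>u. unipotent_action u P = P}"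


section \<open>The bi-invariants\<close>

definition D :: "jet_poly \<Rightarrow> jet_poly" where
  "D = derivation (\<lambda>v. coord (component v) (Suc (level v)))"

text \<open>The bracket of \<open>P\<close> of weight \<open>p\<close> and \<open>Q\<close> of weight \<open>q\<close>.\<close>

definition bracket :: "nat \<Rightarrow> jet_poly \<Rightarrow> nat \<Rightarrow> jet_poly \<Rightarrow> jet_poly" where
  "bracket p P q Q = of_nat q * D P * Q - of_nat p * P * D Q"

text \<open>The exact quotient in the integral domain of polynomials; meaningful when \<open>Q\<close> divides \<open>P\<close>.\<close>

definition quotient :: "jet_poly \<Rightarrow> jet_poly \<Rightarrow> jet_poly" where
  "quotient P Q = (THE R. P = Q * R)"

lemma quotient_eq:
  assumes "Q \<noteq> 0" "P = Q * R"
  shows "quotient P Q = R"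
  using assms unfolding quotient_def by auto

abbreviation "f1 \<equiv> coord 1 1"

definition "\<Lambda>3 = coord 1 1 * coord 2 2 - coord 1 2 * coord 2 1"
definition "\<Lambda>5 = bracket 3 \<Lambda>3 1 f1"
definition "\<Lambda>7 = bracket 5 \<Lambda>5 1 f1"
definition "\<Lambda>9 = bracket 7 \<Lambda>7 1 f1"
definition "M8 = quotient (3 * \<Lambda>3 * \<Lambda>7 - 5 * \<Lambda>5 * \<Lambda>5) (f1 ^ 2)"
definition "M10 = bracket 8 M8 1 f1"
definition "N12 = bracket 8 M8 3 \<Lambda>3"
definition "K12 = quotient (bracket 7 \<Lambda>7 5 \<Lambda>5) f1"
definition "H14 = bracket 8 M8 5 \<Lambda>5"
definition "F16 = bracket 8 M8 7 \<Lambda>7"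
definition "X18 = quotient (- 5 * \<Lambda>9 * M10 + 56 * \<Lambda>7 * K12) f1"
definition "X19 = quotient (- 5 * M10 * M10 + 64 * M8 * K12) f1"
definition "X21 = quotient (- 5 * M10 * N12 + 8 * M8 * H14) f1"
definition "X23 = quotient (- 7 * N12 * K12 + M8 * F16) f1"
definition "X25 = quotient (- 56 * K12 * H14 + 5 * M10 * F16) f1"
definition "Y27 = quotient (- 56 * K12 * F16 + M10 * X18) f1"


section \<open>Polarizations\<close>

definition polarization_operator :: "jet_poly \<Rightarrow> jet_poly" where
  "polarization_operator =
     derivation (\<lambda>v. if component v = 1 then coord 2 (level v) else 0)"

text \<open>\<open>polarization P [i\<^sub>1, \<dots>, i\<^sub>r]\<close> is $P_{i_1,\dots,i_r}$.\<close>

definition polarization :: "jet_poly \<Rightarrow> nat list \<Rightarrow> jet_poly" where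
  "polarization P is =
     (let r = length is; s = count_list is 2
      in Const (fact (r - s) / fact r) * (polarization_operator ^^ s) P)"

definition index_lists :: "nat \<Rightarrow> nat list set" where
  "index_lists r = {is. length is = r \<and> set is \<subseteq> {1, 2}}"

text \<open>The bi-invariants, each with the number of lower indices of its polarizations.\<close>

definition bi_invariants :: "(jet_poly \<times> nat) list" where
  "bi_invariants =
     [(f1, 1), (\<Lambda>3, 0), (\<Lambda>5, 1), (\<Lambda>7, 2), (\<Lambda>9, 3), (M8, 0), (M10, 1), (K12, 2), (N12, 0),
      (H14, 1), (F16, 2), (X18, 3), (X19, 1), (X21, 0), (X23, 1), (X25, 2), (Y27, 3)]"

text \<open>
  Labels of the polarizations: the position of a bi-invariant in the list together with its lower
  indices. Different labels may name equal polynomials.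
\<close>

definition polarization_labels :: "(nat \<times> nat list) set" where
  "polarization_labels =
     (SIGMA n : {..<length bi_invariants}. index_lists (snd (bi_invariants ! n)))"

definition labelled_polarization :: "nat \<times> nat list \<Rightarrow> jet_poly" where
  "labelled_polarization = (\<lambda>(n, is). polarization (fst (bi_invariants ! n)) is)"

end

(* After clearing denominators in f1', every bi-invariant is a polynomial in f1' and the Lambdas: a reparametrization
   and a unipotent substitution bring a jet with f1' <> 0 to f1(t) = t, f2'(0) = 0, and the values there are the
   Lambdas. So it remains to show that f1' P in the algebra A of the 17 elements implies P in A. Modulo f1' A the
   relations between the generators rewrite each element of A to a combination of standard monomials, and the
   standard monomials are linearly independent on the locus f1' = 0.

   E_5 is a sum of finite-dimensional representations of sl_2, so that it is spanned by the lowerings of its highest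
   weight vectors, and these are the bi-invariants. The algebra of polarizations is closed under the lowering operator.

   For the independence, Lambda^3 and Lambda^9 are seen at jets where all other generators are constant. On a suitable
   three-parameter family of jets these two vanish, and the others become monomials whose exponents are
   indecomposable in an additive monoid. *)

theory Submission
  imports Defs
begin

section \<open>Substitution and derivations\<close>

definition mono_value :: "(jet_coord \<Rightarrow> 'a::comm_semiring_1) \<Rightarrow> (jet_coord \<Rightarrow>\<^sub>0 nat) \<Rightarrow> 'a" where
  "mono_value x m = (\<Prod>v\<in>Poly_Mapping.keys m. x v ^ Poly_Mapping.lookup m v)"

lemma mono_value_superset:
  assumes "finite S" "Poly_Mapping.keys m \<subseteq> S"
  shows "mono_value x m = (\<Prod>v\<in>S. x v ^ Poly_Mapping.lookup m v)"
  unfolding mono_value_def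
  by (rule prod.mono_neutral_left) (use assms in \<open>auto simp: in_keys_iff\<close>)

lemma mono_value_add: "mono_value x (m + n) = mono_value x m * mono_value x n"
proof -
  let ?S = "Poly_Mapping.keys m \<union> Poly_Mapping.keys n"
  have k: "Poly_Mapping.keys (m + n) \<subseteq> ?S" by (rule Poly_Mapping.keys_add)
  have "mono_value x (m + n) = (\<Prod>v\<in>?S. x v ^ Poly_Mapping.lookup (m + n) v)"
    by (rule mono_value_superset) (use k in auto)
  also have "\<dots> = (\<Prod>v\<in>?S. x v ^ Poly_Mapping.lookup m v) * (\<Prod>v\<in>?S. x v ^ Poly_Mapping.lookup n v)"
    by (simp add: lookup_add power_add prod.distrib)
  also have "\<dots> = mono_value x m * mono_value x n"
    by (simp add: mono_value_superset[symmetric])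
  finally show ?thesis .
qed

lemma mono_value_single [simp]: "mono_value x (Poly_Mapping.single v k) = x v ^ k"
  by (simp add: mono_value_def)

lemma mono_value_zero [simp]: "mono_value x 0 = 1"
  by (simp add: mono_value_def)

definition scalar_hom :: "(complex \<Rightarrow> 'a::comm_semiring_1) \<Rightarrow> bool" where
  "scalar_hom h \<longleftrightarrow> h 0 = 0 \<and> h 1 = 1 \<and> (\<forall>a b. h (a + b) = h a + h b) \<and> (\<forall>a b. h (a * b) = h a * h b)"

lemma scalar_hom_id: "scalar_hom id"
  by (simp add: scalar_hom_def)

lemma scalar_hom_Const: "scalar_hom Const"
  by (auto simp: scalar_hom_def Const_def single_add mult_single)

lemma jet_subst_superset:
  assumes "scalar_hom h" "finite S" "Poly_Mapping.keys P \<subseteq> S"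
  shows "jet_subst h x P = (\<Sum>m\<in>S. h (Poly_Mapping.lookup P m) * mono_value x m)"
  unfolding jet_subst_def mono_value_def
  by (rule sum.mono_neutral_left) (use assms in \<open>auto simp: in_keys_iff scalar_hom_def\<close>)

lemma jet_subst_add:
  assumes "scalar_hom h"
  shows "jet_subst h x (P + Q) = jet_subst h x P + jet_subst h x Q"
proof -
  let ?S = "Poly_Mapping.keys P \<union> Poly_Mapping.keys Q"
  have k: "Poly_Mapping.keys (P + Q) \<subseteq> ?S" by (rule Poly_Mapping.keys_add)
  have "jet_subst h x (P + Q) = (\<Sum>m\<in>?S. h (Poly_Mapping.lookup (P + Q) m) * mono_value x m)"
    by (rule jet_subst_superset) (use k assms in auto)
  also have "\<dots> = (\<Sum>m\<in>?S. h (Poly_Mapping.lookup P m) * mono_value x m) +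
                  (\<Sum>m\<in>?S. h (Poly_Mapping.lookup Q m) * mono_value x m)"
    using assms by (simp add: lookup_add scalar_hom_def sum.distrib distrib_right)
  also have "\<dots> = jet_subst h x P + jet_subst h x Q"
    by (simp add: jet_subst_superset[OF assms, symmetric])
  finally show ?thesis .
qed

lemma jet_subst_single:
  assumes "scalar_hom h"
  shows "jet_subst h x (Poly_Mapping.single m c) = h c * mono_value x m"
  using jet_subst_superset[OF assms, of "{m}" "Poly_Mapping.single m c" x] by simp

lemma sum_monomials:
  fixes P :: "'a \<Rightarrow>\<^sub>0 'b::comm_monoid_add"
  shows "(\<Sum>m\<in>Poly_Mapping.keys P. Poly_Mapping.single m (Poly_Mapping.lookup P m)) = P"
proof (rule poly_mapping_eqI)
  fix n
  have "Poly_Mapping.lookup (\<Sum>m\<in>Poly_Mapping.keys P. Poly_Mapping.single m (Poly_Mapping.lookup P m)) n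
     = (\<Sum>m\<in>Poly_Mapping.keys P. if m = n then Poly_Mapping.lookup P m else 0)"
    by (simp add: lookup_sum lookup_single when_def)
  also have "\<dots> = Poly_Mapping.lookup P n"
    by (simp add: sum.delta in_keys_iff)
  finally show "Poly_Mapping.lookup (\<Sum>m\<in>Poly_Mapping.keys P. Poly_Mapping.single m (Poly_Mapping.lookup P m)) n
     = Poly_Mapping.lookup P n" .
qed

lemma monomial_sum_induct [case_names monomial add]:
  fixes P :: "'a \<Rightarrow>\<^sub>0 'b::comm_monoid_add"
  assumes "\<And>m c. Q (Poly_Mapping.single m c)" "\<And>P R. Q P \<Longrightarrow> Q R \<Longrightarrow> Q (P + R)"
  shows "Q P"
proof -
  have "Q (\<Sum>m\<in>S. Poly_Mapping.single m (Poly_Mapping.lookup P m))" if "finite S" for S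
    using that by induction (use assms(1)[of undefined 0] assms in auto)
  then show ?thesis using sum_monomials[of P] by (metis finite_keys)
qed

lemma jet_subst_mult:
  assumes h: "scalar_hom h"
  shows "jet_subst h x (P * Q) = jet_subst h x P * jet_subst h x Q"
proof (induction P rule: monomial_sum_induct)
  case (monomial m c)
  show ?case
  proof (induction Q rule: monomial_sum_induct)
    case (monomial n d)
    then show ?case
      using h by (simp add: mult_single jet_subst_single mono_value_add scalar_hom_def algebra_simps)
  next
    case (add P R)
    then show ?case by (simp add: distrib_left jet_subst_add h)
  qed
next
  case (add P R)
  then show ?case by (simp add: distrib_right jet_subst_add h)
qed

lemma jet_subst_Const: "scalar_hom h \<Longrightarrow> jet_subst h x (Const c) = h c"
  by (simp add: Const_def jet_subst_single)

lemma jet_subst_coord: "scalar_hom h \<Longrightarrow> jet_subst h x (coord k l) = x (Jet k l)"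
  by (simp add: coord_def jet_subst_single scalar_hom_def)

lemma Const_0 [simp]: "Const 0 = 0" and Const_1 [simp]: "Const 1 = 1"
  by (simp_all add: Const_def)

lemma Const_add: "Const (a + b) = Const a + Const b"
  and Const_mult: "Const (a * b) = Const a * Const b"
  and Const_minus: "Const (- a) = - Const a"
  and Const_numeral: "Const (numeral n) = numeral n"
  and Const_of_nat: "Const (of_nat k) = of_nat k"
  by (simp_all add: Const_def single_add mult_single single_uminus)

lemma jet_subst_0: "scalar_hom h \<Longrightarrow> jet_subst h x 0 = 0"
  using jet_subst_Const[of h x 0] by (simp add: scalar_hom_def)

lemma jet_subst_1: "scalar_hom h \<Longrightarrow> jet_subst h x 1 = 1"
  using jet_subst_Const[of h x 1] by (simp add: scalar_hom_def)

definition ev :: "(jet_coord \<Rightarrow> complex) \<Rightarrow> jet_poly \<Rightarrow> complex" where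
  "ev = jet_subst id"

lemma ev_simps [simp]:
  "ev x (P + Q) = ev x P + ev x Q"
  "ev x (P * Q) = ev x P * ev x Q"
  "ev x (Const c) = c"
  "ev x (coord k l) = x (Jet k l)"
  "ev x 0 = 0"
  "ev x 1 = 1"
  by (simp_all add: ev_def jet_subst_add jet_subst_mult jet_subst_Const jet_subst_coord
      jet_subst_0 jet_subst_1 scalar_hom_id)

lemma ev_uminus [simp]: "ev x (- P) = - ev x P"
  using ev_simps(1)[of x P "- P"] by (simp add: add_eq_0_iff)

lemma ev_diff [simp]: "ev x (P - Q) = ev x P - ev x Q"
  using ev_simps(1)[of x P "- Q"] by simp

lemma ev_power [simp]: "ev x (P ^ n) = ev x P ^ n"
  by (induction n) auto

lemma ev_numeral [simp]: "ev x (numeral n) = numeral n"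
  by (metis Const_numeral ev_simps(3))

lemma ev_of_nat [simp]: "ev x (of_nat n) = of_nat n"
  by (metis Const_of_nat ev_simps(3))

lemma ev_sum [simp]: "ev x (sum f S) = (\<Sum>i\<in>S. ev x (f i))"
  by (induction S rule: infinite_finite_induct) auto

lemma ev_prod [simp]: "ev x (prod f S) = (\<Prod>i\<in>S. ev x (f i))"
  by (induction S rule: infinite_finite_induct) auto

lemma ev_monomials:
  "ev x P = (\<Sum>m\<in>Poly_Mapping.keys P. Poly_Mapping.lookup P m * mono_value x m)"
  by (simp add: ev_def jet_subst_def mono_value_def)

lemma ev_cong: "(\<And>v. v \<in> jet_vars P \<Longrightarrow> x v = y v) \<Longrightarrow> ev x P = ev y P"
  unfolding ev_monomials mono_value_def jet_vars_def
  by (intro sum.cong prod.cong refl arg_cong2[where f = "(*)"] arg_cong2[where f = "(^)"]) blast+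

lemma single_prod:
  "finite S \<Longrightarrow> (\<Prod>v\<in>S. Poly_Mapping.single (f v) (1::complex)) =
     Poly_Mapping.single (\<Sum>v\<in>S. f v :: jet_coord \<Rightarrow>\<^sub>0 nat) 1"
  by (induction S rule: finite_induct) (auto simp: mult_single)

lemma single_power: "(Poly_Mapping.single m (1::complex)) ^ k =
    Poly_Mapping.single (\<Sum>i<k. m :: jet_coord \<Rightarrow>\<^sub>0 nat) 1"
  by (induction k) (auto simp: mult_single add.commute)

lemma coord_power: "coord k l ^ n = Poly_Mapping.single (Poly_Mapping.single (Jet k l) n) 1"
proof -
  have "(\<Sum>i<n. Poly_Mapping.single (Jet k l) (1::nat)) = Poly_Mapping.single (Jet k l) n"
    by (induction n) (auto simp: single_add[symmetric])
  then show ?thesis by (simp add: coord_def single_power)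
qed

lemma monomial_eq_prod:
  "Poly_Mapping.single m c =
     Const c * (\<Prod>v\<in>Poly_Mapping.keys m. coord (component v) (level v) ^ Poly_Mapping.lookup m v)"
proof -
  have "(\<Prod>v\<in>Poly_Mapping.keys m. coord (component v) (level v) ^ Poly_Mapping.lookup m v) =
     Poly_Mapping.single (\<Sum>v\<in>Poly_Mapping.keys m. Poly_Mapping.single v (Poly_Mapping.lookup m v)) 1"
    by (simp add: coord_power single_prod)
  then show ?thesis by (simp add: sum_monomials Const_def mult_single)
qed

lemma generated_algebra_0 [simp]: "0 \<in> generated_algebra S"
  and generated_algebra_1 [simp]: "1 \<in> generated_algebra S"
  using generated_algebra.const[of 0 S] generated_algebra.const[of 1 S] by simp_all

lemma generated_algebra_power:
  "P \<in> generated_algebra S \<Longrightarrow> P ^ n \<in> generated_algebra S"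
  by (induction n) (simp_all add: generated_algebra.mult)

lemma generated_algebra_prod:
  "(\<And>i. i \<in> I \<Longrightarrow> f i \<in> generated_algebra S) \<Longrightarrow> prod f I \<in> generated_algebra S"
  by (induction I rule: infinite_finite_induct) (simp_all add: generated_algebra.mult)

lemma generated_algebra_sum:
  "(\<And>i. i \<in> I \<Longrightarrow> f i \<in> generated_algebra S) \<Longrightarrow> sum f I \<in> generated_algebra S"
  by (induction I rule: infinite_finite_induct) (simp_all add: generated_algebra.add)

lemma generated_algebra_uminus:
  "P \<in> generated_algebra S \<Longrightarrow> - P \<in> generated_algebra S"
  using generated_algebra.mult[OF generated_algebra.const[of "-1" S], of P]
  by (simp add: Const_minus)

lemma generated_algebra_diff:
  "P \<in> generated_algebra S \<Longrightarrow> Q \<in> generated_algebra S \<Longrightarrow> P - Q \<in> generated_algebra S"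
  using generated_algebra.add[OF _ generated_algebra_uminus, of P S Q] by simp

lemma generated_algebra_coords:
  assumes "jet_vars P \<subseteq> V"
  shows "P \<in> generated_algebra ((\<lambda>v. coord (component v) (level v)) ` V)" (is "_ \<in> ?A")
proof -
  have "Poly_Mapping.single m (Poly_Mapping.lookup P m) \<in> ?A" if "m \<in> Poly_Mapping.keys P" for m
    unfolding monomial_eq_prod
    using that assms
    by (intro generated_algebra.mult generated_algebra_prod generated_algebra_power)
       (auto simp: jet_vars_def intro!: generated_algebra.const generated_algebra.gen)
  then have "(\<Sum>m\<in>Poly_Mapping.keys P. Poly_Mapping.single m (Poly_Mapping.lookup P m)) \<in> ?A"
    by (rule generated_algebra_sum)
  then show ?thesis by (simp add: sum_monomials)
qed

lemma jet_poly_induct [case_names const coord add mult]: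
  assumes "\<And>c. Q (Const c)" "\<And>k l. Q (coord k l)"
    "\<And>P R. Q P \<Longrightarrow> Q R \<Longrightarrow> Q (P + R)" "\<And>P R. Q P \<Longrightarrow> Q R \<Longrightarrow> Q (P * R)"
  shows "Q P"
proof -
  have "P \<in> generated_algebra ((\<lambda>v. coord (component v) (level v)) ` UNIV)"
    by (rule generated_algebra_coords) simp
  then show ?thesis by induction (use assms in auto)
qed

lemma ev_jet_subst: "ev x (jet_subst Const y P) = ev (\<lambda>v. ev x (y v)) P"
  by (induction P rule: jet_poly_induct)
     (simp_all add: jet_subst_add jet_subst_mult jet_subst_Const jet_subst_coord scalar_hom_Const)

lemma jet_vars_add: "jet_vars (P + Q) \<subseteq> jet_vars P \<union> jet_vars Q"
  using Poly_Mapping.keys_add[of P Q] by (auto simp: jet_vars_def)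

lemma jet_vars_mult: "jet_vars (P * Q) \<subseteq> jet_vars P \<union> jet_vars Q"
proof
  fix v assume "v \<in> jet_vars (P * Q)"
  then obtain m where m: "m \<in> Poly_Mapping.keys (P * Q)" "v \<in> Poly_Mapping.keys m"
    by (auto simp: jet_vars_def)
  then obtain a b where "m = a + b" "a \<in> Poly_Mapping.keys P" "b \<in> Poly_Mapping.keys Q"
    using keys_mult[of P Q] by auto
  then show "v \<in> jet_vars P \<union> jet_vars Q"
    using m Poly_Mapping.keys_add[of a b] by (auto simp: jet_vars_def)
qed

lemma jet_vars_Const [simp]: "jet_vars (Const c) = {}"
  by (auto simp: jet_vars_def Const_def split: if_splits)

lemma jet_vars_coord [simp]: "jet_vars (coord k l) = {Jet k l}"
  by (auto simp: jet_vars_def coord_def split: if_splits)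

lemma finite_jet_vars [simp]: "finite (jet_vars P)"
  by (simp add: jet_vars_def)

lemma partial_single:
  "partial v (Poly_Mapping.single m c) =
     Poly_Mapping.single (m - Poly_Mapping.single v 1) (of_nat (Poly_Mapping.lookup m v) * c)"
  by (cases "c = 0") (simp_all add: partial_def)

lemma partial_superset:
  assumes "finite S" "Poly_Mapping.keys P \<subseteq> S"
  shows "partial v P = (\<Sum>m\<in>S. Poly_Mapping.single (m - Poly_Mapping.single v 1)
          (of_nat (Poly_Mapping.lookup m v) * Poly_Mapping.lookup P m))"
  unfolding partial_def
  by (rule sum.mono_neutral_left) (use assms in \<open>auto simp: in_keys_iff\<close>)

lemma partial_add: "partial v (P + Q) = partial v P + partial v Q"
proof -
  let ?S = "Poly_Mapping.keys P \<union> Poly_Mapping.keys Q"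
  have "Poly_Mapping.keys (P + Q) \<subseteq> ?S" by (rule Poly_Mapping.keys_add)
  then show ?thesis
    by (simp add: partial_superset[of ?S] lookup_add distrib_left single_add sum.distrib)
qed

lemma partial_mult: "partial v (P * Q) = partial v P * Q + P * partial v Q"
proof (induction P rule: monomial_sum_induct)
  case (monomial m c)
  show ?case
  proof (induction Q rule: monomial_sum_induct)
    case (monomial n d)
    let ?e = "Poly_Mapping.single v (1::nat)"
    have 1: "Poly_Mapping.lookup m v \<noteq> 0 \<Longrightarrow> m - ?e + n = m + n - ?e"
      and 2: "Poly_Mapping.lookup n v \<noteq> 0 \<Longrightarrow> m + (n - ?e) = m + n - ?e"
      by (auto intro!: poly_mapping_eqI simp: lookup_add lookup_minus lookup_single when_def)
    have "partial v (Poly_Mapping.single m c * Poly_Mapping.single n d)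
       = Poly_Mapping.single (m + n - ?e) (of_nat (Poly_Mapping.lookup m v) * c * d)
       + Poly_Mapping.single (m + n - ?e) (c * (of_nat (Poly_Mapping.lookup n v) * d))"
      by (simp add: mult_single partial_single lookup_add single_add[symmetric] algebra_simps)
    also have "\<dots> = partial v (Poly_Mapping.single m c) * Poly_Mapping.single n d +
                     Poly_Mapping.single m c * partial v (Poly_Mapping.single n d)"
      using 1 2
      by (cases "Poly_Mapping.lookup m v = 0"; cases "Poly_Mapping.lookup n v = 0")
         (simp_all add: mult_single partial_single)
    finally show ?case .
  next
    case (add P R)
    then show ?case by (simp add: distrib_left partial_add)
  qed
next
  case (add P R)
  then show ?case by (simp add: distrib_right partial_add)
qed

lemma partial_eq_0: "v \<notin> jet_vars P \<Longrightarrow> partial v P = 0"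
  by (auto simp: partial_def jet_vars_def in_keys_iff intro!: sum.neutral)

lemma derivation_superset:
  assumes "finite S" "jet_vars P \<subseteq> S"
  shows "derivation g P = (\<Sum>v\<in>S. g v * partial v P)"
  unfolding derivation_def
  by (rule sum.mono_neutral_left) (use assms partial_eq_0 in auto)

lemma derivation_add: "derivation g (P + Q) = derivation g P + derivation g Q"
proof -
  let ?S = "jet_vars P \<union> jet_vars Q"
  show ?thesis
    using jet_vars_add[of P Q]
    by (simp add: derivation_superset[of ?S] partial_add distrib_left sum.distrib)
qed

lemma derivation_mult: "derivation g (P * Q) = derivation g P * Q + P * derivation g Q"
proof -
  let ?S = "jet_vars P \<union> jet_vars Q"
  show ?thesis
    using jet_vars_mult[of P Q]
    by (simp add: derivation_superset[of ?S] partial_mult algebra_simps sum.distrib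
        sum_distrib_left sum_distrib_right)
qed

lemma derivation_Const [simp]: "derivation g (Const c) = 0"
  by (simp add: derivation_def)

lemma derivation_coord [simp]: "derivation g (coord k l) = g (Jet k l)"
  by (simp add: derivation_def) (simp add: coord_def partial_single)

lemma derivation_0 [simp]: "derivation g 0 = 0"
  and derivation_1 [simp]: "derivation g 1 = 0"
  and derivation_numeral [simp]: "derivation g (numeral n) = 0"
  and derivation_of_nat [simp]: "derivation g (of_nat k) = 0"
  using derivation_Const[of g 0] derivation_Const[of g 1] derivation_Const[of g "numeral n"]
    derivation_Const[of g "of_nat k"]
  by (simp_all add: Const_numeral Const_of_nat del: derivation_Const)

lemma derivation_uminus: "derivation g (- P) = - derivation g P"
  using derivation_add[of g P "- P"] by (simp add: add_eq_0_iff)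

lemma derivation_diff: "derivation g (P - Q) = derivation g P - derivation g Q"
  using derivation_add[of g P "- Q"] by (simp add: derivation_uminus)

lemma derivation_sum: "derivation g (sum f S) = (\<Sum>i\<in>S. derivation g (f i))"
  by (induction S rule: infinite_finite_induct) (auto simp: derivation_add)

lemma has_field_derivative_ev:
  assumes "\<And>v. v \<in> jet_vars P \<Longrightarrow>
      ((\<lambda>t. X t v) has_field_derivative ev (X t0) (g v)) (at t0)"
  shows "((\<lambda>t. ev (X t) P) has_field_derivative ev (X t0) (derivation g P)) (at t0)"
proof -
  have *: "((\<lambda>t. ev (X t) Q) has_field_derivative ev (X t0) (derivation g Q)) (at t0)"
    if "\<And>k l. ((\<lambda>t. X t (Jet k l)) has_field_derivative ev (X t0) (g (Jet k l))) (at t0)"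
    for X :: "complex \<Rightarrow> jet_coord \<Rightarrow> complex" and g Q
    by (induction Q rule: jet_poly_induct)
       (auto simp: derivation_add derivation_mult that intro!: derivative_eq_intros)
  define Y where "Y t v = (if v \<in> jet_vars P then X t v else 0)" for t v
  define h where "h v = (if v \<in> jet_vars P then Const (ev (X t0) (g v)) else 0)" for v
  have "((\<lambda>t. ev (Y t) P) has_field_derivative ev (Y t0) (derivation h P)) (at t0)"
    by (rule *) (auto simp: Y_def h_def assms)
  moreover have "ev (Y t) P = ev (X t) P" for t
    by (rule ev_cong) (simp add: Y_def)
  moreover have "ev (Y t0) (derivation h P) = ev (X t0) (derivation g P)"
  proof -
    have p: "jet_vars (partial v P) \<subseteq> jet_vars P" for v
    proof -
      have "Poly_Mapping.keys (partial v P) \<subseteq> (\<lambda>m. m - Poly_Mapping.single v 1) ` Poly_Mapping.keys P"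
        unfolding partial_def by (rule order_trans[OF Poly_Mapping.keys_sum]) (auto split: if_splits)
      moreover have "Poly_Mapping.keys (m - Poly_Mapping.single v (1::nat)) \<subseteq> Poly_Mapping.keys m" for m
        by (auto simp: in_keys_iff lookup_minus)
      ultimately show ?thesis unfolding jet_vars_def by blast
    qed
    have "ev (Y t0) (partial v P) = ev (X t0) (partial v P)" for v
      by (rule ev_cong) (use p in \<open>auto simp: Y_def\<close>)
    then show ?thesis by (simp add: derivation_def h_def)
  qed
  ultimately show ?thesis by simp
qed

lemma continuous_ev:
  assumes "\<And>v. isCont (\<lambda>t. X t v) t0"
  shows "isCont (\<lambda>t. ev (X t) P) t0"
  by (induction P rule: jet_poly_induct) (auto intro!: continuous_intros assms)

subsection \<open>Polynomials are determined by their values\<close>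

lemma separate_exponents:
  fixes a :: "'i \<Rightarrow> complex"
  assumes "finite I" "finite F" "\<And>z. z \<notin> F \<Longrightarrow> (\<Sum>i\<in>I. z ^ e i * a i) = 0"
  shows "(\<Sum>i | i \<in> I \<and> e i = n. a i) = 0"
proof -
  define N where "N = (if I = {} then 0 else Max (e ` I)) + n"
  define c where "c k = (\<Sum>i | i \<in> I \<and> e i = k. a i)" for k
  have eN: "e i \<le> N" if "i \<in> I" for i
  proof -
    have "e i \<le> Max (e ` I)" using that assms(1) by simp
    then show ?thesis using that by (auto simp: N_def)
  qed
  have sum_eq: "(\<Sum>k\<le>N. c k * z ^ k) = (\<Sum>i\<in>I. z ^ e i * a i)" for z
  proof -
    have "c k * z ^ k = (\<Sum>i | i \<in> I \<and> e i = k. z ^ e i * a i)" for k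
      unfolding c_def sum_distrib_right by (rule sum.cong) (auto simp: mult.commute)
    then have "(\<Sum>k\<le>N. c k * z ^ k) = (\<Sum>k\<le>N. \<Sum>i | i \<in> I \<and> e i = k. z ^ e i * a i)"
      by simp
    also have "\<dots> = (\<Sum>i\<in>I. z ^ e i * a i)"
      by (rule sum.group) (use assms(1) eN in auto)
    finally show ?thesis .
  qed
  have "c n = 0"
  proof (rule ccontr)
    assume "c n \<noteq> 0"
    then have "finite {z. (\<Sum>k\<le>N. c k * z ^ k) = 0}"
      by (subst polyfun_finite_roots) (auto simp: N_def)
    moreover have "UNIV - F \<subseteq> {z::complex. (\<Sum>k\<le>N. c k * z ^ k) = 0}"
      using assms(3) sum_eq by auto
    ultimately have "finite (UNIV - F)" using finite_subset by blast
    then have "finite (UNIV :: complex set)" using assms(2) by simp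
    then show False using infinite_UNIV_char_0 by blast
  qed
  then show ?thesis by (simp add: c_def)
qed

lemma exists_separating_weight:
  assumes "finite V" "finite M" "\<And>m. m \<in> M \<Longrightarrow> Poly_Mapping.keys m \<subseteq> V"
  shows "\<exists>w::jet_coord \<Rightarrow> nat. inj_on (\<lambda>m. \<Sum>v\<in>V. Poly_Mapping.lookup m v * w v) M"
  using assms
proof (induction V arbitrary: M rule: finite_induct)
  case empty
  then have "M \<subseteq> {0}" by auto
  then show ?case by (auto simp: inj_on_def)
next
  case (insert u V)
  define r where "r m = m - Poly_Mapping.single u (Poly_Mapping.lookup m u)" for m :: "jet_coord \<Rightarrow>\<^sub>0 nat"
  have r: "Poly_Mapping.lookup (r m) v = (if v = u then 0 else Poly_Mapping.lookup m v)" for m v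
    by (auto simp: r_def lookup_minus lookup_single when_def)
  have "\<exists>w::jet_coord \<Rightarrow> nat. inj_on (\<lambda>m. \<Sum>v\<in>V. Poly_Mapping.lookup m v * w v) (r ` M)"
  proof (rule insert.IH)
    show "finite (r ` M)" using insert.prems(1) by simp
    fix n assume "n \<in> r ` M"
    then obtain m where m: "m \<in> M" "n = r m" by blast
    have "Poly_Mapping.keys (r m) \<subseteq> Poly_Mapping.keys m - {u}"
      by (auto simp: in_keys_iff r split: if_splits)
    then show "Poly_Mapping.keys n \<subseteq> V" using insert.prems(2)[OF m(1)] m(2) by blast
  qed
  then obtain w :: "jet_coord \<Rightarrow> nat"
    where w: "inj_on (\<lambda>m. \<Sum>v\<in>V. Poly_Mapping.lookup m v * w v) (r ` M)" by blast
  define s where "s m = (\<Sum>v\<in>V. Poly_Mapping.lookup m v * w v)" for m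
  have sr: "s (r m) = s m" for m
    unfolding s_def by (rule sum.cong) (use insert.hyps r in auto)
  define B where "B = Suc (\<Sum>m\<in>M. s m)"
  have sB: "s m < B" if "m \<in> M" for m
    using member_le_sum[OF that, of s] insert.prems(1) by (simp add: B_def less_Suc_eq_le)
  have val: "(\<Sum>v\<in>insert u V. Poly_Mapping.lookup m v * (w(u := B)) v) = Poly_Mapping.lookup m u * B + s m" for m
  proof -
    have "(\<Sum>v\<in>V. Poly_Mapping.lookup m v * (w(u := B)) v) = s m"
      unfolding s_def by (rule sum.cong) (use insert.hyps in auto)
    then show ?thesis using insert.hyps by simp
  qed
  have "inj_on (\<lambda>m. \<Sum>v\<in>insert u V. Poly_Mapping.lookup m v * (w(u := B)) v) M"
  proof (rule inj_onI)
    fix m n assume mn: "m \<in> M" "n \<in> M"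
      and "(\<Sum>v\<in>insert u V. Poly_Mapping.lookup m v * (w(u := B)) v) =
        (\<Sum>v\<in>insert u V. Poly_Mapping.lookup n v * (w(u := B)) v)"
    then have eq: "Poly_Mapping.lookup m u * B + s m = Poly_Mapping.lookup n u * B + s n"
      by (simp only: val)
    have B0: "B \<noteq> 0" by (simp add: B_def)
    have "(Poly_Mapping.lookup m u * B + s m) div B = Poly_Mapping.lookup m u"
      "(Poly_Mapping.lookup n u * B + s n) div B = Poly_Mapping.lookup n u"
      using sB[OF mn(1)] sB[OF mn(2)] B0 by simp_all
    then have u: "Poly_Mapping.lookup m u = Poly_Mapping.lookup n u" using eq by simp
    then have "s m = s n" using eq by simp
    then have "s (r m) = s (r n)" by (simp only: sr)
    then have "(\<Sum>v\<in>V. Poly_Mapping.lookup (r m) v * w v) = (\<Sum>v\<in>V. Poly_Mapping.lookup (r n) v * w v)"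
      by (simp only: s_def)
    then have "r m = r n"
      by (rule inj_onD[OF w]) (use mn in blast)+
    then have "Poly_Mapping.lookup m v = Poly_Mapping.lookup n v" for v
      using u r[of m v] r[of n v] \<open>r m = r n\<close> by (cases "v = u") auto
    then show "m = n" by (rule poly_mapping_eqI)
  qed
  then show ?case by blast
qed

lemma ev_eq_0_imp:
  assumes "\<And>x. ev x P = 0"
  shows "P = 0"
proof -
  obtain w :: "jet_coord \<Rightarrow> nat" where
    w: "inj_on (\<lambda>m. \<Sum>v\<in>jet_vars P. Poly_Mapping.lookup m v * w v) (Poly_Mapping.keys P)"
    using exists_separating_weight[of "jet_vars P" "Poly_Mapping.keys P"]
    by (auto simp: jet_vars_def)
  define s where "s m = (\<Sum>v\<in>jet_vars P. Poly_Mapping.lookup m v * w v)" for m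
  have mv: "mono_value (\<lambda>v. z ^ w v) m = z ^ s m" if "m \<in> Poly_Mapping.keys P" for z :: complex and m
  proof -
    have "mono_value (\<lambda>v. z ^ w v) m = (\<Prod>v\<in>jet_vars P. (z ^ w v) ^ Poly_Mapping.lookup m v)"
      by (rule mono_value_superset) (use that in \<open>auto simp: jet_vars_def\<close>)
    also have "\<dots> = (\<Prod>v\<in>jet_vars P. z ^ (Poly_Mapping.lookup m v * w v))"
      by (simp only: power_mult[symmetric] mult.commute)
    also have "\<dots> = z ^ s m" by (simp add: s_def power_sum)
    finally show ?thesis .
  qed
  have "(\<Sum>m\<in>Poly_Mapping.keys P. z ^ s m * Poly_Mapping.lookup P m) = 0" for z
  proof -
    have "ev (\<lambda>v. z ^ w v) P = (\<Sum>m\<in>Poly_Mapping.keys P. z ^ s m * Poly_Mapping.lookup P m)"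
      unfolding ev_monomials by (rule sum.cong) (simp_all add: mv)
    then show ?thesis using assms by simp
  qed
  then have *: "(\<Sum>i | i \<in> Poly_Mapping.keys P \<and> s i = n. Poly_Mapping.lookup P i) = 0" for n
    by (intro separate_exponents[where F = "{}"]) auto
  have "Poly_Mapping.keys P = {}"
  proof (rule ccontr)
    assume "Poly_Mapping.keys P \<noteq> {}"
    then obtain m where m: "m \<in> Poly_Mapping.keys P" by blast
    have "{i \<in> Poly_Mapping.keys P. s i = s m} = {m}"
      using m w by (auto simp: s_def inj_on_def)
    with *[of "s m"] m show False by (simp add: in_keys_iff)
  qed
  then show ?thesis by simp
qed

lemma ev_eqI: "(\<And>x. ev x P = ev x Q) \<Longrightarrow> P = Q"
  using ev_eq_0_imp[of "P - Q"] by simp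

lemma ev_eqI_nonzero:
  assumes "R \<noteq> 0" "\<And>x. ev x R \<noteq> 0 \<Longrightarrow> ev x P = ev x Q"
  shows "P = Q"
proof -
  have "R * (P - Q) = 0"
    by (rule ev_eq_0_imp) (use assms(2) in auto)
  then show ?thesis using assms(1) by simp
qed

section \<open>Invariance under reparametrization\<close>

lemma jet_ring_iff: "P \<in> jet_ring \<kappa> \<longleftrightarrow> (\<forall>v\<in>jet_vars P. component v \<in> {1, 2} \<and> level v \<in> {1..\<kappa>})"
proof -
  have "{Jet k l |k l. k \<in> {1, 2} \<and> l \<in> {1..\<kappa>}} = {v. component v \<in> {1, 2} \<and> level v \<in> {1..\<kappa>}}"
    by (auto, (metis jet_coord.exhaust_sel)+)
  then show ?thesis by (auto simp: jet_ring_def)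
qed

lemma jet_ring_Const: "Const c \<in> jet_ring \<kappa>"
  and jet_ring_add: "P \<in> jet_ring \<kappa> \<Longrightarrow> Q \<in> jet_ring \<kappa> \<Longrightarrow> P + Q \<in> jet_ring \<kappa>"
  and jet_ring_mult: "P \<in> jet_ring \<kappa> \<Longrightarrow> Q \<in> jet_ring \<kappa> \<Longrightarrow> P * Q \<in> jet_ring \<kappa>"
  and jet_ring_coord: "k \<in> {1, 2} \<Longrightarrow> l \<in> {1..\<kappa>} \<Longrightarrow> coord k l \<in> jet_ring \<kappa>"
  and jet_ring_mono: "\<kappa> \<le> \<kappa>' \<Longrightarrow> P \<in> jet_ring \<kappa> \<Longrightarrow> P \<in> jet_ring \<kappa>'"
  using jet_vars_add[of P Q] jet_vars_mult[of P Q] unfolding jet_ring_iff by fastforce+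

lemma jet_ring_0: "0 \<in> jet_ring \<kappa>"
  and jet_ring_1: "1 \<in> jet_ring \<kappa>"
  and jet_ring_numeral: "numeral n \<in> jet_ring \<kappa>"
  and jet_ring_of_nat: "of_nat k \<in> jet_ring \<kappa>"
  using jet_ring_Const[of 0] jet_ring_Const[of 1] jet_ring_Const[of "numeral n"] jet_ring_Const[of "of_nat k"]
  by (simp_all add: Const_numeral Const_of_nat)

lemma jet_ring_uminus: "P \<in> jet_ring \<kappa> \<Longrightarrow> - P \<in> jet_ring \<kappa>"
  using jet_ring_mult[OF jet_ring_Const[of "-1"], of P] by (simp add: Const_minus)

lemma jet_ring_diff: "P \<in> jet_ring \<kappa> \<Longrightarrow> Q \<in> jet_ring \<kappa> \<Longrightarrow> P - Q \<in> jet_ring \<kappa>"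
  using jet_ring_add[OF _ jet_ring_uminus, of P \<kappa> Q] by simp

lemma jet_ring_power: "P \<in> jet_ring \<kappa> \<Longrightarrow> P ^ n \<in> jet_ring \<kappa>"
  by (induction n) (auto intro: jet_ring_mult jet_ring_1)

lemma jet_ring_sum: "(\<And>i. i \<in> I \<Longrightarrow> f i \<in> jet_ring \<kappa>) \<Longrightarrow> sum f I \<in> jet_ring \<kappa>"
  by (induction I rule: infinite_finite_induct) (auto intro: jet_ring_add jet_ring_0)

lemmas jet_ring_intros = jet_ring_Const jet_ring_add jet_ring_mult jet_ring_0 jet_ring_1
  jet_ring_numeral jet_ring_of_nat jet_ring_uminus jet_ring_diff jet_ring_power

lemma jet_ring_derivation:
  assumes "P \<in> jet_ring \<kappa>" "\<kappa> \<le> \<kappa>'"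
    and "\<And>k l. k \<in> {1, 2} \<Longrightarrow> l \<in> {1..\<kappa>} \<Longrightarrow> g (Jet k l) \<in> jet_ring \<kappa>'"
  shows "derivation g P \<in> jet_ring \<kappa>'"
proof -
  let ?V = "{v. component v \<in> {1, 2} \<and> level v \<in> {1..\<kappa>}}"
  have "P \<in> generated_algebra ((\<lambda>v. coord (component v) (level v)) ` ?V)"
    using assms(1) by (intro generated_algebra_coords) (auto simp: jet_ring_iff)
  then have "P \<in> jet_ring \<kappa>' \<and> derivation g P \<in> jet_ring \<kappa>'"
  proof induction
    case (gen P)
    then show ?case
      using assms(2,3) by (auto intro!: jet_ring_coord)
  qed (auto intro: jet_ring_intros simp: derivation_add derivation_mult)
  then show ?thesis ..
qed

lemma jet_ring_D: "P \<in> jet_ring \<kappa> \<Longrightarrow> D P \<in> jet_ring (Suc \<kappa>)"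
  unfolding D_def by (rule jet_ring_derivation[of _ \<kappa>]) (auto intro!: jet_ring_coord)

lemma jet_ring_bracket:
  "P \<in> jet_ring \<kappa> \<Longrightarrow> Q \<in> jet_ring \<kappa> \<Longrightarrow> bracket p P q Q \<in> jet_ring (Suc \<kappa>)"
  unfolding bracket_def
  by (intro jet_ring_intros jet_ring_D jet_ring_mono[of \<kappa> "Suc \<kappa>"]) auto

definition faa_di_bruno :: "(nat \<Rightarrow> complex) \<Rightarrow> (nat \<Rightarrow> complex) \<Rightarrow> nat \<Rightarrow> complex" where
  "faa_di_bruno y p l =
    (if l = 1 then y 1 * p 1
     else if l = 2 then y 2 * p 1 ^ 2 + y 1 * p 2
     else if l = 3 then y 3 * p 1 ^ 3 + 3 * y 2 * p 1 * p 2 + y 1 * p 3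
     else if l = 4 then y 4 * p 1 ^ 4 + 6 * y 3 * p 1 ^ 2 * p 2 + y 2 * (4 * p 1 * p 3 + 3 * p 2 ^ 2) + y 1 * p 4
     else if l = 5 then y 5 * p 1 ^ 5 + 10 * y 4 * p 1 ^ 3 * p 2 + y 3 * (10 * p 1 ^ 2 * p 3 + 15 * p 1 * p 2 ^ 2)
        + y 2 * (5 * p 1 * p 4 + 10 * p 2 * p 3) + y 1 * p 5
     else 0)"

definition compose_jet :: "(jet_coord \<Rightarrow> complex) \<Rightarrow> (nat \<Rightarrow> complex) \<Rightarrow> jet_coord \<Rightarrow> complex" where
  "compose_jet x p v = faa_di_bruno (\<lambda>l. x (Jet (component v) l)) p (level v)"

lemma deriv_eq_on_open:
  assumes "open U" "\<And>t. t \<in> U \<Longrightarrow> h t = g t" "\<And>t. t \<in> U \<Longrightarrow> (g has_field_derivative g' t) (at t)" "t \<in> U"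
  shows "deriv h t = g' t"
proof (rule DERIV_imp_deriv)
  show "(h has_field_derivative g' t) (at t)"
    by (rule has_field_derivative_transform_within_open[OF assms(3)[OF assms(4)] assms(1,4)]) (simp add: assms(2))
qed

lemma higher_deriv_DERIV:
  assumes "f holomorphic_on V" "open V" "t \<in> V"
  shows "((deriv ^^ i) f has_field_derivative (deriv ^^ Suc i) f t) (at t)"
  using holomorphic_derivI[OF holomorphic_higher_deriv[OF assms(1,2)] assms(2,3)] by simp

lemma faa_di_bruno_deriv:
  assumes U: "open U" "\<phi> holomorphic_on U" and V: "open V" "f holomorphic_on V" and sub: "\<phi> ` U \<subseteq> V"
    and t: "t \<in> U" and l: "l \<in> {1..5}"
  shows "(deriv ^^ l) (f \<circ> \<phi>) t = faa_di_bruno (\<lambda>i. (deriv ^^ i) f (\<phi> t)) (\<lambda>i. (deriv ^^ i) \<phi> t) l"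
proof -
  define F where "F i = (deriv ^^ i) f" for i
  define G where "G i = (deriv ^^ i) \<phi>" for i
  have G: "(G i has_field_derivative G (Suc i) s) (at s)" if "s \<in> U" for i s
    unfolding G_def by (rule higher_deriv_DERIV) (use U that in auto)
  have F: "((\<lambda>s. F i (\<phi> s)) has_field_derivative F (Suc i) (\<phi> s) * G 1 s) (at s)" if "s \<in> U" for i s
  proof -
    have "(F i has_field_derivative F (Suc i) (\<phi> s)) (at (\<phi> s))"
      unfolding F_def by (rule higher_deriv_DERIV) (use V that sub in auto)
    moreover have "(\<phi> has_field_derivative G 1 s) (at s)" using G[OF that, of 0] by (simp add: G_def)
    ultimately show ?thesis by (rule DERIV_chain2)
  qed
  have F': "((\<lambda>s. F 1 (\<phi> s)) has_field_derivative F 2 (\<phi> s) * G 1 s) (at s)"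
    "((\<lambda>s. F 2 (\<phi> s)) has_field_derivative F 3 (\<phi> s) * G 1 s) (at s)"
    "((\<lambda>s. F 3 (\<phi> s)) has_field_derivative F 4 (\<phi> s) * G 1 s) (at s)"
    "((\<lambda>s. F 4 (\<phi> s)) has_field_derivative F 5 (\<phi> s) * G 1 s) (at s)"
    "(G 1 has_field_derivative G 2 s) (at s)" "(G 2 has_field_derivative G 3 s) (at s)"
    "(G 3 has_field_derivative G 4 s) (at s)" "(G 4 has_field_derivative G 5 s) (at s)"
    if "s \<in> U" for s
    using F[OF that, of 1] F[OF that, of 2] F[OF that, of 3] F[OF that, of 4]
      G[OF that, of 1] G[OF that, of 2] G[OF that, of 3] G[OF that, of 4]
    by (simp_all add: eval_nat_numeral)
  have 1: "deriv (f \<circ> \<phi>) s = F 1 (\<phi> s) * G 1 s" if "s \<in> U" for s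
    by (rule deriv_eq_on_open[OF U(1) _ _ that, of _ "\<lambda>s. F 0 (\<phi> s)"])
       (use F[of _ 0] in \<open>simp_all add: F_def\<close>)
  have 2: "(deriv ^^ 2) (f \<circ> \<phi>) s = F 2 (\<phi> s) * G 1 s ^ 2 + F 1 (\<phi> s) * G 2 s" if "s \<in> U" for s
  proof -
    have "(deriv ^^ 2) (f \<circ> \<phi>) s = deriv (deriv (f \<circ> \<phi>)) s" by (simp add: numeral_2_eq_2)
    also have "\<dots> = F 2 (\<phi> s) * G 1 s ^ 2 + F 1 (\<phi> s) * G 2 s"
      by (rule deriv_eq_on_open[OF U(1) 1 _ that], assumption)
         ((rule F' derivative_eq_intros refl | assumption)+, simp add: algebra_simps power2_eq_square)
    finally show ?thesis .
  qed
  have 3: "(deriv ^^ 3) (f \<circ> \<phi>) s = F 3 (\<phi> s) * G 1 s ^ 3 + 3 * F 2 (\<phi> s) * G 1 s * G 2 s + F 1 (\<phi> s) * G 3 s"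
    if "s \<in> U" for s
  proof -
    have "(deriv ^^ 3) (f \<circ> \<phi>) s = deriv ((deriv ^^ 2) (f \<circ> \<phi>)) s" by (simp add: numeral_eq_Suc)
    also have "\<dots> = F 3 (\<phi> s) * G 1 s ^ 3 + 3 * F 2 (\<phi> s) * G 1 s * G 2 s + F 1 (\<phi> s) * G 3 s"
      by (rule deriv_eq_on_open[OF U(1) 2 _ that], assumption)
         ((rule F' derivative_eq_intros refl | assumption)+, simp add: algebra_simps power_numeral_reduce)
    finally show ?thesis .
  qed
  have 4: "(deriv ^^ 4) (f \<circ> \<phi>) s = F 4 (\<phi> s) * G 1 s ^ 4 + 6 * F 3 (\<phi> s) * G 1 s ^ 2 * G 2 s
      + F 2 (\<phi> s) * (4 * G 1 s * G 3 s + 3 * G 2 s ^ 2) + F 1 (\<phi> s) * G 4 s"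
    if "s \<in> U" for s
  proof -
    have "(deriv ^^ 4) (f \<circ> \<phi>) s = deriv ((deriv ^^ 3) (f \<circ> \<phi>)) s" by (simp add: numeral_eq_Suc)
    also have "\<dots> = F 4 (\<phi> s) * G 1 s ^ 4 + 6 * F 3 (\<phi> s) * G 1 s ^ 2 * G 2 s
      + F 2 (\<phi> s) * (4 * G 1 s * G 3 s + 3 * G 2 s ^ 2) + F 1 (\<phi> s) * G 4 s"
      by (rule deriv_eq_on_open[OF U(1) 3 _ that], assumption)
         ((rule F' derivative_eq_intros refl | assumption)+, simp add: algebra_simps power_numeral_reduce)
    finally show ?thesis .
  qed
  have 5: "(deriv ^^ 5) (f \<circ> \<phi>) s = F 5 (\<phi> s) * G 1 s ^ 5 + 10 * F 4 (\<phi> s) * G 1 s ^ 3 * G 2 s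
      + F 3 (\<phi> s) * (10 * G 1 s ^ 2 * G 3 s + 15 * G 1 s * G 2 s ^ 2)
      + F 2 (\<phi> s) * (5 * G 1 s * G 4 s + 10 * G 2 s * G 3 s) + F 1 (\<phi> s) * G 5 s"
    if "s \<in> U" for s
  proof -
    have "(deriv ^^ 5) (f \<circ> \<phi>) s = deriv ((deriv ^^ 4) (f \<circ> \<phi>)) s" by (simp add: numeral_eq_Suc)
    also have "\<dots> = F 5 (\<phi> s) * G 1 s ^ 5 + 10 * F 4 (\<phi> s) * G 1 s ^ 3 * G 2 s
      + F 3 (\<phi> s) * (10 * G 1 s ^ 2 * G 3 s + 15 * G 1 s * G 2 s ^ 2)
      + F 2 (\<phi> s) * (5 * G 1 s * G 4 s + 10 * G 2 s * G 3 s) + F 1 (\<phi> s) * G 5 s"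
      by (rule deriv_eq_on_open[OF U(1) 4 _ that], assumption)
         ((rule F' derivative_eq_intros refl | assumption)+, simp add: algebra_simps power_numeral_reduce)
    finally show ?thesis .
  qed
  have "l = 1 \<or> l = 2 \<or> l = 3 \<or> l = 4 \<or> l = 5" using l by auto
  then show ?thesis
    using 1[OF t] 2[OF t] 3[OF t] 4[OF t] 5[OF t]
    by (elim disjE) (simp_all add: faa_di_bruno_def F_def G_def)
qed

lemma biholomorphism_neighbourhoods:
  assumes "\<forall>k\<in>{1, 2}. f k analytic_on {0}" "local_biholomorphism \<phi>"
  obtains U V where "open U" "0 \<in> U" "open V" "\<phi> holomorphic_on U" "\<phi> ` U \<subseteq> V"
    "\<And>k. k \<in> {1, 2} \<Longrightarrow> f k holomorphic_on V" "\<And>t. t \<in> U \<Longrightarrow> deriv \<phi> t \<noteq> 0"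
proof -
  obtain A B \<psi> where AB: "\<phi> 0 = 0" "open A" "0 \<in> A" "open B" "\<phi> holomorphic_on A" "\<psi> holomorphic_on B"
    "\<forall>z\<in>A. \<phi> z \<in> B \<and> \<psi> (\<phi> z) = z"
    using assms(2) unfolding local_biholomorphism_def by blast
  obtain V1 V2 where V: "open V1" "{0} \<subseteq> V1" "f 1 holomorphic_on V1" "open V2" "{0} \<subseteq> V2" "f 2 holomorphic_on V2"
    using assms(1) by (auto simp: analytic_on_holomorphic)
  define U where "U = A \<inter> \<phi> -` (V1 \<inter> V2)"
  show thesis
  proof
    show "open U" unfolding U_def
      using AB(2,5) V by (intro continuous_open_preimage holomorphic_on_imp_continuous_on) auto
    show "0 \<in> U" using AB V by (auto simp: U_def)
    show "open (V1 \<inter> V2)" using V by auto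
    show "\<phi> holomorphic_on U" using AB(5) by (rule holomorphic_on_subset) (auto simp: U_def)
    show "\<phi> ` U \<subseteq> V1 \<inter> V2" by (auto simp: U_def)
    show "f k holomorphic_on V1 \<inter> V2" if "k \<in> {1, 2}" for k
      using that V(3,6) by (auto intro: holomorphic_on_subset)
    show "deriv \<phi> t \<noteq> 0" if "t \<in> U" for t
    proof
      assume d: "deriv \<phi> t = 0"
      have t: "t \<in> A" using that by (simp add: U_def)
      have "(\<phi> has_field_derivative 0) (at t)"
        using holomorphic_derivI[OF AB(5,2) t] d by simp
      moreover have "(\<psi> has_field_derivative deriv \<psi> (\<phi> t)) (at (\<phi> t))"
        using holomorphic_derivI[OF AB(6,4)] AB(7) t by blast
      ultimately have "((\<lambda>z. \<psi> (\<phi> z)) has_field_derivative deriv \<psi> (\<phi> t) * 0) (at t)"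
        by (intro DERIV_chain2)
      then have "((\<lambda>z. z) has_field_derivative deriv \<psi> (\<phi> t) * 0) (at t)"
        by (rule has_field_derivative_transform_within_open[OF _ AB(2) t]) (use AB(7) in auto)
      then show False using DERIV_unique[OF _ DERIV_ident] by fastforce
    qed
  qed
qed

definition jet_invariant :: "nat \<Rightarrow> jet_poly \<Rightarrow> bool" where
  "jet_invariant m P \<longleftrightarrow> (\<forall>x p. p 1 \<noteq> 0 \<longrightarrow> ev (compose_jet x p) P = p 1 ^ m * ev x P)"

lemma jet_comp_eq_compose_jet:
  assumes "P \<in> jet_ring 5" "open U" "open V" "\<phi> holomorphic_on U" "\<phi> ` U \<subseteq> V"
    "\<And>k. k \<in> {1, 2} \<Longrightarrow> f k holomorphic_on V" "t \<in> U"
  shows "ev (jet (\<lambda>k. f k \<circ> \<phi>) t) P = ev (compose_jet (jet f (\<phi> t)) (\<lambda>i. (deriv ^^ i) \<phi> t)) P"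
proof (rule ev_cong)
  fix v assume "v \<in> jet_vars P"
  then have v: "component v \<in> {1, 2}" "level v \<in> {1..5}" using assms(1) by (auto simp: jet_ring_iff)
  show "jet (\<lambda>k. f k \<circ> \<phi>) t v = compose_jet (jet f (\<phi> t)) (\<lambda>i. (deriv ^^ i) \<phi> t) v"
    using faa_di_bruno_deriv[OF assms(2,4,3) assms(6)[OF v(1)] assms(5,7) v(2)]
    by (simp add: jet_def compose_jet_def)
qed

lemma holomorphic_poly: "poly (q :: complex poly) holomorphic_on S"
  unfolding holomorphic_on_def field_differentiable_def
  using poly_DERIV has_field_derivative_at_within by blast

lemma higher_deriv_poly: "(deriv ^^ n) (poly (q :: complex poly)) = poly ((pderiv ^^ n) q)"
proof (induction n)
  case (Suc n)
  have "deriv (poly r) = poly (pderiv r)" for r :: "complex poly"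
    by (rule ext) (simp add: DERIV_imp_deriv poly_DERIV)
  with Suc show ?case by simp
qed simp

lemma poly_with_jet:
  fixes a :: "nat \<Rightarrow> complex"
  obtains q where "poly q 0 = 0" "\<And>l. l \<in> {1..5} \<Longrightarrow> (deriv ^^ l) (poly q) 0 = a l"
proof
  let ?q = "\<Sum>l=1..5. monom (a l / fact l) l"
  show "poly ?q 0 = 0" by (auto simp: poly_sum poly_monom intro!: sum.neutral)
  fix l :: nat assume l: "l \<in> {1..5}"
  have "coeff ?q l = a l / fact l"
    using l by (simp add: coeff_sum sum.delta)
  then show "(deriv ^^ l) (poly ?q) 0 = a l"
    by (simp add: higher_deriv_poly poly_0_coeff_0 coeff_higher_pderiv pochhammer_fact[symmetric])
qed

lemma local_biholomorphism_poly:
  assumes "poly q 0 = 0" "deriv (poly q) 0 \<noteq> 0"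
  shows "local_biholomorphism (poly q)"
proof -
  have hol: "poly q holomorphic_on S" for S by (rule holomorphic_poly)
  obtain r where r: "r > 0" "inj_on (poly q) (ball 0 r)"
    by (rule has_complex_derivative_locally_injective[OF hol UNIV_I open_UNIV assms(2)])
  obtain g where g: "g holomorphic_on (poly q ` ball 0 r)" "\<And>z. z \<in> ball 0 r \<Longrightarrow> deriv (poly q) z * deriv g (poly q z) = 1"
    "\<And>z. z \<in> ball 0 r \<Longrightarrow> g (poly q z) = z"
    by (rule holomorphic_has_inverse[OF hol open_ball r(2)]) (rule that; assumption)
  have o: "open (poly q ` ball 0 r)"
    by (rule open_mapping_thm3[OF hol open_ball r(2)])
  have inv1: "\<forall>z\<in>ball 0 r. poly q z \<in> poly q ` ball 0 r \<and> g (poly q z) = z"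
  proof
    fix z :: complex assume z: "z \<in> ball 0 r"
    show "poly q z \<in> poly q ` ball 0 r \<and> g (poly q z) = z"
      using imageI[OF z, of "poly q"] g(3)[OF z] by (rule conjI)
  qed
  have inv2: "\<forall>w\<in>poly q ` ball 0 r. g w \<in> ball 0 r \<and> poly q (g w) = w"
  proof
    fix w assume "w \<in> poly q ` ball 0 r"
    then obtain z where z: "z \<in> ball 0 r" "w = poly q z" by (rule imageE)
    show "g w \<in> ball 0 r \<and> poly q (g w) = w"
      unfolding z(2) g(3)[OF z(1)] using z(1) by (intro conjI refl)
  qed
  have "0 \<in> ball 0 r" using r(1) by simp
  then show ?thesis
    unfolding local_biholomorphism_def
    by (intro conjI exI[of _ "ball 0 r"] exI[of _ "poly q ` ball 0 r"] exI[of _ g]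
        assms(1) open_ball o hol g(1) inv1 inv2)
qed

lemma reparametrization_invariant_iff:
  assumes P: "P \<in> jet_ring 5"
  shows "reparametrization_invariant m P \<longleftrightarrow> jet_invariant m P"
proof
  assume inv: "jet_invariant m P"
  show "reparametrization_invariant m P"
    unfolding reparametrization_invariant_def
  proof (intro allI impI, elim conjE)
    fix f :: "nat \<Rightarrow> complex \<Rightarrow> complex" and \<phi>
    assume f: "\<forall>k\<in>{1, 2}. f k analytic_on {0}" "local_biholomorphism \<phi>"
    obtain U V where UV: "open U" "0 \<in> U" "open V" "\<phi> holomorphic_on U" "\<phi> ` U \<subseteq> V"
      "\<And>k. k \<in> {1, 2} \<Longrightarrow> f k holomorphic_on V" "\<And>t. t \<in> U \<Longrightarrow> deriv \<phi> t \<noteq> 0"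
      using biholomorphism_neighbourhoods[OF f] by blast
    have "ev (jet (\<lambda>k. f k \<circ> \<phi>) t) P = deriv \<phi> t ^ m * ev (jet f (\<phi> t)) P" if "t \<in> U" for t
      using jet_comp_eq_compose_jet[OF P UV(1,3,4,5,6) that] inv UV(7)[OF that]
      by (simp add: jet_invariant_def)
    then show "\<forall>\<^sub>F t in nhds 0. jet_subst id (jet (\<lambda>k. f k \<circ> \<phi>) t) P = deriv \<phi> t ^ m * jet_subst id (jet f (\<phi> t)) P"
      unfolding eventually_nhds ev_def using UV(1,2) by blast
  qed
next
  assume inv: "reparametrization_invariant m P"
  show "jet_invariant m P"
    unfolding jet_invariant_def
  proof (intro allI impI)
    fix x :: "jet_coord \<Rightarrow> complex" and p :: "nat \<Rightarrow> complex" assume p: "p 1 \<noteq> 0"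
    obtain r where r: "poly r 0 = 0" "\<And>l. l \<in> {1..5} \<Longrightarrow> (deriv ^^ l) (poly r) 0 = p l"
      using poly_with_jet[of p] by blast
    have "\<exists>q. \<forall>l\<in>{1..5}. (deriv ^^ l) (poly q) 0 = x (Jet k l)" for k
      using poly_with_jet[of "\<lambda>l. x (Jet k l)"] by metis
    then obtain q where q: "\<And>k l. l \<in> {1..5} \<Longrightarrow> (deriv ^^ l) (poly (q k)) 0 = x (Jet k l)" by metis
    have r1: "deriv (poly r) 0 = p 1" using r(2)[of 1] by simp
    have "\<forall>\<^sub>F t in nhds 0. ev (jet (\<lambda>k. poly (q k) \<circ> poly r) t) P =
        deriv (poly r) t ^ m * ev (jet (\<lambda>k. poly (q k)) (poly r t)) P"
    proof -
      have "\<forall>k\<in>{1, 2}. poly (q k) analytic_on {0}"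
        unfolding analytic_on_holomorphic using holomorphic_poly open_UNIV by blast
      moreover have "local_biholomorphism (poly r)"
        using local_biholomorphism_poly[OF r(1)] r1 p by simp
      ultimately show ?thesis
        using inv[unfolded reparametrization_invariant_def, rule_format, of "\<lambda>k. poly (q k)" "poly r"]
        unfolding ev_def by simp
    qed
    then have "ev (jet (\<lambda>k. poly (q k) \<circ> poly r) 0) P = p 1 ^ m * ev (jet (\<lambda>k. poly (q k)) 0) P"
      using eventually_nhds_x_imp_x r(1) r1 by fastforce
    moreover have "ev (jet (\<lambda>k. poly (q k) \<circ> poly r) 0) P =
        ev (compose_jet (jet (\<lambda>k. poly (q k)) 0) (\<lambda>i. (deriv ^^ i) (poly r) 0)) P"
      using jet_comp_eq_compose_jet[OF P open_UNIV open_UNIV, of "poly r" "\<lambda>k. poly (q k)" 0] r(1)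
      by (simp add: holomorphic_poly)
    moreover have "ev (compose_jet (jet (\<lambda>k. poly (q k)) 0) (\<lambda>i. (deriv ^^ i) (poly r) 0)) P = ev (compose_jet x p) P"
    proof (rule ev_cong)
      fix v assume "v \<in> jet_vars P"
      then have "level v \<in> {1..5}" using P by (auto simp: jet_ring_iff)
      then show "compose_jet (jet (\<lambda>k. poly (q k)) 0) (\<lambda>i. (deriv ^^ i) (poly r) 0) v = compose_jet x p v"
        using q[of _ "component v"] r(2) r1
        by (auto simp: compose_jet_def faa_di_bruno_def jet_def simp flip: One_nat_def)
    qed
    moreover have "ev (jet (\<lambda>k. poly (q k)) 0) P = ev x P"
    proof (rule ev_cong)
      fix v assume "v \<in> jet_vars P"
      then have "level v \<in> {1..5}" using P by (auto simp: jet_ring_iff)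
      then show "jet (\<lambda>k. poly (q k)) 0 v = x v"
        using q[of "level v" "component v"] by (simp add: jet_def)
    qed
    ultimately show "ev (compose_jet x p) P = p 1 ^ m * ev x P" by simp
  qed
qed

lemma reparametrization_invariant_bracket:
  assumes P: "P \<in> jet_ring \<kappa>" "reparametrization_invariant p P"
    and Q: "Q \<in> jet_ring \<kappa>" "reparametrization_invariant q Q"
    and pq: "p > 0" "q > 0"
  shows "reparametrization_invariant (p + q + 1) (bracket p P q Q)"
  unfolding reparametrization_invariant_def
proof (intro allI impI, elim conjE)
  fix f :: "nat \<Rightarrow> complex \<Rightarrow> complex" and \<phi>
  assume f: "\<forall>k\<in>{1, 2}. f k analytic_on {0}" "local_biholomorphism \<phi>"
  obtain U V where UV: "open U" "0 \<in> U" "open V" "\<phi> holomorphic_on U" "\<phi> ` U \<subseteq> V"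
    "\<And>k. k \<in> {1, 2} \<Longrightarrow> f k holomorphic_on V" "\<And>t. t \<in> U \<Longrightarrow> deriv \<phi> t \<noteq> 0"
    using biholomorphism_neighbourhoods[OF f] by blast
  have comp_hol: "(f k \<circ> \<phi>) holomorphic_on U" if "k \<in> {1, 2}" for k
    using holomorphic_on_compose_gen[OF UV(4) UV(6)[OF that] UV(5)] .
  have DR: "\<exists>S. open S \<and> 0 \<in> S \<and> (\<forall>t\<in>S.
      ev (jet (\<lambda>k. f k \<circ> \<phi>) t) R = deriv \<phi> t ^ m * ev (jet f (\<phi> t)) R \<and>
      ev (jet (\<lambda>k. f k \<circ> \<phi>) t) (D R) = of_nat m * deriv \<phi> t ^ (m - 1) * deriv (deriv \<phi>) t * ev (jet f (\<phi> t)) R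
        + deriv \<phi> t ^ Suc m * ev (jet f (\<phi> t)) (D R))"
    if R: "R \<in> jet_ring \<kappa>" "reparametrization_invariant m R" for R m
  proof -
    obtain S where S: "open S" "0 \<in> S"
      "\<And>t. t \<in> S \<Longrightarrow> ev (jet (\<lambda>k. f k \<circ> \<phi>) t) R = deriv \<phi> t ^ m * ev (jet f (\<phi> t)) R"
    proof -
      have "\<forall>\<^sub>F t in nhds 0. ev (jet (\<lambda>k. f k \<circ> \<phi>) t) R = deriv \<phi> t ^ m * ev (jet f (\<phi> t)) R"
        unfolding ev_def
        by (rule R(2)[unfolded reparametrization_invariant_def, rule_format, of f \<phi>]) (use f in simp_all)
      then show ?thesis unfolding eventually_nhds by (elim exE conjE) (rule that, auto)
    qed
    have "ev (jet (\<lambda>k. f k \<circ> \<phi>) t) (D R) = of_nat m * deriv \<phi> t ^ (m - 1) * deriv (deriv \<phi>) t * ev (jet f (\<phi> t)) R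
        + deriv \<phi> t ^ Suc m * ev (jet f (\<phi> t)) (D R)" if t: "t \<in> S \<inter> U" for t
    proof -
      have 1: "((\<lambda>t. ev (jet (\<lambda>k. f k \<circ> \<phi>) t) R) has_field_derivative ev (jet (\<lambda>k. f k \<circ> \<phi>) t) (D R)) (at t)"
        unfolding D_def
      proof (rule has_field_derivative_ev)
        fix v assume "v \<in> jet_vars R"
        then have "component v \<in> {1, 2}" using R(1) by (auto simp: jet_ring_iff)
        from higher_deriv_DERIV[OF comp_hol[OF this] UV(1), of t "level v"] t
        show "((\<lambda>t. jet (\<lambda>k. f k \<circ> \<phi>) t v) has_field_derivative
           ev (jet (\<lambda>k. f k \<circ> \<phi>) t) (coord (component v) (Suc (level v)))) (at t)"
          by (simp add: jet_def)
      qed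
      have "((\<lambda>s. ev (jet f s) R) has_field_derivative ev (jet f (\<phi> t)) (D R)) (at (\<phi> t))"
        unfolding D_def
      proof (rule has_field_derivative_ev)
        fix v assume "v \<in> jet_vars R"
        then have "component v \<in> {1, 2}" using R(1) by (auto simp: jet_ring_iff)
        from higher_deriv_DERIV[OF UV(6)[OF this] UV(3), of "\<phi> t" "level v"] t UV(5)
        show "((\<lambda>s. jet f s v) has_field_derivative ev (jet f (\<phi> t)) (coord (component v) (Suc (level v)))) (at (\<phi> t))"
          by (auto simp: jet_def)
      qed
      then have 2: "((\<lambda>t. ev (jet f (\<phi> t)) R) has_field_derivative ev (jet f (\<phi> t)) (D R) * deriv \<phi> t) (at t)"
        by (rule DERIV_chain2) (use holomorphic_derivI[OF UV(4,1)] t in auto)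
      have 3: "(deriv \<phi> has_field_derivative deriv (deriv \<phi>) t) (at t)"
        using higher_deriv_DERIV[OF UV(4,1), of t 1] t by simp
      have "((\<lambda>t. deriv \<phi> t ^ m * ev (jet f (\<phi> t)) R) has_field_derivative
        of_nat m * deriv \<phi> t ^ (m - 1) * deriv (deriv \<phi>) t * ev (jet f (\<phi> t)) R
        + deriv \<phi> t ^ Suc m * ev (jet f (\<phi> t)) (D R)) (at t)"
        by (auto intro!: derivative_eq_intros 2 3 simp: algebra_simps)
      then have "((\<lambda>t. ev (jet (\<lambda>k. f k \<circ> \<phi>) t) R) has_field_derivative
        of_nat m * deriv \<phi> t ^ (m - 1) * deriv (deriv \<phi>) t * ev (jet f (\<phi> t)) R
        + deriv \<phi> t ^ Suc m * ev (jet f (\<phi> t)) (D R)) (at t)"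
        by (rule has_field_derivative_transform_within_open[OF _ S(1)]) (use t S(3) in auto)
      with 1 show ?thesis by (rule DERIV_unique)
    qed
    then show ?thesis using S UV(1,2) by (intro exI[of _ "S \<inter> U"]) auto
  qed
  obtain S where S: "open S" "0 \<in> S" "\<forall>t\<in>S.
      ev (jet (\<lambda>k. f k \<circ> \<phi>) t) P = deriv \<phi> t ^ p * ev (jet f (\<phi> t)) P \<and>
      ev (jet (\<lambda>k. f k \<circ> \<phi>) t) (D P) = of_nat p * deriv \<phi> t ^ (p - 1) * deriv (deriv \<phi>) t * ev (jet f (\<phi> t)) P
        + deriv \<phi> t ^ Suc p * ev (jet f (\<phi> t)) (D P)"
    using DR[OF P] by (elim exE conjE)
  obtain T where T: "open T" "0 \<in> T" "\<forall>t\<in>T.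
      ev (jet (\<lambda>k. f k \<circ> \<phi>) t) Q = deriv \<phi> t ^ q * ev (jet f (\<phi> t)) Q \<and>
      ev (jet (\<lambda>k. f k \<circ> \<phi>) t) (D Q) = of_nat q * deriv \<phi> t ^ (q - 1) * deriv (deriv \<phi>) t * ev (jet f (\<phi> t)) Q
        + deriv \<phi> t ^ Suc q * ev (jet f (\<phi> t)) (D Q)"
    using DR[OF Q] by (elim exE conjE)
  obtain p' q' where pq': "p = Suc p'" "q = Suc q'" using pq by (metis gr0_implies_Suc)
  have "ev (jet (\<lambda>k. f k \<circ> \<phi>) t) (bracket p P q Q) =
      deriv \<phi> t ^ (p + q + 1) * ev (jet f (\<phi> t)) (bracket p P q Q)" if "t \<in> S \<inter> T" for t
  proof -
    have alg: "n' * (n * A * b * u + a * (a * A) * u') * (a * B * w) - n * (a * A * u) * (n' * B * b * w + a * (a * B) * w')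
        = a * (a * A) * (a * B) * (n' * u' * w - n * u * w')" for n n' A B a b u u' w w' :: complex
      by algebra
    have "ev (jet (\<lambda>k. f k \<circ> \<phi>) t) (bracket p P q Q) =
        of_nat q * ev (jet (\<lambda>k. f k \<circ> \<phi>) t) (D P) * ev (jet (\<lambda>k. f k \<circ> \<phi>) t) Q
        - of_nat p * ev (jet (\<lambda>k. f k \<circ> \<phi>) t) P * ev (jet (\<lambda>k. f k \<circ> \<phi>) t) (D Q)"
      by (simp only: bracket_def ev_diff ev_simps ev_of_nat)
    also have "\<dots> = deriv \<phi> t ^ (p + q + 1) * (of_nat q * ev (jet f (\<phi> t)) (D P) * ev (jet f (\<phi> t)) Q
        - of_nat p * ev (jet f (\<phi> t)) P * ev (jet f (\<phi> t)) (D Q))"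
    proof -
      have pw: "deriv \<phi> t ^ p = deriv \<phi> t * deriv \<phi> t ^ p'" "deriv \<phi> t ^ q = deriv \<phi> t * deriv \<phi> t ^ q'"
        "p - 1 = p'" "q - 1 = q'"
        "deriv \<phi> t ^ (p + q + 1) = deriv \<phi> t * (deriv \<phi> t * deriv \<phi> t ^ p') * (deriv \<phi> t * deriv \<phi> t ^ q')"
        by (simp_all add: pq' power_add)
      have St: "t \<in> S" "t \<in> T" using that by auto
      show ?thesis
        unfolding S(3)[rule_format, OF St(1), THEN conjunct1] S(3)[rule_format, OF St(1), THEN conjunct2]
          T(3)[rule_format, OF St(2), THEN conjunct1] T(3)[rule_format, OF St(2), THEN conjunct2] power_Suc pw
        by (rule alg)
    qed
    finally show ?thesis by (simp only: bracket_def ev_diff ev_simps ev_of_nat)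
  qed
  then show "\<forall>\<^sub>F t in nhds 0. jet_subst id (jet (\<lambda>k. f k \<circ> \<phi>) t) (bracket p P q Q) =
      deriv \<phi> t ^ (p + q + 1) * jet_subst id (jet f (\<phi> t)) (bracket p P q Q)"
    unfolding eventually_nhds ev_def using S(1,2) T(1,2) by (intro exI[of _ "S \<inter> T"]) auto
qed

lemma cancel_equivariance:
  assumes eq: "\<And>x. ev (T x) (f1 * R) = \<kappa> * c * ev x (f1 * R)"
    and T: "\<And>x. T x (Jet 1 1) = \<kappa> * x (Jet 1 1)" "\<kappa> \<noteq> 0"
    and cont: "\<And>x v. isCont (\<lambda>z. T (x(Jet 1 1 := z)) v) 0"
  shows "ev (T x) R = c * ev x R"
proof (cases "x (Jet 1 1) = 0")
  case False
  then show ?thesis using eq[of x] T by simp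
next
  case True
  define g where "g z = ev (T (x(Jet 1 1 := z))) R - c * ev (x(Jet 1 1 := z)) R" for z
  have g0: "g z = 0" if "z \<noteq> 0" for z
    using eq[of "x(Jet 1 1 := z)"] T(1)[of "x(Jet 1 1 := z)"] T(2) that by (simp add: g_def)
  have "isCont (\<lambda>z. (x(Jet 1 1 := z)) v) 0" for v
    by (cases "v = Jet 1 1") auto
  then have "isCont g 0"
    unfolding g_def by (intro continuous_intros continuous_ev cont)
  then have "g \<midarrow>0\<rightarrow> g 0" by (simp add: isCont_def)
  moreover have "g \<midarrow>0\<rightarrow> 0"
    using tendsto_cong[of g "\<lambda>_. 0" "at 0" 0] g0 by (simp add: eventually_at_filter)
  ultimately have "g 0 = 0" by (rule LIM_unique)
  moreover have "x(Jet 1 1 := 0) = x" using True by auto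
  ultimately show ?thesis by (simp add: g_def)
qed

lemma isCont_faa_di_bruno:
  assumes "\<And>i. isCont (\<lambda>z. y z i) z0"
  shows "isCont (\<lambda>z. faa_di_bruno (y z) p l) z0"
proof -
  consider "l = 1" | "l = 2" | "l = 3" | "l = 4" | "l = 5" | "l \<notin> {1, 2, 3, 4, 5}" by blast
  then show ?thesis
    by cases (simp_all add: faa_di_bruno_def assms)
qed

lemma jet_invariant_cancel:
  assumes "jet_invariant (Suc m) (f1 * R)"
  shows "jet_invariant m R"
  unfolding jet_invariant_def
proof (intro allI impI)
  fix x and p :: "nat \<Rightarrow> complex" assume p: "p 1 \<noteq> 0"
  show "ev (compose_jet x p) R = p 1 ^ m * ev x R"
  proof (rule cancel_equivariance[where T = "\<lambda>x. compose_jet x p" and \<kappa> = "p 1"])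
    show "ev (compose_jet x p) (f1 * R) = p 1 * p 1 ^ m * ev x (f1 * R)" for x
      using assms p unfolding jet_invariant_def by (metis power_Suc)
    show "isCont (\<lambda>z. compose_jet (x(Jet 1 1 := z)) p v) 0" for x v
    proof -
      have u: "isCont (\<lambda>z. (x(Jet 1 1 := z)) w) 0" for w
        by (cases "w = Jet 1 1") auto
      show ?thesis
        unfolding compose_jet_def by (intro isCont_faa_di_bruno u)
    qed
  qed (use p in \<open>auto simp: compose_jet_def faa_di_bruno_def\<close>)
qed

lemma jet_invariant_Const: "jet_invariant 0 (Const c)"
  and jet_invariant_add: "jet_invariant m P \<Longrightarrow> jet_invariant m Q \<Longrightarrow> jet_invariant m (P + Q)"
  and jet_invariant_diff: "jet_invariant m P \<Longrightarrow> jet_invariant m Q \<Longrightarrow> jet_invariant m (P - Q)"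
  and jet_invariant_uminus: "jet_invariant m P \<Longrightarrow> jet_invariant m (- P)"
  and jet_invariant_scale: "jet_invariant m P \<Longrightarrow> jet_invariant m (Const c * P)"
  and jet_invariant_0: "jet_invariant m 0"
  by (simp_all add: jet_invariant_def algebra_simps)

lemma jet_invariant_mult:
  "jet_invariant m P \<Longrightarrow> jet_invariant n Q \<Longrightarrow> jet_invariant (m + n) (P * Q)"
  by (simp add: jet_invariant_def power_add algebra_simps)

lemma jet_invariant_power: "jet_invariant m P \<Longrightarrow> jet_invariant (k * m) (P ^ k)"
  by (induction k) (simp_all add: jet_invariant_mult jet_invariant_Const[of 1, simplified])

lemma jet_invariant_sum: "(\<And>i. i \<in> I \<Longrightarrow> jet_invariant m (f i)) \<Longrightarrow> jet_invariant m (sum f I)"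
  by (induction I rule: infinite_finite_induct) (auto intro: jet_invariant_add jet_invariant_0)

lemma jet_invariant_bracket:
  assumes "P \<in> jet_ring 4" "jet_invariant p P" "Q \<in> jet_ring 4" "jet_invariant q Q" "p > 0" "q > 0"
  shows "jet_invariant (p + q + 1) (bracket p P q Q)"
proof -
  have "bracket p P q Q \<in> jet_ring 5"
    using jet_ring_bracket[OF assms(1,3)] by simp
  moreover have "reparametrization_invariant (p + q + 1) (bracket p P q Q)"
    using assms jet_ring_mono[of 4 5]
    by (intro reparametrization_invariant_bracket[where \<kappa> = 4]) (auto simp: reparametrization_invariant_iff)
  ultimately show ?thesis by (simp add: reparametrization_invariant_iff)
qed

section \<open>Bi-invariants and the normal form of jets\<close>

definition shear :: "complex \<Rightarrow> (jet_coord \<Rightarrow> complex) \<Rightarrow> jet_coord \<Rightarrow> complex" where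
  "shear u x v = (if component v = 2 then x v + u * x (Jet 1 (level v)) else x v)"

definition unipotent_invariant :: "jet_poly \<Rightarrow> bool" where
  "unipotent_invariant P \<longleftrightarrow> (\<forall>u x. ev (shear u x) P = ev x P)"

lemma ev_unipotent_action: "ev x (unipotent_action u P) = ev (shear u x) P"
proof -
  have "(\<lambda>v. ev x (if component v = 2 then coord 2 (level v) + Const u * coord 1 (level v)
                          else coord (component v) (level v))) = shear u x"
  proof
    fix v
    show "ev x (if component v = 2 then coord 2 (level v) + Const u * coord 1 (level v)
                          else coord (component v) (level v)) = shear u x v"
      by (cases v) (simp add: shear_def)
  qed
  then show ?thesis by (simp add: unipotent_action_def ev_jet_subst)
qed

lemma unipotent_invariant_iff: "(\<forall>u. unipotent_action u P = P) \<longleftrightarrow> unipotent_invariant P"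
proof
  assume "\<forall>u. unipotent_action u P = P"
  then show "unipotent_invariant P"
    unfolding unipotent_invariant_def ev_unipotent_action[symmetric] by simp
next
  assume "unipotent_invariant P"
  then show "\<forall>u. unipotent_action u P = P"
    unfolding unipotent_invariant_def by (intro allI ev_eqI) (simp add: ev_unipotent_action)
qed

lemma D_simps:
  "D (P + Q) = D P + D Q" "D (P - Q) = D P - D Q" "D (- P) = - D P"
  "D (P * Q) = D P * Q + P * D Q" "D (coord k l) = coord k (Suc l)" "D (Const c) = 0"
  "D 0 = 0" "D 1 = 0" "D (numeral n) = 0" "D (of_nat i) = 0"
  by (simp_all add: D_def derivation_add derivation_diff derivation_uminus derivation_mult)

lemma unipotent_invariant_D:
  assumes "unipotent_invariant P"
  shows "unipotent_invariant (D P)"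
  unfolding unipotent_invariant_def
proof (intro allI)
  fix u :: complex and x :: "jet_coord \<Rightarrow> complex"
  define y where "y t v = x v + t * x (Jet (component v) (Suc (level v)))" for t v
  have y0: "y 0 = x" by (rule ext) (simp add: y_def)
  have lin: "((\<lambda>t. a + t * b) has_field_derivative b) (at 0)" for a b :: complex
    by (auto intro!: derivative_eq_intros)
  have "((\<lambda>t. ev (y t) P) has_field_derivative ev (y 0) (D P)) (at 0)"
    unfolding D_def
  proof (rule has_field_derivative_ev)
    fix v
    show "((\<lambda>t. y t v) has_field_derivative ev (y 0) (coord (component v) (Suc (level v)))) (at 0)"
      unfolding y0 ev_simps y_def by (rule lin)
  qed
  moreover have "((\<lambda>t. ev (shear u (y t)) P) has_field_derivative ev (shear u (y 0)) (D P)) (at 0)"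
    unfolding D_def
  proof (rule has_field_derivative_ev)
    fix v
    have "(\<lambda>t. shear u (y t) v) =
        (\<lambda>t. shear u x v + t * shear u x (Jet (component v) (Suc (level v))))"
      by (rule ext) (simp add: shear_def y_def algebra_simps)
    then show "((\<lambda>t. shear u (y t) v) has_field_derivative
        ev (shear u (y 0)) (coord (component v) (Suc (level v)))) (at 0)"
      unfolding y0 ev_simps by (simp only: lin)
  qed
  moreover have "(\<lambda>t. ev (shear u (y t)) P) = (\<lambda>t. ev (y t) P)"
    using assms by (simp add: unipotent_invariant_def)
  ultimately have "((\<lambda>t. ev (y t) P) has_field_derivative ev x (D P)) (at 0)"
    "((\<lambda>t. ev (y t) P) has_field_derivative ev (shear u x) (D P)) (at 0)"
    unfolding y0 by simp_all
  then show "ev (shear u x) (D P) = ev x (D P)" using DERIV_unique by blast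
qed

definition bi_invariant :: "nat \<Rightarrow> jet_poly \<Rightarrow> bool" where
  "bi_invariant m P \<longleftrightarrow> P \<in> jet_ring 5 \<and> jet_invariant m P \<and> unipotent_invariant P"

lemma bi_invariant_Const: "bi_invariant 0 (Const c)"
  by (simp add: bi_invariant_def jet_ring_Const jet_invariant_Const unipotent_invariant_def)

lemma bi_invariant_numeral: "bi_invariant 0 (numeral n)"
  using bi_invariant_Const[of "numeral n"] by (simp add: Const_numeral)

lemma bi_invariant_0: "bi_invariant m 0"
  by (simp add: bi_invariant_def jet_ring_0 jet_invariant_0 unipotent_invariant_def)

lemma bi_invariant_add: "bi_invariant m P \<Longrightarrow> bi_invariant m Q \<Longrightarrow> bi_invariant m (P + Q)"
  by (simp add: bi_invariant_def jet_ring_add jet_invariant_add unipotent_invariant_def)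

lemma bi_invariant_diff: "bi_invariant m P \<Longrightarrow> bi_invariant m Q \<Longrightarrow> bi_invariant m (P - Q)"
  by (simp add: bi_invariant_def jet_ring_diff jet_invariant_diff unipotent_invariant_def)

lemma bi_invariant_uminus: "bi_invariant m P \<Longrightarrow> bi_invariant m (- P)"
  by (simp add: bi_invariant_def jet_ring_uminus jet_invariant_uminus unipotent_invariant_def)

lemma bi_invariant_mult:
  "bi_invariant m P \<Longrightarrow> bi_invariant n Q \<Longrightarrow> w = m + n \<Longrightarrow> bi_invariant w (P * Q)"
  by (simp add: bi_invariant_def jet_ring_mult jet_invariant_mult unipotent_invariant_def)

lemma bi_invariant_power:
  "bi_invariant m P \<Longrightarrow> w = n * m \<Longrightarrow> bi_invariant w (P ^ n)"
  by (simp add: bi_invariant_def jet_ring_power jet_invariant_power unipotent_invariant_def)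

lemma bi_invariant_sum: "(\<And>i. i \<in> I \<Longrightarrow> bi_invariant m (f i)) \<Longrightarrow> bi_invariant m (sum f I)"
  by (induction I rule: infinite_finite_induct) (auto intro: bi_invariant_add bi_invariant_0)

lemmas bi_invariant_intros = bi_invariant_Const bi_invariant_numeral bi_invariant_add bi_invariant_diff
  bi_invariant_uminus bi_invariant_mult bi_invariant_power

lemma bi_invariant_bracket:
  assumes "bi_invariant p P" "bi_invariant q Q" "P \<in> jet_ring 4" "Q \<in> jet_ring 4" "p > 0" "q > 0"
    "w = p + q + 1"
  shows "bi_invariant w (bracket p P q Q)"
proof -
  have "unipotent_invariant (bracket p P q Q)"
    using assms(1,2) unipotent_invariant_D[of P] unipotent_invariant_D[of Q]
    by (simp add: bi_invariant_def bracket_def unipotent_invariant_def)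
  then show ?thesis
    using assms jet_invariant_bracket[of P p Q q] jet_ring_bracket[of P 4 Q p q]
    by (simp add: bi_invariant_def)
qed

lemma lookup_coord_mult:
  "Poly_Mapping.lookup (coord k l * R) (Poly_Mapping.single (Jet k l) 1 + n) = Poly_Mapping.lookup R n"
proof (induction R rule: monomial_sum_induct)
  case (monomial m c)
  then show ?case by (simp add: coord_def mult_single lookup_single when_def)
next
  case (add P R)
  then show ?case by (simp add: distrib_left lookup_add)
qed

lemma jet_vars_coord_mult: "jet_vars R \<subseteq> jet_vars (coord k l * R)"
proof
  fix v assume "v \<in> jet_vars R"
  then obtain n where n: "n \<in> Poly_Mapping.keys R" "v \<in> Poly_Mapping.keys n"
    by (auto simp: jet_vars_def)
  have "Poly_Mapping.single (Jet k l) 1 + n \<in> Poly_Mapping.keys (coord k l * R)"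
    using n(1) by (simp only: in_keys_iff lookup_coord_mult not_False_eq_True)
  moreover have "v \<in> Poly_Mapping.keys (Poly_Mapping.single (Jet k l) 1 + n)"
    using n(2) by (simp add: in_keys_iff lookup_add)
  ultimately show "v \<in> jet_vars (coord k l * R)" by (auto simp: jet_vars_def)
qed

lemma bi_invariant_cancel:
  assumes "bi_invariant (Suc m) (f1 * R)"
  shows "bi_invariant m R"
proof -
  have "f1 * R \<in> jet_ring 5" using assms unfolding bi_invariant_def by (rule conjunct1)
  then have R5: "R \<in> jet_ring 5"
    using jet_vars_coord_mult[of R 1 1] unfolding jet_ring_def mem_Collect_eq by (rule order_trans[rotated])
  have "jet_invariant (Suc m) (f1 * R)" using assms unfolding bi_invariant_def by (elim conjE)
  then have Rm: "jet_invariant m R" by (rule jet_invariant_cancel)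
  have uf: "ev (shear u x) (f1 * R) = ev x (f1 * R)" for u x
    using assms unfolding bi_invariant_def unipotent_invariant_def by (elim conjE allE)
  have "ev (shear u x) R = 1 * ev x R" for u x
  proof (rule cancel_equivariance[where T = "shear u" and \<kappa> = 1])
    show "ev (shear u x) (f1 * R) = 1 * 1 * ev x (f1 * R)" for x
      by (simp only: uf mult_1)
    show "isCont (\<lambda>z. shear u (x(Jet 1 1 := z)) v) 0" for x v
    proof -
      have c: "isCont (\<lambda>z. (x(Jet 1 1 := z)) w) 0" for w
        by (cases "w = Jet 1 1") auto
      have "isCont (\<lambda>z. (x(Jet 1 1 := z)) v + u * (x(Jet 1 1 := z)) (Jet 1 (level v))) 0"
        by (intro continuous_intros c)
      with c[of v] show ?thesis
        by (cases "component v = 2") (simp_all only: shear_def if_True if_False simp_thms)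
    qed
    show "shear u x (Jet 1 1) = 1 * x (Jet 1 1)" for x by (simp add: shear_def)
  qed simp
  with R5 Rm show ?thesis by (simp add: bi_invariant_def unipotent_invariant_def)
qed

text \<open>
  Every jet with $f_1' \ne 0$ is brought to $f_1(t) = t$ by a reparametrization and then to
  $f_2'(0) = 0$ by the unipotent group.
\<close>

definition slice :: "complex \<Rightarrow> complex \<Rightarrow> complex \<Rightarrow> complex \<Rightarrow> jet_coord \<Rightarrow> complex" where
  "slice a b c d v =
    (if v = Jet 1 1 then 1 else if v = Jet 2 2 then a else if v = Jet 2 3 then b
     else if v = Jet 2 4 then c else if v = Jet 2 5 then d else 0)"

lemma normal_form:
  assumes "x (Jet 1 1) \<noteq> 0"
  obtains a b c d where "\<And>m P. bi_invariant m P \<Longrightarrow> ev x P = x (Jet 1 1) ^ m * ev (slice a b c d) P"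
proof -
  define p where "p l = x (Jet 1 l)" for l
  define y where "y l = x (Jet 2 l)" for l
  have p1: "p 1 \<noteq> 0" using assms by (simp add: p_def)
  define s1 where "s1 = y 1 / p 1"
  define s2 where "s2 = (y 2 - s1 * p 2) / p 1 ^ 2"
  define s3 where "s3 = (y 3 - (3 * s2 * p 1 * p 2 + s1 * p 3)) / p 1 ^ 3"
  define s4 where "s4 = (y 4 - (6 * s3 * p 1 ^ 2 * p 2 + s2 * (4 * p 1 * p 3 + 3 * p 2 ^ 2) + s1 * p 4)) / p 1 ^ 4"
  define s5 where "s5 = (y 5 - (10 * s4 * p 1 ^ 3 * p 2 + s3 * (10 * p 1 ^ 2 * p 3 + 15 * p 1 * p 2 ^ 2)
        + s2 * (5 * p 1 * p 4 + 10 * p 2 * p 3) + s1 * p 5)) / p 1 ^ 5"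
  define z where "z v = (if v = Jet 2 1 then s1 else slice s2 s3 s4 s5 v)" for v
  have div: "q \<noteq> 0 \<Longrightarrow> s = r / q \<Longrightarrow> s * q = r" for q s r :: complex by simp
  have s: "s1 * p 1 = y 1" "s2 * p 1 ^ 2 = y 2 - s1 * p 2"
    "s3 * p 1 ^ 3 = y 3 - (3 * s2 * p 1 * p 2 + s1 * p 3)"
    "s4 * p 1 ^ 4 = y 4 - (6 * s3 * p 1 ^ 2 * p 2 + s2 * (4 * p 1 * p 3 + 3 * p 2 ^ 2) + s1 * p 4)"
    "s5 * p 1 ^ 5 = y 5 - (10 * s4 * p 1 ^ 3 * p 2 + s3 * (10 * p 1 ^ 2 * p 3 + 15 * p 1 * p 2 ^ 2)
        + s2 * (5 * p 1 * p 4 + 10 * p 2 * p 3) + s1 * p 5)"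
    by (rule div[OF _ s1_def] div[OF _ s2_def] div[OF _ s3_def] div[OF _ s4_def] div[OF _ s5_def],
        simp only: p1 power_not_zero not_False_eq_True)+
  have comp: "compose_jet z p v = x v" if v: "component v \<in> {1, 2}" "level v \<in> {1..5}" for v
  proof -
    have zv: "z (Jet 1 1) = 1" "z (Jet 1 2) = 0" "z (Jet 1 3) = 0" "z (Jet 1 4) = 0" "z (Jet 1 5) = 0"
      "z (Jet 2 1) = s1" "z (Jet 2 2) = s2" "z (Jet 2 3) = s3" "z (Jet 2 4) = s4" "z (Jet 2 5) = s5"
      by (simp_all add: z_def slice_def)
    have l: "level v = 1 \<or> level v = 2 \<or> level v = 3 \<or> level v = 4 \<or> level v = 5"
      using v(2) by auto
    from v(1) consider "component v = 1" | "component v = 2" by blast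
    then show ?thesis
    proof cases
      case 1
      then have "v = Jet 1 (level v)" by (metis jet_coord.collapse)
      then have "x v = p (level v)" unfolding p_def by (rule arg_cong)
      then show ?thesis
        using l by (elim disjE) (simp_all add: compose_jet_def faa_di_bruno_def 1 zv flip: One_nat_def)
    next
      case 2
      then have "v = Jet 2 (level v)" by (metis jet_coord.collapse)
      then have "x v = y (level v)" unfolding y_def by (rule arg_cong)
      then show ?thesis
        using l s by (elim disjE) (simp_all add: compose_jet_def faa_di_bruno_def 2 zv flip: One_nat_def)
    qed
  qed
  show thesis
  proof
    fix m P assume P: "bi_invariant m P"
    have "ev x P = ev (compose_jet z p) P"
      by (rule ev_cong) (use P comp in \<open>auto simp: bi_invariant_def jet_ring_iff\<close>)
    also have "\<dots> = p 1 ^ m * ev z P"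
      using P p1 by (simp add: bi_invariant_def jet_invariant_def)
    also have "ev z P = ev (shear (- s1) z) P"
      using P by (simp add: bi_invariant_def unipotent_invariant_def)
    also have "ev (shear (- s1) z) P = ev (slice s2 s3 s4 s5) P"
    proof -
      have "shear (- s1) z v = slice s2 s3 s4 s5 v" for v
        by (cases v) (simp add: shear_def z_def slice_def)
      then show ?thesis by (intro ev_cong)
    qed
    finally show "ev x P = x (Jet 1 1) ^ m * ev (slice s2 s3 s4 s5) P" by (simp add: p_def)
  qed
qed

lemma f1_nonzero: "f1 \<noteq> 0"
proof
  assume "f1 = 0"
  then have "ev (\<lambda>_. 1) f1 = 0" by (simp only: ev_simps)
  then show False by simp
qed

lemma bi_invariant_eqI:
  assumes "bi_invariant m P" "bi_invariant m Q" "\<And>a b c d. ev (slice a b c d) P = ev (slice a b c d) Q"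
  shows "P = Q"
proof (rule ev_eqI_nonzero[OF f1_nonzero])
  fix x assume "ev x f1 \<noteq> 0"
  then have "x (Jet 1 1) \<noteq> 0" by simp
  then obtain a b c d where "\<And>m P. bi_invariant m P \<Longrightarrow> ev x P = x (Jet 1 1) ^ m * ev (slice a b c d) P"
    using normal_form by blast
  with assms show "ev x P = ev x Q" by simp
qed

subsection \<open>The bi-invariants on the normal form\<close>

lemma slice_simps [simp]:
  "slice a b c d (Jet 1 1) = 1" "slice a b c d (Jet 1 2) = 0" "slice a b c d (Jet 1 3) = 0"
  "slice a b c d (Jet 1 4) = 0" "slice a b c d (Jet 1 5) = 0" "slice a b c d (Jet 2 1) = 0"
  "slice a b c d (Jet 2 2) = a" "slice a b c d (Jet 2 3) = b" "slice a b c d (Jet 2 4) = c"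
  "slice a b c d (Jet 2 5) = d"
  by (simp_all add: slice_def)

lemma slice_simps' [simp]:
  "slice a b c d (Jet (Suc 0) (Suc 0)) = 1" "slice a b c d (Jet (Suc 0) n) = (if n = 1 then 1 else 0)"
  "slice a b c d (Jet 2 (Suc 0)) = 0"
  "slice a b c d (Jet 2 (Suc (Suc 0))) = a"  "slice a b c d (Jet 2 (Suc 2)) = b"
  "slice a b c d (Jet 2 (Suc 3)) = c" "slice a b c d (Jet 2 (Suc 4)) = d"
  by (simp_all add: slice_def)

lemma jet_ring_f1: "f1 \<in> jet_ring 4"
  by (rule jet_ring_coord) auto

lemma bi_invariant_f1: "bi_invariant 1 f1"
  unfolding bi_invariant_def
  by (auto intro!: jet_ring_coord
      simp: jet_invariant_def compose_jet_def faa_di_bruno_def unipotent_invariant_def shear_def)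

lemma bi_invariant_\<Lambda>3: "bi_invariant 3 \<Lambda>3"
proof -
  have "\<Lambda>3 \<in> jet_ring 5"
    unfolding \<Lambda>3_def by (intro jet_ring_intros jet_ring_coord) auto
  moreover have "jet_invariant 3 \<Lambda>3"
    by (simp add: jet_invariant_def \<Lambda>3_def compose_jet_def faa_di_bruno_def power2_eq_square power3_eq_cube algebra_simps)
  moreover have "unipotent_invariant \<Lambda>3"
    by (simp add: unipotent_invariant_def \<Lambda>3_def shear_def algebra_simps)
  ultimately show ?thesis by (simp add: bi_invariant_def)
qed

lemma jet_ring_\<Lambda>: "\<Lambda>3 \<in> jet_ring 2" "\<Lambda>5 \<in> jet_ring 3" "\<Lambda>7 \<in> jet_ring 4"
proof -
  show 3: "\<Lambda>3 \<in> jet_ring 2"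
    unfolding \<Lambda>3_def by (intro jet_ring_intros jet_ring_coord) auto
  show 5: "\<Lambda>5 \<in> jet_ring 3"
    using jet_ring_bracket[OF 3, of f1 3 1] by (simp add: \<Lambda>5_def jet_ring_coord numeral_3_eq_3)
  show "\<Lambda>7 \<in> jet_ring 4"
    using jet_ring_bracket[OF 5, of f1 5 1] by (simp add: \<Lambda>7_def jet_ring_coord)
qed

lemma jet_ring_4: "\<Lambda>3 \<in> jet_ring 4" "\<Lambda>5 \<in> jet_ring 4" "\<Lambda>7 \<in> jet_ring 4"
  using jet_ring_mono[OF _ jet_ring_\<Lambda>(1), of 4] jet_ring_mono[OF _ jet_ring_\<Lambda>(2), of 4] jet_ring_\<Lambda>(3) by simp_all

lemma bi_invariant_\<Lambda>:
  "bi_invariant 5 \<Lambda>5" "bi_invariant 7 \<Lambda>7" "bi_invariant 9 \<Lambda>9"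
proof -
  show 5: "bi_invariant 5 \<Lambda>5" unfolding \<Lambda>5_def
    by (rule bi_invariant_bracket[OF bi_invariant_\<Lambda>3 bi_invariant_f1 jet_ring_4(1) jet_ring_f1]) simp_all
  show 7: "bi_invariant 7 \<Lambda>7" unfolding \<Lambda>7_def
    by (rule bi_invariant_bracket[OF 5 bi_invariant_f1 jet_ring_4(2) jet_ring_f1]) simp_all
  show "bi_invariant 9 \<Lambda>9" unfolding \<Lambda>9_def
    by (rule bi_invariant_bracket[OF 7 bi_invariant_f1 jet_ring_4(3) jet_ring_f1]) simp_all
qed

lemma slice_\<Lambda> [simp]:
  "ev (slice a b c d) \<Lambda>3 = a" "ev (slice a b c d) \<Lambda>5 = b"
  "ev (slice a b c d) \<Lambda>7 = c" "ev (slice a b c d) \<Lambda>9 = d"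
  by (simp_all add: \<Lambda>3_def \<Lambda>5_def \<Lambda>7_def \<Lambda>9_def bracket_def D_simps)

lemma slice_D\<Lambda> [simp]:
  "ev (slice a b c d) (D \<Lambda>3) = b" "ev (slice a b c d) (D \<Lambda>5) = c" "ev (slice a b c d) (D \<Lambda>7) = d"
  using slice_\<Lambda>(2-4)[of a b c d] by (simp_all add: \<Lambda>5_def \<Lambda>7_def \<Lambda>9_def bracket_def D_simps)

lemma M8_eq:
  "M8 = 3 * (coord 1 1 * coord 2 4 - coord 1 4 * coord 2 1) * (coord 1 1 * coord 2 2 - coord 1 2 * coord 2 1)
      + 12 * (coord 1 2 * coord 2 3 - coord 1 3 * coord 2 2) * (coord 1 1 * coord 2 2 - coord 1 2 * coord 2 1)
      - 5 * (coord 1 1 * coord 2 3 - coord 1 3 * coord 2 1) ^ 2" (is "_ = ?M")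
  and f1_M8: "f1 ^ 2 * M8 = 3 * \<Lambda>3 * \<Lambda>7 - 5 * \<Lambda>5 * \<Lambda>5"
proof -
  have alg: "3 * L * ((((u1 * v4 + u2 * v3 - (u3 * v2 + u4 * v1)) * u1 + (u1 * v3 - u3 * v1) * u2
        - 3 * ((u1 * v3 - u3 * v1) * u2 + L * u3)) * u1) - 5 * ((u1 * v3 - u3 * v1) * u1 - 3 * L * u2) * u2)
      - 5 * ((u1 * v3 - u3 * v1) * u1 - 3 * L * u2) * ((u1 * v3 - u3 * v1) * u1 - 3 * L * u2)
     = u1 ^ 2 * (3 * (u1 * v4 - u4 * v1) * L + 12 * (u2 * v3 - u3 * v2) * L - 5 * (u1 * v3 - u3 * v1) ^ 2)"
    if "L = u1 * v2 - u2 * v1" for L u1 u2 u3 u4 v1 v2 v3 v4 :: jet_poly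
    unfolding that by algebra
  have n: "Suc (Suc 0) = 2" "Suc 2 = 3" "Suc 3 = 4" by simp_all
  have e5: "\<Lambda>5 = (coord 1 1 * coord 2 3 - coord 1 3 * coord 2 1) * coord 1 1 - 3 * \<Lambda>3 * coord 1 2"
    by (simp add: \<Lambda>5_def bracket_def \<Lambda>3_def D_simps n)
  have e7: "\<Lambda>7 = ((coord 1 1 * coord 2 4 + coord 1 2 * coord 2 3 - (coord 1 3 * coord 2 2 + coord 1 4 * coord 2 1)) * coord 1 1
        + (coord 1 1 * coord 2 3 - coord 1 3 * coord 2 1) * coord 1 2
        - 3 * ((coord 1 1 * coord 2 3 - coord 1 3 * coord 2 1) * coord 1 2 + \<Lambda>3 * coord 1 3)) * coord 1 1 - 5 * \<Lambda>5 * coord 1 2"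
  proof -
    have D5: "D \<Lambda>5 = (coord 1 1 * coord 2 4 + coord 1 2 * coord 2 3 - (coord 1 3 * coord 2 2 + coord 1 4 * coord 2 1)) * coord 1 1
        + (coord 1 1 * coord 2 3 - coord 1 3 * coord 2 1) * coord 1 2
        - 3 * ((coord 1 1 * coord 2 3 - coord 1 3 * coord 2 1) * coord 1 2 + \<Lambda>3 * coord 1 3)"
      unfolding e5 \<Lambda>3_def by (simp only: D_simps n Suc_1 One_nat_def[symmetric]) algebra
    show ?thesis
      unfolding \<Lambda>7_def bracket_def D5 by (simp add: D_simps n)
  qed
  have eq: "3 * \<Lambda>3 * \<Lambda>7 - 5 * \<Lambda>5 * \<Lambda>5 = f1 ^ 2 * ?M"
    unfolding e7 unfolding e5 using alg[of \<Lambda>3 "coord 1 1" "coord 2 2" "coord 1 2" "coord 2 1"]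
    by (simp only: \<Lambda>3_def)
  show "M8 = ?M"
    unfolding M8_def by (rule quotient_eq[OF power_not_zero[OF f1_nonzero] eq])
  with eq show "f1 ^ 2 * M8 = 3 * \<Lambda>3 * \<Lambda>7 - 5 * \<Lambda>5 * \<Lambda>5" by simp
qed

lemma bi_invariant_M8: "bi_invariant 8 M8"
proof -
  have "bi_invariant 10 (f1 ^ 2 * M8)"
    unfolding f1_M8
    by (rule bi_invariant_intros bi_invariant_\<Lambda>3 bi_invariant_\<Lambda> | simp)+
  then have "bi_invariant (Suc 9) (f1 * (f1 * M8))"
    by (simp add: power2_eq_square mult.assoc)
  then have "bi_invariant (Suc 8) (f1 * M8)"
    using bi_invariant_cancel by fastforce
  then show ?thesis by (rule bi_invariant_cancel)
qed

lemma jet_ring_M8: "M8 \<in> jet_ring 4"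
  unfolding M8_eq by (intro jet_ring_intros jet_ring_coord) auto

lemma bi_invariant_M10: "bi_invariant 10 M10"
  unfolding M10_def by (rule bi_invariant_bracket[OF bi_invariant_M8 bi_invariant_f1 jet_ring_M8 jet_ring_f1]) simp_all

lemma bi_invariant_N12: "bi_invariant 12 N12"
  unfolding N12_def by (rule bi_invariant_bracket[OF bi_invariant_M8 bi_invariant_\<Lambda>3 jet_ring_M8 jet_ring_4(1)]) simp_all

lemma bi_invariant_H14: "bi_invariant 14 H14"
  unfolding H14_def by (rule bi_invariant_bracket[OF bi_invariant_M8 bi_invariant_\<Lambda>(1) jet_ring_M8 jet_ring_4(2)]) simp_all

lemma bi_invariant_F16: "bi_invariant 16 F16"
  unfolding F16_def by (rule bi_invariant_bracket[OF bi_invariant_M8 bi_invariant_\<Lambda>(2) jet_ring_M8 jet_ring_4(3)]) simp_all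

lemma slice_M8: "ev (slice a b c d) M8 = 3 * a * c - 5 * b ^ 2"
  by (simp add: M8_eq)

lemma slice_DM8: "ev (slice a b c d) (D M8) = 3 * a * d - 7 * b * c"
  by (simp add: M8_eq D_simps power2_eq_square)

lemma slice_M10: "ev (slice a b c d) M10 = 3 * a * d - 7 * b * c"
  by (simp add: M10_def bracket_def slice_DM8 D_simps)

lemma slice_N12: "ev (slice a b c d) N12 = 3 * (3 * a * d - 7 * b * c) * a - 8 * (3 * a * c - 5 * b ^ 2) * b"
  by (simp add: N12_def bracket_def slice_DM8 slice_M8)

lemma slice_H14: "ev (slice a b c d) H14 = 5 * (3 * a * d - 7 * b * c) * b - 8 * (3 * a * c - 5 * b ^ 2) * c"
  by (simp add: H14_def bracket_def slice_DM8 slice_M8)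

lemma slice_F16: "ev (slice a b c d) F16 = 7 * (3 * a * d - 7 * b * c) * c - 8 * (3 * a * c - 5 * b ^ 2) * d"
  by (simp add: F16_def bracket_def slice_DM8 slice_M8)

lemma f1_dvd:
  assumes "\<Lambda>3 * P = f1 * Q"
  obtains R where "P = f1 * R"
proof -
  define \<pi> where "\<pi> = jet_subst Const (\<lambda>v. if v = Jet 1 1 then 0 else coord (component v) (level v))"
  have \<pi>: "\<pi> (A + B) = \<pi> A + \<pi> B" "\<pi> (A * B) = \<pi> A * \<pi> B" "\<pi> (Const c) = Const c"
    "\<pi> (coord k l) = (if Jet k l = Jet 1 1 then 0 else coord k l)" for A B c k l
    by (simp_all add: \<pi>_def jet_subst_add jet_subst_mult jet_subst_Const jet_subst_coord scalar_hom_Const)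
  have "\<exists>R. A = \<pi> A + f1 * R" for A
  proof (induction A rule: jet_poly_induct)
    case (const c)
    show ?case by (rule exI[of _ 0]) (simp add: \<pi>)
  next
    case (coord k l)
    show ?case
      by (cases "Jet k l = Jet 1 1") (auto simp: \<pi> intro: exI[of _ 0] exI[of _ 1])
  next
    case (add A B)
    then obtain R S where "A = \<pi> A + f1 * R" "B = \<pi> B + f1 * S" by (elim exE)
    then have "A + B = (\<pi> A + f1 * R) + (\<pi> B + f1 * S)" by (rule arg_cong2[where f = "(+)"])
    also have "\<dots> = \<pi> (A + B) + f1 * (R + S)" unfolding \<pi> by (simp only: distrib_left add_ac)
    finally show ?case by (rule exI)
  next
    case (mult A B)
    then obtain R S where RS: "A = \<pi> A + f1 * R" "B = \<pi> B + f1 * S" by (elim exE)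
    have "A * B = (\<pi> A + f1 * R) * (\<pi> B + f1 * S)" using RS by (rule arg_cong2[where f = "(*)"])
    also have "\<dots> = \<pi> (A * B) + f1 * (R * \<pi> B + \<pi> A * S + f1 * R * S)"
      unfolding \<pi> by (simp only: distrib_left distrib_right add_ac mult_ac)
    finally show ?case by (rule exI)
  qed
  note decomp = this
  obtain R where R: "P = \<pi> P + f1 * R" using decomp[of P] by (elim exE)
  have "\<pi> \<Lambda>3 * \<pi> P = 0"
    using arg_cong[OF assms, of \<pi>] by (simp add: \<pi>)
  moreover have "\<pi> \<Lambda>3 \<noteq> 0"
  proof
    assume z: "\<pi> \<Lambda>3 = 0"
    obtain S where "\<Lambda>3 = \<pi> \<Lambda>3 + f1 * S" using decomp[of \<Lambda>3] by (elim exE)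
    then have "\<Lambda>3 = f1 * S" by (simp only: z add_0)
    then have "ev (\<lambda>v. if v = Jet 1 1 then 0 else 1) \<Lambda>3 = ev (\<lambda>v. if v = Jet 1 1 then 0 else 1) (f1 * S)"
      by (rule arg_cong)
    then show False by (simp add: \<Lambda>3_def)
  qed
  ultimately have "\<pi> P = 0" by (simp only: mult_eq_0_iff) simp
  with R have "P = f1 * R" by (simp only: add_0)
  then show thesis by (rule that)
qed

lemma quotient_by_f1:
  assumes P: "bi_invariant (Suc m) P" and Q: "bi_invariant (m + 3) Q"
    and eq: "\<And>a b c d. a * ev (slice a b c d) P = ev (slice a b c d) Q"
  shows "f1 * quotient P f1 = P" "bi_invariant m (quotient P f1)"
    "ev (slice a b c d) (quotient P f1) = ev (slice a b c d) P"
proof -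
  have "\<Lambda>3 * P = f1 * Q"
  proof (rule bi_invariant_eqI)
    show "bi_invariant (m + 4) (\<Lambda>3 * P)"
      by (rule bi_invariant_mult[OF bi_invariant_\<Lambda>3 P]) simp
    show "bi_invariant (m + 4) (f1 * Q)"
      by (rule bi_invariant_mult[OF bi_invariant_f1 Q]) simp
  qed (simp add: eq)
  then obtain R where R: "P = f1 * R" by (rule f1_dvd)
  have q: "quotient P f1 = R" by (rule quotient_eq[OF f1_nonzero R])
  show "f1 * quotient P f1 = P" unfolding q by (rule R[symmetric])
  show "bi_invariant m (quotient P f1)"
    unfolding q by (rule bi_invariant_cancel) (use P R in simp)
  show "ev (slice a b c d) (quotient P f1) = ev (slice a b c d) P"
    unfolding q by (simp add: R)
qed

lemma K12:
  "f1 * K12 = bracket 7 \<Lambda>7 5 \<Lambda>5" "bi_invariant 12 K12"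
  "ev (slice a b c d) K12 = 5 * d * b - 7 * c * c"
proof -
  let ?Q = "Const (5/24) * \<Lambda>5 * M10 + Const (7/24) * f1 * H14"
  have P: "bi_invariant (Suc 12) (bracket 7 \<Lambda>7 5 \<Lambda>5)"
    by (rule bi_invariant_bracket[OF bi_invariant_\<Lambda>(2,1) jet_ring_4(3,2)]) simp_all
  have Q: "bi_invariant (12 + 3) ?Q"
    by (rule bi_invariant_intros bi_invariant_\<Lambda> bi_invariant_M10 bi_invariant_H14 bi_invariant_f1 | simp)+
  have eq: "a * ev (slice a b c d) (bracket 7 \<Lambda>7 5 \<Lambda>5) = ev (slice a b c d) ?Q" for a b c d
    by (simp add: bracket_def slice_M10 slice_H14 field_simps power2_eq_square)
  note q = quotient_by_f1[OF P Q eq, folded K12_def]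
  show "f1 * K12 = bracket 7 \<Lambda>7 5 \<Lambda>5" "bi_invariant 12 K12" by (rule q)+
  show "ev (slice a b c d) K12 = 5 * d * b - 7 * c * c"
    unfolding q(3) by (simp add: bracket_def)
qed

lemmas bi_invariant_basic = bi_invariant_f1 bi_invariant_\<Lambda>3 bi_invariant_\<Lambda> bi_invariant_M8 bi_invariant_M10
  bi_invariant_N12 bi_invariant_H14 bi_invariant_F16 K12(2)

lemmas slice_basic = slice_M8 slice_M10 slice_N12 slice_H14 slice_F16 K12(3)

lemma X18:
  "f1 * X18 = - 5 * \<Lambda>9 * M10 + 56 * \<Lambda>7 * K12" "bi_invariant 18 X18"
  "ev (slice a b c d) X18 = - 5 * d * (3 * a * d - 7 * b * c) + 56 * c * (5 * d * b - 7 * c * c)"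
proof -
  let ?P = "- 5 * \<Lambda>9 * M10 + 56 * \<Lambda>7 * K12"
  let ?Q = "Const (35/3) * \<Lambda>5 * F16 - Const (5/3) * f1 * M10 ^ 2 + Const (56/3) * f1 * M8 * K12"
  have P: "bi_invariant (Suc 18) ?P"
    by (rule bi_invariant_intros bi_invariant_basic | simp)+
  have Q: "bi_invariant (18 + 3) ?Q"
    by (rule bi_invariant_intros bi_invariant_basic | simp)+
  have eq: "a * ev (slice a b c d) ?P = ev (slice a b c d) ?Q" for a b c d
    by (simp add: slice_basic field_simps power2_eq_square)
  note q = quotient_by_f1[OF P Q eq, folded X18_def]
  show "f1 * X18 = ?P" "bi_invariant 18 X18" by (rule q)+
  show "ev (slice a b c d) X18 = - 5 * d * (3 * a * d - 7 * b * c) + 56 * c * (5 * d * b - 7 * c * c)"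
    unfolding q(3) by (simp add: slice_basic)
qed

lemma X21:
  "f1 * X21 = - 5 * M10 * N12 + 8 * M8 * H14" "bi_invariant 21 X21"
  "ev (slice a b c d) X21 = - 5 * ev (slice a b c d) M10 * ev (slice a b c d) N12
     + 8 * ev (slice a b c d) M8 * ev (slice a b c d) H14"
proof -
  let ?P = "- 5 * M10 * N12 + 8 * M8 * H14"
  let ?Q = "- Const (5/3) * N12 ^ 2 - Const (64/3) * M8 ^ 3"
  have P: "bi_invariant (Suc 21) ?P"
    by (rule bi_invariant_intros bi_invariant_basic | simp)+
  have Q: "bi_invariant (21 + 3) ?Q"
    by (rule bi_invariant_intros bi_invariant_basic | simp)+
  have eq: "a * ev (slice a b c d) ?P = ev (slice a b c d) ?Q" for a b c d
    by (simp add: slice_basic field_simps power2_eq_square power3_eq_cube)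
  note q = quotient_by_f1[OF P Q eq, folded X21_def]
  show "f1 * X21 = ?P" "bi_invariant 21 X21" by (rule q)+
  show "ev (slice a b c d) X21 = - 5 * ev (slice a b c d) M10 * ev (slice a b c d) N12
     + 8 * ev (slice a b c d) M8 * ev (slice a b c d) H14"
    unfolding q(3) by simp
qed

lemma X19:
  "f1 * X19 = - 5 * M10 * M10 + 64 * M8 * K12" "bi_invariant 19 X19"
  "ev (slice a b c d) X19 = - 5 * ev (slice a b c d) M10 * ev (slice a b c d) M10
     + 64 * ev (slice a b c d) M8 * ev (slice a b c d) K12"
proof -
  let ?P = "- 5 * M10 * M10 + 64 * M8 * K12"
  let ?Q = "10 * N12 * M10 + Const (7/3) * f1 * X21"
  have P: "bi_invariant (Suc 19) ?P"
    by (rule bi_invariant_intros bi_invariant_basic | simp)+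
  have Q: "bi_invariant (19 + 3) ?Q"
    by (rule bi_invariant_intros bi_invariant_basic X21(2) | simp)+
  have eq: "a * ev (slice a b c d) ?P = ev (slice a b c d) ?Q" for a b c d
    by (simp add: X21(3)) (simp add: slice_basic field_simps power2_eq_square)
  note q = quotient_by_f1[OF P Q eq, folded X19_def]
  show "f1 * X19 = ?P" "bi_invariant 19 X19" by (rule q)+
  show "ev (slice a b c d) X19 = - 5 * ev (slice a b c d) M10 * ev (slice a b c d) M10
     + 64 * ev (slice a b c d) M8 * ev (slice a b c d) K12"
    unfolding q(3) by simp
qed

lemma X23:
  "f1 * X23 = - 7 * N12 * K12 + M8 * F16" "bi_invariant 23 X23"
  "ev (slice a b c d) X23 = - 7 * ev (slice a b c d) N12 * ev (slice a b c d) K12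
     + ev (slice a b c d) M8 * ev (slice a b c d) F16"
proof -
  let ?P = "- 7 * N12 * K12 + M8 * F16"
  let ?Q = "- Const (7/3) * N12 * H14 - Const (8/3) * M8 ^ 2 * M10"
  have P: "bi_invariant (Suc 23) ?P"
    by (rule bi_invariant_intros bi_invariant_basic | simp)+
  have Q: "bi_invariant (23 + 3) ?Q"
    by (rule bi_invariant_intros bi_invariant_basic | simp)+
  have eq: "a * ev (slice a b c d) ?P = ev (slice a b c d) ?Q" for a b c d
    by (simp add: slice_basic field_simps power2_eq_square)
  note q = quotient_by_f1[OF P Q eq, folded X23_def]
  show "f1 * X23 = ?P" "bi_invariant 23 X23" by (rule q)+
  show "ev (slice a b c d) X23 = - 7 * ev (slice a b c d) N12 * ev (slice a b c d) K12
     + ev (slice a b c d) M8 * ev (slice a b c d) F16"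
    unfolding q(3) by simp
qed

lemma X25:
  "f1 * X25 = - 56 * K12 * H14 + 5 * M10 * F16" "bi_invariant 25 X25"
  "ev (slice a b c d) X25 = - 56 * ev (slice a b c d) K12 * ev (slice a b c d) H14
     + 5 * ev (slice a b c d) M10 * ev (slice a b c d) F16"
proof -
  let ?P = "- 56 * K12 * H14 + 5 * M10 * F16"
  let ?Q = "- Const (49/3) * H14 ^ 2 - Const (5/3) * M8 * M10 ^ 2"
  have P: "bi_invariant (Suc 25) ?P"
    by (rule bi_invariant_intros bi_invariant_basic | simp)+
  have Q: "bi_invariant (25 + 3) ?Q"
    by (rule bi_invariant_intros bi_invariant_basic | simp)+
  have eq: "a * ev (slice a b c d) ?P = ev (slice a b c d) ?Q" for a b c d
    by (simp add: slice_basic field_simps power2_eq_square)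
  note q = quotient_by_f1[OF P Q eq, folded X25_def]
  show "f1 * X25 = ?P" "bi_invariant 25 X25" by (rule q)+
  show "ev (slice a b c d) X25 = - 56 * ev (slice a b c d) K12 * ev (slice a b c d) H14
     + 5 * ev (slice a b c d) M10 * ev (slice a b c d) F16"
    unfolding q(3) by simp
qed

lemma Y27:
  "f1 * Y27 = - 56 * K12 * F16 + M10 * X18" "bi_invariant 27 Y27"
  "ev (slice a b c d) Y27 = - 56 * ev (slice a b c d) K12 * ev (slice a b c d) F16
     + ev (slice a b c d) M10 * ev (slice a b c d) X18"
proof -
  let ?P = "- 56 * K12 * F16 + M10 * X18"
  let ?Q = "- Const (147/8) * H14 * F16 + Const (7/24) * N12 * X18 - Const (5/24) * M10 ^ 3"
  have P: "bi_invariant (Suc 27) ?P"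
    by (rule bi_invariant_intros bi_invariant_basic X18(2) | simp)+
  have Q: "bi_invariant (27 + 3) ?Q"
    by (rule bi_invariant_intros bi_invariant_basic X18(2) | simp)+
  have eq: "a * ev (slice a b c d) ?P = ev (slice a b c d) ?Q" for a b c d
    by (simp add: slice_basic X18(3) field_simps power2_eq_square power3_eq_cube)
  note q = quotient_by_f1[OF P Q eq, folded Y27_def]
  show "f1 * Y27 = ?P" "bi_invariant 27 Y27" by (rule q)+
  show "ev (slice a b c d) Y27 = - 56 * ev (slice a b c d) K12 * ev (slice a b c d) F16
     + ev (slice a b c d) M10 * ev (slice a b c d) X18"
    unfolding q(3) by simp
qed

lemmas bi_invariant_generators = bi_invariant_basic X18(2) X19(2) X21(2) X23(2) X25(2) Y27(2)

subsection \<open>Clearing denominators\<close>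

lemma clear_denominators:
  assumes P: "bi_invariant m P"
  obtains N where "f1 ^ N * P \<in> generated_algebra {f1, \<Lambda>3, \<Lambda>5, \<Lambda>7, \<Lambda>9}"
proof -
  let ?V = "{Jet 1 1, Jet 2 2, Jet 2 3, Jet 2 4, Jet 2 5}"
  define K where "K = {n \<in> Poly_Mapping.keys P. Poly_Mapping.keys n \<subseteq> ?V}"
  define e where "e k n = Poly_Mapping.lookup n (Jet 2 k)" for k and n :: "jet_coord \<Rightarrow>\<^sub>0 nat"
  define w where "w n = 3 * e 2 n + 5 * e 3 n + 7 * e 4 n + 9 * e 5 n" for n
  define N where "N = (\<Sum>n\<in>Poly_Mapping.keys P. w n)"
  define T where "T n = Const (Poly_Mapping.lookup P n) * (f1 ^ (N + m - w n) *
      (\<Lambda>3 ^ e 2 n * (\<Lambda>5 ^ e 3 n * (\<Lambda>7 ^ e 4 n * \<Lambda>9 ^ e 5 n))))" for n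
  have wN: "w n \<le> N" if "n \<in> Poly_Mapping.keys P" for n
    unfolding N_def using that by (intro member_le_sum) auto
  have "bi_invariant (N + m) (T n)" if n: "n \<in> K" for n
  proof -
    have "bi_invariant ((N + m - w n) * 1 + (e 2 n * 3 + (e 3 n * 5 + (e 4 n * 7 + e 5 n * 9)))) (f1 ^ (N + m - w n) *
      (\<Lambda>3 ^ e 2 n * (\<Lambda>5 ^ e 3 n * (\<Lambda>7 ^ e 4 n * \<Lambda>9 ^ e 5 n))))"
      by (rule bi_invariant_mult[OF bi_invariant_power[OF bi_invariant_f1 refl]
            bi_invariant_mult[OF bi_invariant_power[OF bi_invariant_\<Lambda>3 refl]
            bi_invariant_mult[OF bi_invariant_power[OF bi_invariant_\<Lambda>(1) refl]
            bi_invariant_mult[OF bi_invariant_power[OF bi_invariant_\<Lambda>(2) refl]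
            bi_invariant_power[OF bi_invariant_\<Lambda>(3) refl] refl] refl] refl] refl])
    moreover have "(N + m - w n) * 1 + (e 2 n * 3 + (e 3 n * 5 + (e 4 n * 7 + e 5 n * 9))) = N + m"
      using wN[of n] n by (simp add: K_def w_def)
    ultimately show ?thesis
      unfolding T_def by (intro bi_invariant_mult[OF bi_invariant_Const]) simp_all
  qed
  then have Q: "bi_invariant (N + m) (\<Sum>n\<in>K. T n)" by (rule bi_invariant_sum)
  have fP: "bi_invariant (N + m) (f1 ^ N * P)"
    by (rule bi_invariant_mult[OF bi_invariant_power[OF bi_invariant_f1 refl] P]) simp
  have "f1 ^ N * P = (\<Sum>n\<in>K. T n)"
  proof (rule bi_invariant_eqI[OF fP Q])
    fix a b c d
    let ?s = "slice a b c d"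
    have mv: "mono_value ?s n = (if n \<in> K then a ^ e 2 n * (b ^ e 3 n * (c ^ e 4 n * d ^ e 5 n)) else 0)"
      if n: "n \<in> Poly_Mapping.keys P" for n
    proof (cases "n \<in> K")
      case True
      then have "mono_value ?s n = (\<Prod>v\<in>?V. ?s v ^ Poly_Mapping.lookup n v)"
        by (intro mono_value_superset) (simp_all add: K_def)
      then show ?thesis using True by (simp add: e_def)
    next
      case False
      then obtain v where v: "v \<in> Poly_Mapping.keys n" "v \<notin> ?V"
        using n by (auto simp: K_def)
      have "?s v = 0" using v(2) by (simp add: slice_def)
      moreover have "Poly_Mapping.lookup n v \<noteq> 0" using v(1) by (simp add: in_keys_iff)
      ultimately have "?s v ^ Poly_Mapping.lookup n v = 0" by simp
      then have "mono_value ?s n = 0"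
        unfolding mono_value_def using v(1) by (intro prod_zero) auto
      then show ?thesis using False by simp
    qed
    have "ev ?s (f1 ^ N * P) = (\<Sum>n\<in>Poly_Mapping.keys P. Poly_Mapping.lookup P n * mono_value ?s n)"
      by (simp add: ev_monomials[of ?s P])
    also have "\<dots> = (\<Sum>n\<in>Poly_Mapping.keys P. if n \<in> K then ev ?s (T n) else 0)"
      by (rule sum.cong) (simp_all add: mv T_def)
    also have "\<dots> = (\<Sum>n\<in>K. ev ?s (T n))"
      by (rule sum.mono_neutral_cong_right) (auto simp: K_def)
    finally show "ev ?s (f1 ^ N * P) = ev ?s (\<Sum>n\<in>K. T n)" by simp
  qed
  moreover have "(\<Sum>n\<in>K. T n) \<in> generated_algebra {f1, \<Lambda>3, \<Lambda>5, \<Lambda>7, \<Lambda>9}"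
    unfolding T_def
    by (intro generated_algebra_sum generated_algebra.mult generated_algebra_power generated_algebra.const
        generated_algebra.gen insertI1 insertI2)
  ultimately have "f1 ^ N * P \<in> generated_algebra {f1, \<Lambda>3, \<Lambda>5, \<Lambda>7, \<Lambda>9}" by (simp only:)
  then show thesis by (rule that)
qed

section \<open>Relations between the bi-invariants\<close>

definition bi_algebra :: "jet_poly set" where
  "bi_algebra = generated_algebra
     {f1, \<Lambda>3, \<Lambda>5, \<Lambda>7, \<Lambda>9, M8, M10, K12, N12, H14, F16, X18, X19, X21, X23, X25, Y27}"

lemma bi_algebra_intros:
  "f1 \<in> bi_algebra" "\<Lambda>3 \<in> bi_algebra" "\<Lambda>5 \<in> bi_algebra" "\<Lambda>7 \<in> bi_algebra" "\<Lambda>9 \<in> bi_algebra"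
  "M8 \<in> bi_algebra" "M10 \<in> bi_algebra" "K12 \<in> bi_algebra" "N12 \<in> bi_algebra" "H14 \<in> bi_algebra"
  "F16 \<in> bi_algebra" "X18 \<in> bi_algebra" "X19 \<in> bi_algebra" "X21 \<in> bi_algebra" "X23 \<in> bi_algebra"
  "X25 \<in> bi_algebra" "Y27 \<in> bi_algebra" "0 \<in> bi_algebra" "1 \<in> bi_algebra"
  "Const c \<in> bi_algebra" "numeral n \<in> bi_algebra"
  "P \<in> bi_algebra \<Longrightarrow> Q \<in> bi_algebra \<Longrightarrow> P + Q \<in> bi_algebra"
  "P \<in> bi_algebra \<Longrightarrow> Q \<in> bi_algebra \<Longrightarrow> P - Q \<in> bi_algebra"
  "P \<in> bi_algebra \<Longrightarrow> Q \<in> bi_algebra \<Longrightarrow> P * Q \<in> bi_algebra"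
  "P \<in> bi_algebra \<Longrightarrow> - P \<in> bi_algebra"
  unfolding bi_algebra_def
  using generated_algebra.const[of "numeral n"]
  by (simp_all add: generated_algebra.gen generated_algebra.const generated_algebra.add generated_algebra_diff
      generated_algebra.mult generated_algebra_uminus Const_numeral)

text \<open>
  The letters: at $f_1' = 0$, with $s = \Lambda^5/(3\Lambda^3)$ and up to nonzero constants, the letters of
  the types \<open>TC\<close>, \<open>TQ\<close>, \<open>TK\<close>, \<open>TX\<close>, \<open>TP\<close> take the values $\Lambda^3 s^j$, $M^8 s^j$, $N^{12} s^j$,
  $M^8 N^{12} s/\Lambda^3$ and $(64 (M^8)^3 + 5 \cdot 7^j (N^{12})^2) s^j / \Lambda^3$ respectively.
\<close>

datatype ty = TC | TQ | TK | TX | TP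

fun lo :: "ty \<Rightarrow> nat" where
  "lo TX = 1" | "lo _ = 0"

fun hi :: "ty \<Rightarrow> nat" where
  "hi TC = 3" | "hi TQ = 2" | "hi TK = 3" | "hi TX = 1" | "hi TP = 3"

fun letter :: "ty \<Rightarrow> nat \<Rightarrow> jet_poly" where
  "letter TC j = [\<Lambda>3, \<Lambda>5, \<Lambda>7, \<Lambda>9] ! j"
| "letter TQ j = [M8, M10, K12] ! j"
| "letter TK j = [N12, H14, F16, X18] ! j"
| "letter TX j = X19"
| "letter TP j = [X21, X23, X25, Y27] ! j"

definition tp :: "ty \<Rightarrow> nat" where
  "tp T = (if T = TP then 1 else 0)"

inductive filt :: "nat \<Rightarrow> jet_poly \<Rightarrow> bool" where
  filt_Const: "filt 0 (Const c)"
| filt_letter: "lo T \<le> j \<Longrightarrow> j \<le> hi T \<Longrightarrow> filt (tp T) (letter T j)"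
| filt_add: "filt p x \<Longrightarrow> filt p y \<Longrightarrow> filt p (x + y)"
| filt_mult: "filt p x \<Longrightarrow> filt q y \<Longrightarrow> filt (p + q) (x * y)"
| filt_Suc: "filt p x \<Longrightarrow> filt (Suc p) x"

lemma filt_letters:
  "filt 0 \<Lambda>3" "filt 0 \<Lambda>5" "filt 0 \<Lambda>7" "filt 0 \<Lambda>9" "filt 0 M8" "filt 0 M10" "filt 0 K12"
  "filt 0 N12" "filt 0 H14" "filt 0 F16" "filt 0 X18" "filt 0 X19"
  using filt_letter[of TC 0] filt_letter[of TC 1] filt_letter[of TC 2] filt_letter[of TC 3]
    filt_letter[of TQ 0] filt_letter[of TQ 1] filt_letter[of TQ 2]
    filt_letter[of TK 0] filt_letter[of TK 1] filt_letter[of TK 2] filt_letter[of TK 3]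
    filt_letter[of TX 1]
  by (simp_all add: tp_def numeral_2_eq_2 numeral_3_eq_3)

lemma filt_numeral: "filt 0 (numeral n)"
  using filt_Const[of "numeral n"] by (simp add: Const_numeral)

lemma filt_mult_0: "filt 0 x \<Longrightarrow> filt 0 y \<Longrightarrow> filt 0 (x * y)"
  using filt_mult[of 0 x 0 y] by simp

lemma filt_scale: "filt p x \<Longrightarrow> filt p (Const c * x)"
  using filt_mult[OF filt_Const, of p x c] by simp

lemma filt_uminus: "filt p x \<Longrightarrow> filt p (- x)"
  using filt_scale[of p x "-1"] by (simp add: Const_minus)

lemma filt_diff: "filt p x \<Longrightarrow> filt p y \<Longrightarrow> filt p (x - y)"
  using filt_add[OF _ filt_uminus, of p x y] by simp

lemma filt_mono: "filt p x \<Longrightarrow> p \<le> q \<Longrightarrow> filt q x"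
  by (rotate_tac 1, induction q rule: dec_induct) (auto intro: filt_Suc)

lemma letter_in_bi_algebra:
  assumes "lo T \<le> j" "j \<le> hi T"
  shows "letter T j \<in> bi_algebra"
proof -
  have "j = 0 \<or> j = 1 \<or> j = 2 \<or> j = 3" using assms by (cases T) auto
  then show ?thesis
    using assms by (cases T; elim disjE) (simp_all add: bi_algebra_intros)
qed

lemma filt_in_bi_algebra: "filt p x \<Longrightarrow> x \<in> bi_algebra"
  by (induction rule: filt.induct) (simp_all add: bi_algebra_intros letter_in_bi_algebra)

text \<open>
  \<open>neg p x\<close> (negligible): \<open>x\<close> is a multiple of $f_1'$ up to terms of degree less than \<open>p\<close> in the letters of type \<open>TP\<close>.
\<close>

inductive neg :: "nat \<Rightarrow> jet_poly \<Rightarrow> bool" where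
  neg_f1: "y \<in> bi_algebra \<Longrightarrow> neg p (f1 * y)"
| neg_low: "filt q z \<Longrightarrow> q < p \<Longrightarrow> neg p z"
| neg_add: "neg p x \<Longrightarrow> neg p y \<Longrightarrow> neg p (x + y)"

lemma neg_0: "neg p 0"
  using neg_f1[of 0 p] by (simp add: bi_algebra_intros)

lemma neg_mult:
  assumes "neg p x" "filt q y"
  shows "neg (p + q) (x * y)"
  using assms(1)
proof induction
  case (neg_f1 z p)
  then show ?case
    using neg.neg_f1[of "z * y" "p + q"] filt_in_bi_algebra[OF assms(2)]
    by (simp add: bi_algebra_intros mult.assoc)
next
  case (neg_low r z p)
  then show ?case by (intro neg.neg_low[OF filt_mult[OF _ assms(2)]]) auto
next
  case (neg_add p x z)
  then show ?case by (simp add: distrib_right neg.neg_add)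
qed

lemma neg_scale: "neg p x \<Longrightarrow> neg p (Const c * x)"
  using neg_mult[OF _ filt_Const, of p x c] by (simp add: mult.commute)

lemma neg_diff: "neg p x \<Longrightarrow> neg p y \<Longrightarrow> neg p (x - y)"
  using neg_add[OF _ neg_scale, of p x y "-1"] by (simp add: Const_minus)

definition sim :: "nat \<Rightarrow> jet_poly \<Rightarrow> jet_poly \<Rightarrow> bool" where
  "sim p x y \<longleftrightarrow> (\<exists>c. c \<noteq> 0 \<and> neg p (x - Const c * y))"

lemma sim_refl: "sim p x x"
  unfolding sim_def by (rule exI[of _ 1]) (simp add: neg_0)

lemma sim_sym:
  assumes "sim p x y"
  shows "sim p y x"
proof -
  obtain c where c: "c \<noteq> 0" "neg p (x - Const c * y)" using assms unfolding sim_def by (elim exE conjE)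
  have "Const (- inverse c) * (x - Const c * y) = y - Const (inverse c) * x"
  proof -
    have "Const (inverse c) * (Const c * y) = y"
      using c(1) by (simp add: mult.assoc[symmetric] Const_mult[symmetric])
    then show ?thesis by (simp add: right_diff_distrib Const_minus)
  qed
  then have "neg p (y - Const (inverse c) * x)" using neg_scale[OF c(2), of "- inverse c"] by simp
  then show ?thesis unfolding sim_def using c(1) by (intro exI[of _ "inverse c"]) simp
qed

lemma sim_trans:
  assumes "sim p x y" "sim p y z"
  shows "sim p x z"
proof -
  obtain c where c: "c \<noteq> 0" "neg p (x - Const c * y)" using assms(1) unfolding sim_def by (elim exE conjE)
  obtain d where d: "d \<noteq> 0" "neg p (y - Const d * z)" using assms(2) unfolding sim_def by (elim exE conjE)
  have "(x - Const c * y) + Const c * (y - Const d * z) = x - Const (c * d) * z"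
    by (simp add: right_diff_distrib Const_mult mult.assoc)
  then have "neg p (x - Const (c * d) * z)" using neg_add[OF c(2) neg_scale[OF d(2)]] by metis
  then show ?thesis unfolding sim_def using c(1) d(1) by (intro exI[of _ "c * d"]) simp
qed

lemma sim_mult:
  assumes "sim p x y" "filt q w" "r = p + q"
  shows "sim r (w * x) (w * y)" "sim r (x * w) (y * w)"
proof -
  obtain c where c: "c \<noteq> 0" "neg p (x - Const c * y)" using assms unfolding sim_def by (elim exE conjE)
  have "(x - Const c * y) * w = x * w - Const c * (y * w)"
    by (simp add: left_diff_distrib mult.assoc)
  then have "neg r (x * w - Const c * (y * w))"
    using neg_mult[OF c(2) assms(2)] assms(3) by simp
  then show "sim r (x * w) (y * w)" unfolding sim_def using c(1) by (intro exI[of _ c]) simp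
  then show "sim r (w * x) (w * y)" by (simp only: mult.commute[of w])
qed

lemma sim_neg: "neg p x \<Longrightarrow> neg p y \<Longrightarrow> sim p x y"
  unfolding sim_def by (intro exI[of _ 1]) (simp add: neg_diff)

lemma neg_sim:
  assumes "sim p x y" "neg p y"
  shows "neg p x"
proof -
  obtain c where c: "c \<noteq> 0" "neg p (x - Const c * y)" using assms unfolding sim_def by (elim exE conjE)
  have "neg p ((x - Const c * y) + Const c * y)" by (rule neg_add[OF c(2) neg_scale[OF assms(2)]])
  then show ?thesis by simp
qed

lemma relation_eqI:
  assumes "bi_invariant m X" "bi_invariant m Y" "bi_invariant m (f1 * A)" "bi_invariant m Z"
    "\<And>a b c d. k * ev (slice a b c d) X = l * ev (slice a b c d) Y + ev (slice a b c d) A + ev (slice a b c d) Z"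
    "k \<noteq> 0"
  shows "X - Const (l / k) * Y = f1 * (Const (1 / k) * A) + Const (1 / k) * Z"
proof (rule bi_invariant_eqI)
  show "bi_invariant m (X - Const (l / k) * Y)"
    using assms(1,2) by (intro bi_invariant_diff bi_invariant_mult[OF bi_invariant_Const]) simp_all
  have "bi_invariant m (Const (1 / k) * (f1 * A) + Const (1 / k) * Z)"
    using assms(3,4) by (intro bi_invariant_add bi_invariant_mult[OF bi_invariant_Const]) simp_all
  then show "bi_invariant m (f1 * (Const (1 / k) * A) + Const (1 / k) * Z)"
    by (simp only: mult.left_commute)
  fix a b c d
  have "ev (slice a b c d) X = (k * ev (slice a b c d) X) / k" using assms(6) by simp
  also have "\<dots> = (l * ev (slice a b c d) Y + ev (slice a b c d) A + ev (slice a b c d) Z) / k"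
    by (simp only: assms(5))
  finally show "ev (slice a b c d) (X - Const (l / k) * Y) =
      ev (slice a b c d) (f1 * (Const (1 / k) * A) + Const (1 / k) * Z)"
    by (simp add: add_divide_distrib)
qed

lemma sim_relation:
  assumes "\<And>a b c d. k * ev (slice a b c d) X = l * ev (slice a b c d) Y + ev (slice a b c d) A + ev (slice a b c d) Z"
    "bi_invariant m X" "bi_invariant m Y" "bi_invariant m (f1 * A)" "bi_invariant m Z"
    "A \<in> bi_algebra" "k \<noteq> 0" "l \<noteq> 0" "Z = 0 \<or> filt 0 Z \<and> p > 0"
  shows "sim p X Y"
proof -
  have z: "neg p Z" using assms(9) neg_0 neg_low[of 0 Z p] by blast
  have "neg p (f1 * (Const (1 / k) * A) + Const (1 / k) * Z)"
    using assms(6) by (intro neg_add neg_f1 neg_scale z bi_algebra_intros)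
  then show ?thesis
    unfolding sim_def relation_eqI[OF assms(2-5,1,7), symmetric]
    using assms(7,8) by (intro exI[of _ "l / k"]) simp
qed

lemma sim_relation_low:
  assumes "\<And>a b c d. k * ev (slice a b c d) X = l * ev (slice a b c d) Y + ev (slice a b c d) A + ev (slice a b c d) Z"
    "bi_invariant m X" "bi_invariant m Y" "bi_invariant m (f1 * A)" "bi_invariant m Z"
    "A \<in> bi_algebra" "k \<noteq> 0" "l \<noteq> 0" "filt 0 Z" "p > 0"
  shows "sim p X Y"
  by (rule sim_relation[OF assms(1-8)]) (use assms(9,10) in simp)

lemma neg_relation:
  assumes "\<And>a b c d. k * ev (slice a b c d) X = ev (slice a b c d) A + ev (slice a b c d) Z"
    "bi_invariant m X" "bi_invariant m (f1 * A)" "bi_invariant m Z"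
    "A \<in> bi_algebra" "k \<noteq> 0" "filt 0 Z" "p > 0"
  shows "neg p X"
proof -
  have "neg p (f1 * (Const (1 / k) * A) + Const (1 / k) * Z)"
    using assms(5,7,8) by (intro neg_add neg_f1 neg_scale neg_low[of 0] bi_algebra_intros)
  moreover have "X - Const (0 / k) * 0 = f1 * (Const (1 / k) * A) + Const (1 / k) * Z"
    by (rule relation_eqI[OF assms(2) bi_invariant_0 assms(3,4) _ assms(6)]) (simp add: assms(1))
  ultimately show ?thesis by simp
qed

lemmas relation_intros = filt_letters filt_numeral filt_mult_0 filt_uminus filt_add filt_diff
  bi_algebra_intros bi_invariant_0 bi_invariant_intros bi_invariant_generators

lemmas slice_values = ev_simps ev_uminus ev_diff ev_numeral slice_simps slice_\<Lambda> X18(3) X19(3) X21(3) X23(3) X25(3) Y27(3) slice_basic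

lemma swap_CC:
  "sim 0 (\<Lambda>3 * \<Lambda>7) (\<Lambda>5 * \<Lambda>5)"
  "sim 0 (\<Lambda>3 * \<Lambda>9) (\<Lambda>5 * \<Lambda>7)"
  "sim 0 (\<Lambda>5 * \<Lambda>9) (\<Lambda>7 * \<Lambda>7)"
proof -
  show "sim 0 (\<Lambda>3 * \<Lambda>7) (\<Lambda>5 * \<Lambda>5)"
    by (rule sim_relation[where k = 3 and l = 5 and m = 10 and A = "f1 * M8" and Z = "0"],
        simp only: slice_values, algebra, (rule relation_intros | simp)+)
  show "sim 0 (\<Lambda>3 * \<Lambda>9) (\<Lambda>5 * \<Lambda>7)"
    by (rule sim_relation[where k = 3 and l = 7 and m = 12 and A = "f1 * M10" and Z = "0"],
        simp only: slice_values, algebra, (rule relation_intros | simp)+)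
  show "sim 0 (\<Lambda>5 * \<Lambda>9) (\<Lambda>7 * \<Lambda>7)"
    by (rule sim_relation[where k = 5 and l = 7 and m = 14 and A = "f1 * K12" and Z = "0"],
        simp only: slice_values, algebra, (rule relation_intros | simp)+)
qed

lemma swap_CQ:
  "sim 0 (\<Lambda>3 * M10) (\<Lambda>5 * M8)"
  "sim 0 (\<Lambda>3 * K12) (\<Lambda>5 * M10)"
  "sim 0 (\<Lambda>5 * M10) (\<Lambda>7 * M8)"
  "sim 0 (\<Lambda>5 * K12) (\<Lambda>7 * M10)"
  "sim 0 (\<Lambda>7 * M10) (\<Lambda>9 * M8)"
  "sim 0 (\<Lambda>7 * K12) (\<Lambda>9 * M10)"
proof -
  show "sim 0 (\<Lambda>3 * M10) (\<Lambda>5 * M8)"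
    by (rule sim_relation[where k = 3 and l = 8 and m = 13 and A = "N12" and Z = "0"],
        simp only: slice_values, algebra, (rule relation_intros | simp)+)
  show "sim 0 (\<Lambda>3 * K12) (\<Lambda>5 * M10)"
    by (rule sim_relation[where k = 24 and l = 5 and m = 15 and A = "7 * H14" and Z = "0"],
        simp only: slice_values, algebra, (rule relation_intros | simp)+)
  show "sim 0 (\<Lambda>5 * M10) (\<Lambda>7 * M8)"
    by (rule sim_relation[where k = 5 and l = 8 and m = 15 and A = "H14" and Z = "0"],
        simp only: slice_values, algebra, (rule relation_intros | simp)+)
  show "sim 0 (\<Lambda>5 * K12) (\<Lambda>7 * M10)"
    by (rule sim_relation[where k = 8 and l = 1 and m = 17 and A = "F16" and Z = "0"],
        simp only: slice_values, algebra, (rule relation_intros | simp)+)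
  show "sim 0 (\<Lambda>7 * M10) (\<Lambda>9 * M8)"
    by (rule sim_relation[where k = 7 and l = 8 and m = 17 and A = "F16" and Z = "0"],
        simp only: slice_values, algebra, (rule relation_intros | simp)+)
  show "sim 0 (\<Lambda>7 * K12) (\<Lambda>9 * M10)"
    by (rule sim_relation[where k = 56 and l = 5 and m = 19 and A = "X18" and Z = "0"],
        simp only: slice_values, algebra, (rule relation_intros | simp)+)
qed

lemma swap_CK:
  "sim 0 (\<Lambda>3 * H14) (\<Lambda>5 * N12)"
  "sim 0 (\<Lambda>3 * F16) (\<Lambda>5 * H14)"
  "sim 0 (\<Lambda>3 * X18) (\<Lambda>5 * F16)"
  "sim 0 (\<Lambda>5 * H14) (\<Lambda>7 * N12)"
  "sim 0 (\<Lambda>5 * F16) (\<Lambda>7 * H14)"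
  "sim 0 (\<Lambda>5 * X18) (\<Lambda>7 * F16)"
  "sim 0 (\<Lambda>7 * H14) (\<Lambda>9 * N12)"
  "sim 0 (\<Lambda>7 * F16) (\<Lambda>9 * H14)"
  "sim 0 (\<Lambda>7 * X18) (\<Lambda>9 * F16)"
proof -
  show "sim 0 (\<Lambda>3 * H14) (\<Lambda>5 * N12)"
    by (rule sim_relation[where k = 3 and l = 5 and m = 17 and A = "- (8 * (M8 * M8))" and Z = "0"],
        simp only: slice_values, algebra, (rule relation_intros | simp)+)
  show "sim 0 (\<Lambda>3 * F16) (\<Lambda>5 * H14)"
    by (rule sim_relation[where k = 3 and l = 7 and m = 19 and A = "- (M8 * M10)" and Z = "0"],
        simp only: slice_values, algebra, (rule relation_intros | simp)+)
  show "sim 0 (\<Lambda>3 * X18) (\<Lambda>5 * F16)"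
    by (rule sim_relation[where k = 3 and l = 35 and m = 21 and A = "- (5 * (M10 * M10)) + 56 * (M8 * K12)" and Z = "0"],
        simp only: slice_values, algebra, (rule relation_intros | simp)+)
  show "sim 0 (\<Lambda>5 * H14) (\<Lambda>7 * N12)"
    by (rule sim_relation[where k = 1 and l = 1 and m = 19 and A = "- (M8 * M10)" and Z = "0"],
        simp only: slice_values, algebra, (rule relation_intros | simp)+)
  show "sim 0 (\<Lambda>5 * F16) (\<Lambda>7 * H14)"
    by (rule sim_relation[where k = 5 and l = 7 and m = 21 and A = "- (8 * (M8 * K12))" and Z = "0"],
        simp only: slice_values, algebra, (rule relation_intros | simp)+)
  show "sim 0 (\<Lambda>5 * X18) (\<Lambda>7 * F16)"
    by (rule sim_relation[where k = 1 and l = 7 and m = 23 and A = "- (M10 * K12)" and Z = "0"],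
        simp only: slice_values, algebra, (rule relation_intros | simp)+)
  show "sim 0 (\<Lambda>7 * H14) (\<Lambda>9 * N12)"
    by (rule sim_relation[where k = 7 and l = 5 and m = 21 and A = "- (5 * (M10 * M10)) + 8 * (M8 * K12)" and Z = "0"],
        simp only: slice_values, algebra, (rule relation_intros | simp)+)
  show "sim 0 (\<Lambda>7 * F16) (\<Lambda>9 * H14)"
    by (rule sim_relation[where k = 1 and l = 1 and m = 23 and A = "- (M10 * K12)" and Z = "0"],
        simp only: slice_values, algebra, (rule relation_intros | simp)+)
  show "sim 0 (\<Lambda>7 * X18) (\<Lambda>9 * F16)"
    by (rule sim_relation[where k = 1 and l = 5 and m = 25 and A = "- (8 * (K12 * K12))" and Z = "0"],
        simp only: slice_values, algebra, (rule relation_intros | simp)+)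
qed

lemma swap_QQ:
  "sim 0 (M8 * K12) (M10 * M10)"
proof -
  show "sim 0 (M8 * K12) (M10 * M10)"
    by (rule sim_relation[where k = 64 and l = 5 and m = 20 and A = "X19" and Z = "0"],
        simp only: slice_values, algebra, (rule relation_intros | simp)+)
qed

lemma swap_QK:
  "sim 0 (M8 * H14) (M10 * N12)"
  "sim 0 (M8 * F16) (M10 * H14)"
  "sim 0 (M8 * X18) (M10 * F16)"
  "sim 0 (M10 * H14) (K12 * N12)"
  "sim 0 (M10 * F16) (K12 * H14)"
  "sim 0 (M10 * X18) (K12 * F16)"
proof -
  show "sim 0 (M8 * H14) (M10 * N12)"
    by (rule sim_relation[where k = 8 and l = 5 and m = 22 and A = "X21" and Z = "0"],
        simp only: slice_values, algebra, (rule relation_intros | simp)+)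
  show "sim 0 (M8 * F16) (M10 * H14)"
    by (rule sim_relation[where k = 8 and l = 7 and m = 24 and A = "X23" and Z = "0"],
        simp only: slice_values, algebra, (rule relation_intros | simp)+)
  show "sim 0 (M8 * X18) (M10 * F16)"
    by (rule sim_relation[where k = 8 and l = 35 and m = 26 and A = "X25" and Z = "0"],
        simp only: slice_values, algebra, (rule relation_intros | simp)+)
  show "sim 0 (M10 * H14) (K12 * N12)"
    by (rule sim_relation[where k = 1 and l = 8 and m = 24 and A = "X23" and Z = "0"],
        simp only: slice_values, algebra, (rule relation_intros | simp)+)
  show "sim 0 (M10 * F16) (K12 * H14)"
    by (rule sim_relation[where k = 5 and l = 56 and m = 26 and A = "X25" and Z = "0"],
        simp only: slice_values, algebra, (rule relation_intros | simp)+)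
  show "sim 0 (M10 * X18) (K12 * F16)"
    by (rule sim_relation[where k = 1 and l = 56 and m = 28 and A = "Y27" and Z = "0"],
        simp only: slice_values, algebra, (rule relation_intros | simp)+)
qed

lemma swap_QP:
  "sim 1 (M8 * X23) (M10 * X21)"
  "sim 1 (M8 * X25) (M10 * X23)"
  "sim 1 (M8 * Y27) (M10 * X25)"
  "sim 1 (M10 * X23) (K12 * X21)"
  "sim 1 (M10 * X25) (K12 * X23)"
  "sim 1 (M10 * Y27) (K12 * X25)"
proof -
  show "sim 1 (M8 * X23) (M10 * X21)"
    by (rule sim_relation_low[where k = 8 and l = 1 and m = 31 and A = "0" and Z = "- (N12 * X19)"],
        simp only: slice_values, algebra, (rule relation_intros | simp)+)
  show "sim 1 (M8 * X25) (M10 * X23)"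
    by (rule sim_relation_low[where k = 8 and l = 5 and m = 33 and A = "0" and Z = "- (7 * (H14 * X19))"],
        simp only: slice_values, algebra, (rule relation_intros | simp)+)
  show "sim 1 (M8 * Y27) (M10 * X25)"
    by (rule sim_relation_low[where k = 8 and l = 1 and m = 35 and A = "0" and Z = "- (7 * (F16 * X19))"],
        simp only: slice_values, algebra, (rule relation_intros | simp)+)
  show "sim 1 (M10 * X23) (K12 * X21)"
    by (rule sim_relation_low[where k = 5 and l = 8 and m = 33 and A = "0" and Z = "- (H14 * X19)"],
        simp only: slice_values, algebra, (rule relation_intros | simp)+)
  show "sim 1 (M10 * X25) (K12 * X23)"
    by (rule sim_relation_low[where k = 1 and l = 8 and m = 35 and A = "0" and Z = "- (F16 * X19)"],
        simp only: slice_values, algebra, (rule relation_intros | simp)+)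
  show "sim 1 (M10 * Y27) (K12 * X25)"
    by (rule sim_relation_low[where k = 5 and l = 8 and m = 37 and A = "0" and Z = "- (X18 * X19)"],
        simp only: slice_values, algebra, (rule relation_intros | simp)+)
qed

lemma swap_KK:
  "sim 0 (N12 * F16) (H14 * H14)"
  "sim 0 (N12 * X18) (H14 * F16)"
  "sim 0 (H14 * X18) (F16 * F16)"
proof -
  show "sim 0 (N12 * F16) (H14 * H14)"
    by (rule sim_relation[where k = 5 and l = 7 and m = 28 and A = "M8 * X19" and Z = "0"],
        simp only: slice_values, algebra, (rule relation_intros | simp)+)
  show "sim 0 (N12 * X18) (H14 * F16)"
    by (rule sim_relation[where k = 1 and l = 7 and m = 30 and A = "M10 * X19" and Z = "0"],
        simp only: slice_values, algebra, (rule relation_intros | simp)+)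
  show "sim 0 (H14 * X18) (F16 * F16)"
    by (rule sim_relation[where k = 1 and l = 5 and m = 32 and A = "K12 * X19" and Z = "0"],
        simp only: slice_values, algebra, (rule relation_intros | simp)+)
qed

lemma swap_KP:
  "sim 1 (N12 * X23) (H14 * X21)"
  "sim 1 (N12 * X25) (H14 * X23)"
  "sim 1 (N12 * Y27) (H14 * X25)"
  "sim 1 (H14 * X23) (F16 * X21)"
  "sim 1 (H14 * X25) (F16 * X23)"
  "sim 1 (H14 * Y27) (F16 * X25)"
  "sim 1 (F16 * X23) (X18 * X21)"
  "sim 1 (F16 * X25) (X18 * X23)"
  "sim 1 (F16 * Y27) (X18 * X25)"
proof -
  show "sim 1 (N12 * X23) (H14 * X21)"
    by (rule sim_relation_low[where k = 5 and l = 7 and m = 35 and A = "0" and Z = "8 * (M8 * M8 * X19)"],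
        simp only: slice_values, algebra, (rule relation_intros | simp)+)
  show "sim 1 (N12 * X25) (H14 * X23)"
    by (rule sim_relation_low[where k = 1 and l = 7 and m = 37 and A = "0" and Z = "M8 * M10 * X19"],
        simp only: slice_values, algebra, (rule relation_intros | simp)+)
  show "sim 1 (N12 * Y27) (H14 * X25)"
    by (rule sim_relation_low[where k = 5 and l = 7 and m = 39 and A = "0" and Z = "5 * (M10 * M10 * X19) - 56 * (M8 * K12 * X19)"],
        simp only: slice_values, algebra, (rule relation_intros | simp)+)
  show "sim 1 (H14 * X23) (F16 * X21)"
    by (rule sim_relation_low[where k = 1 and l = 1 and m = 37 and A = "0" and Z = "M8 * M10 * X19"],
        simp only: slice_values, algebra, (rule relation_intros | simp)+)
  show "sim 1 (H14 * X25) (F16 * X23)"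
    by (rule sim_relation_low[where k = 1 and l = 5 and m = 39 and A = "0" and Z = "8 * (M8 * K12 * X19)"],
        simp only: slice_values, algebra, (rule relation_intros | simp)+)
  show "sim 1 (H14 * Y27) (F16 * X25)"
    by (rule sim_relation_low[where k = 1 and l = 1 and m = 41 and A = "0" and Z = "M10 * K12 * X19"],
        simp only: slice_values, algebra, (rule relation_intros | simp)+)
  show "sim 1 (F16 * X23) (X18 * X21)"
    by (rule sim_relation_low[where k = 5 and l = 1 and m = 39 and A = "0" and Z = "5 * (M10 * M10 * X19) - 8 * (M8 * K12 * X19)"],
        simp only: slice_values, algebra, (rule relation_intros | simp)+)
  show "sim 1 (F16 * X25) (X18 * X23)"
    by (rule sim_relation_low[where k = 1 and l = 1 and m = 41 and A = "0" and Z = "7 * (M10 * K12 * X19)"],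
        simp only: slice_values, algebra, (rule relation_intros | simp)+)
  show "sim 1 (F16 * Y27) (X18 * X25)"
    by (rule sim_relation_low[where k = 5 and l = 1 and m = 43 and A = "0" and Z = "56 * (K12 * K12 * X19)"],
        simp only: slice_values, algebra, (rule relation_intros | simp)+)
qed

lemma swap_PP:
  "sim 2 (X21 * X25) (X23 * X23)"
  "sim 2 (X21 * Y27) (X23 * X25)"
  "sim 2 (X23 * Y27) (X25 * X25)"
proof -
  show "sim 2 (X21 * X25) (X23 * X23)"
    by (rule sim_relation_low[where k = 1 and l = 5 and m = 46 and A = "0" and Z = "M8 * X19 * X19"],
        simp only: slice_values, algebra, (rule relation_intros | simp)+)
  show "sim 2 (X21 * Y27) (X23 * X25)"
    by (rule sim_relation_low[where k = 1 and l = 1 and m = 48 and A = "0" and Z = "M10 * X19 * X19"],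
        simp only: slice_values, algebra, (rule relation_intros | simp)+)
  show "sim 2 (X23 * Y27) (X25 * X25)"
    by (rule sim_relation_low[where k = 5 and l = 1 and m = 50 and A = "0" and Z = "7 * (K12 * X19 * X19)"],
        simp only: slice_values, algebra, (rule relation_intros | simp)+)
qed

lemma conversion_CX:
  "sim 0 (\<Lambda>3 * X19) (M10 * N12)"
  "sim 0 (\<Lambda>5 * X19) (K12 * N12)"
  "sim 0 (\<Lambda>7 * X19) (K12 * H14)"
  "sim 0 (\<Lambda>9 * X19) (K12 * F16)"
proof -
  show "sim 0 (\<Lambda>3 * X19) (M10 * N12)"
    by (rule sim_relation[where k = 3 and l = 30 and m = 22 and A = "7 * X21" and Z = "0"],
        simp only: slice_values, algebra, (rule relation_intros | simp)+)
  show "sim 0 (\<Lambda>5 * X19) (K12 * N12)"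
    by (rule sim_relation[where k = 1 and l = 48 and m = 24 and A = "7 * X23" and Z = "0"],
        simp only: slice_values, algebra, (rule relation_intros | simp)+)
  show "sim 0 (\<Lambda>7 * X19) (K12 * H14)"
    by (rule sim_relation[where k = 1 and l = 48 and m = 26 and A = "X25" and Z = "0"],
        simp only: slice_values, algebra, (rule relation_intros | simp)+)
  show "sim 0 (\<Lambda>9 * X19) (K12 * F16)"
    by (rule sim_relation[where k = 1 and l = 48 and m = 28 and A = "Y27" and Z = "0"],
        simp only: slice_values, algebra, (rule relation_intros | simp)+)
qed

lemma negligible_CP:
  "neg 1 (\<Lambda>3 * X21)"
  "neg 1 (\<Lambda>3 * X23)"
  "neg 1 (\<Lambda>3 * X25)"
  "neg 1 (\<Lambda>3 * Y27)"
  "neg 1 (\<Lambda>5 * X21)"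
  "neg 1 (\<Lambda>5 * X23)"
  "neg 1 (\<Lambda>5 * X25)"
  "neg 1 (\<Lambda>5 * Y27)"
  "neg 1 (\<Lambda>7 * X21)"
  "neg 1 (\<Lambda>7 * X23)"
  "neg 1 (\<Lambda>7 * X25)"
  "neg 1 (\<Lambda>7 * Y27)"
  "neg 1 (\<Lambda>9 * X21)"
  "neg 1 (\<Lambda>9 * X23)"
  "neg 1 (\<Lambda>9 * X25)"
  "neg 1 (\<Lambda>9 * Y27)"
proof -
  show "neg 1 (\<Lambda>3 * X21)"
    by (rule neg_relation[where k = 3 and m = 24 and A = "0" and Z = "- (5 * (N12 * N12)) - 64 * (M8 * M8 * M8)"],
        simp only: slice_values, algebra, (rule relation_intros | simp)+)
  show "neg 1 (\<Lambda>3 * X23)"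
    by (rule neg_relation[where k = 3 and m = 26 and A = "0" and Z = "- (7 * (N12 * H14)) - 8 * (M8 * M8 * M10)"],
        simp only: slice_values, algebra, (rule relation_intros | simp)+)
  show "neg 1 (\<Lambda>3 * X25)"
    by (rule neg_relation[where k = 3 and m = 28 and A = "0" and Z = "- (49 * (H14 * H14)) - 5 * (M8 * M10 * M10)"],
        simp only: slice_values, algebra, (rule relation_intros | simp)+)
  show "neg 1 (\<Lambda>3 * Y27)"
    by (rule neg_relation[where k = 24 and m = 30 and A = "0" and Z = "- (441 * (H14 * F16)) + 7 * (N12 * X18) - 5 * (M10 * M10 * M10)"],
        simp only: slice_values, algebra, (rule relation_intros | simp)+)
  show "neg 1 (\<Lambda>5 * X21)"
    by (rule neg_relation[where k = 1 and m = 26 and A = "0" and Z = "- (N12 * H14) - 8 * (M8 * M8 * M10)"],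
        simp only: slice_values, algebra, (rule relation_intros | simp)+)
  show "neg 1 (\<Lambda>5 * X23)"
    by (rule neg_relation[where k = 1 and m = 28 and A = "0" and Z = "- (M8 * M10 * M10) - N12 * F16"],
        simp only: slice_values, algebra, (rule relation_intros | simp)+)
  show "neg 1 (\<Lambda>5 * X25)"
    by (rule neg_relation[where k = 1 and m = 30 and A = "0" and Z = "- (7 * (H14 * F16)) - 8 * (M8 * M10 * K12)"],
        simp only: slice_values, algebra, (rule relation_intros | simp)+)
  show "neg 1 (\<Lambda>5 * Y27)"
    by (rule neg_relation[where k = 1 and m = 32 and A = "0" and Z = "- (7 * (F16 * F16)) - M10 * M10 * K12"],
        simp only: slice_values, algebra, (rule relation_intros | simp)+)
  show "neg 1 (\<Lambda>7 * X21)"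
    by (rule neg_relation[where k = 1 and m = 28 and A = "0" and Z = "- (H14 * H14) - 5 * (M8 * M10 * M10)"],
        simp only: slice_values, algebra, (rule relation_intros | simp)+)
  show "neg 1 (\<Lambda>7 * X23)"
    by (rule neg_relation[where k = 1 and m = 30 and A = "0" and Z = "- (H14 * F16) - 8 * (M8 * M10 * K12)"],
        simp only: slice_values, algebra, (rule relation_intros | simp)+)
  show "neg 1 (\<Lambda>7 * X25)"
    by (rule neg_relation[where k = 1 and m = 32 and A = "0" and Z = "- (5 * (M10 * M10 * K12)) - H14 * X18"],
        simp only: slice_values, algebra, (rule relation_intros | simp)+)
  show "neg 1 (\<Lambda>7 * Y27)"
    by (rule neg_relation[where k = 1 and m = 34 and A = "0" and Z = "- (F16 * X18) - 8 * (M10 * K12 * K12)"],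
        simp only: slice_values, algebra, (rule relation_intros | simp)+)
  show "neg 1 (\<Lambda>9 * X21)"
    by (rule neg_relation[where k = 8 and m = 30 and A = "0" and Z = "- (15 * (H14 * F16)) + N12 * X18 - 35 * (M10 * M10 * M10)"],
        simp only: slice_values, algebra, (rule relation_intros | simp)+)
  show "neg 1 (\<Lambda>9 * X23)"
    by (rule neg_relation[where k = 1 and m = 32 and A = "0" and Z = "- (F16 * F16) - 7 * (M10 * M10 * K12)"],
        simp only: slice_values, algebra, (rule relation_intros | simp)+)
  show "neg 1 (\<Lambda>9 * X25)"
    by (rule neg_relation[where k = 1 and m = 34 and A = "0" and Z = "- (F16 * X18) - 56 * (M10 * K12 * K12)"],
        simp only: slice_values, algebra, (rule relation_intros | simp)+)
  show "neg 1 (\<Lambda>9 * Y27)"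
    by (rule neg_relation[where k = 5 and m = 36 and A = "0" and Z = "- (X18 * X18) - 448 * (K12 * K12 * K12)"],
        simp only: slice_values, algebra, (rule relation_intros | simp)+)
qed

lemma negligible_QKP:
  "neg 1 (M10 * (N12 * X21))"
  "neg 1 (K12 * (N12 * X21))"
  "neg 1 (K12 * (H14 * X21))"
  "neg 1 (K12 * (F16 * X21))"
  "neg 1 (K12 * (X18 * X21))"
  "neg 1 (K12 * (X18 * X23))"
  "neg 1 (K12 * (X18 * X25))"
proof -
  show "neg 1 (M10 * (N12 * X21))"
    by (rule neg_relation[where k = 30 and m = 43 and A = "- (7 * (X21 * X21))" and Z = "- (5 * (N12 * N12 * X19)) - 64 * (M8 * M8 * M8 * X19)"],
        simp only: slice_values, algebra, (rule relation_intros | simp)+)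
  show "neg 1 (K12 * (N12 * X21))"
    by (rule neg_relation[where k = 48 and m = 45 and A = "- (7 * (X21 * X23))" and Z = "- (N12 * H14 * X19) - 8 * (M8 * M8 * M10 * X19)"],
        simp only: slice_values, algebra, (rule relation_intros | simp)+)
  show "neg 1 (K12 * (H14 * X21))"
    by (rule neg_relation[where k = 48 and m = 47 and A = "- (X21 * X25)" and Z = "- (5 * (M8 * M10 * M10 * X19)) - H14 * H14 * X19"],
        simp only: slice_values, algebra, (rule relation_intros | simp)+)
  show "neg 1 (K12 * (F16 * X21))"
    by (rule neg_relation[where k = 48 and m = 49 and A = "- (X23 * X25)" and Z = "- (H14 * F16 * X19) - 56 * (M8 * M10 * K12 * X19)"],
        simp only: slice_values, algebra, (rule relation_intros | simp)+)
  show "neg 1 (K12 * (X18 * X21))"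
    by (rule neg_relation[where k = 48 and m = 51 and A = "- (X25 * X25)" and Z = "- (H14 * X18 * X19) - 245 * (M10 * M10 * K12 * X19)"],
        simp only: slice_values, algebra, (rule relation_intros | simp)+)
  show "neg 1 (K12 * (X18 * X23))"
    by (rule neg_relation[where k = 48 and m = 53 and A = "- (X25 * Y27)" and Z = "- (F16 * X18 * X19) - 392 * (M10 * K12 * K12 * X19)"],
        simp only: slice_values, algebra, (rule relation_intros | simp)+)
  show "neg 1 (K12 * (X18 * X25))"
    by (rule neg_relation[where k = 48 and m = 55 and A = "- (5 * (Y27 * Y27))" and Z = "- (X18 * X18 * X19) - 3136 * (K12 * K12 * K12 * X19)"],
        simp only: slice_values, algebra, (rule relation_intros | simp)+)
qed

section \<open>Words in the letters\<close>

lemma sim_commute: "sim p (b * a) (d * c) \<Longrightarrow> sim p (a * b) (c * d)"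
  by (simp only: mult.commute)

lemma neg_commute: "neg p (b * a) \<Longrightarrow> neg p (a * b)"
  by (simp only: mult.commute)

lemma sim_commute_refl: "sim p (a * b) (b * a)"
  by (simp only: mult.commute[of a] sim_refl)

lemmas swap_rules = swap_CC[unfolded One_nat_def] swap_CQ[unfolded One_nat_def] swap_CK[unfolded One_nat_def]
  swap_QQ[unfolded One_nat_def] swap_QK[unfolded One_nat_def] swap_QP[unfolded One_nat_def]
  swap_KK[unfolded One_nat_def] swap_KP[unfolded One_nat_def] swap_PP[unfolded numeral_2_eq_2]

lemma letter_swap:
  assumes "lo T \<le> k" "k < hi T" "lo U < l" "l \<le> hi U"
  shows "sim (tp T + tp U) (letter T k * letter U l) (letter T (k + 1) * letter U (l - 1))"
proof -
  have k: "k = 0 \<or> k = 1 \<or> k = 2" using assms(1,2) by (cases T) auto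
  have l: "l = 1 \<or> l = 2 \<or> l = 3" using assms(3,4) by (cases U) auto
  note neg_rules = negligible_CP[unfolded One_nat_def]
  show ?thesis
    using k l assms
    apply (cases T; cases U)
    apply (simp_all only: lo.simps hi.simps)
    apply (elim disjE; simp add: tp_def; (rule sim_refl sim_commute_refl | rule swap_rules
        | (rule sim_sym, rule swap_rules) | (rule sim_commute, rule swap_rules)
        | (rule sim_sym, rule sim_commute, rule swap_rules)
        | (rule sim_neg; rule neg_rules) | (rule sim_neg; rule neg_commute, rule neg_rules)))+
    done
qed

definition LO :: "ty list \<Rightarrow> nat" where "LO w = sum_list (map lo w)"
definition HI :: "ty list \<Rightarrow> nat" where "HI w = sum_list (map hi w)"
definition tps :: "ty list \<Rightarrow> nat" where "tps w = sum_list (map tp w)"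

lemma LO_HI_tps_simps [simp]:
  "LO [] = 0" "LO (T # w) = lo T + LO w" "LO (u @ v) = LO u + LO v"
  "HI [] = 0" "HI (T # w) = hi T + HI w" "HI (u @ v) = HI u + HI v"
  "tps [] = 0" "tps (T # w) = tp T + tps w" "tps (u @ v) = tps u + tps v"
  by (simp_all add: LO_def HI_def tps_def)

lemma lo_le_hi: "lo T \<le> hi T"
  by (cases T) auto

lemma LO_le_HI: "LO w \<le> HI w"
  by (induction w) (auto intro: add_mono lo_le_hi)

definition valid :: "ty list \<Rightarrow> nat \<Rightarrow> bool" where
  "valid w j \<longleftrightarrow> LO w \<le> j \<and> j \<le> HI w"

fun canon :: "ty list \<Rightarrow> nat \<Rightarrow> jet_poly" where
  "canon [] j = 1"
| "canon (T # w) j = letter T (min (hi T) (j - LO w)) * canon w (j - min (hi T) (j - LO w))"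

lemma valid_Cons:
  assumes "valid (T # w) j"
  shows "lo T \<le> min (hi T) (j - LO w)" "valid w (j - min (hi T) (j - LO w))"
    "min (hi T) (j - LO w) \<le> j"
  using assms lo_le_hi[of T] LO_le_HI[of w] by (auto simp: valid_def min_def)

lemma filt_canon: "valid w j \<Longrightarrow> filt (tps w) (canon w j)"
proof (induction w arbitrary: j)
  case Nil
  show ?case using filt_Const[of 1] by simp
next
  case (Cons T w)
  have "filt (tp T) (letter T (min (hi T) (j - LO w)))"
    by (rule filt_letter) (use valid_Cons(1)[OF Cons.prems] in simp_all)
  from filt_mult[OF this Cons.IH[OF valid_Cons(2)[OF Cons.prems]]] show ?case by simp
qed

lemma canon_swap:
  assumes T: "lo T \<le> k" "k < hi T" and w: "LO w < l" "l \<le> HI w"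
  shows "sim (tps (T # w)) (letter T k * canon w l) (letter T (k + 1) * canon w (l - 1))"
  using w
proof (induction w arbitrary: l)
  case Nil
  then show ?case by simp
next
  case (Cons U v)
  show ?case
  proof (cases "l - LO v \<le> hi U")
    case True
    have m: "min (hi U) (l - LO v) = l - LO v" "min (hi U) (l - 1 - LO v) = l - LO v - 1"
      using True by auto
    have r: "l - (l - LO v) = LO v" "l - 1 - (l - LO v - 1) = LO v"
      using Cons.prems lo_le_hi[of U] by auto
    have "sim (tp T + tp U) (letter T k * letter U (l - LO v)) (letter T (k + 1) * letter U (l - LO v - 1))"
      by (rule letter_swap[OF T]) (use Cons.prems True in auto)
    moreover have "filt (tps v) (canon v (LO v))"
      by (rule filt_canon) (simp add: valid_def LO_le_HI)
    ultimately have "sim (tps (T # U # v)) (letter T k * letter U (l - LO v) * canon v (LO v))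
        (letter T (k + 1) * letter U (l - LO v - 1) * canon v (LO v))"
      by (rule sim_mult(2)) simp
    then show ?thesis by (simp only: canon.simps m r mult.assoc)
  next
    case False
    have m: "min (hi U) (l - LO v) = hi U" "min (hi U) (l - 1 - LO v) = hi U"
      using False by auto
    have r: "l - 1 - hi U = l - hi U - 1" by simp
    have "sim (tps (T # v)) (letter T k * canon v (l - hi U)) (letter T (k + 1) * canon v (l - hi U - 1))"
      by (rule Cons.IH) (use Cons.prems False in auto)
    moreover have "filt (tp U) (letter U (hi U))" by (rule filt_letter) (auto intro: lo_le_hi)
    ultimately have "sim (tps (T # U # v)) (letter U (hi U) * (letter T k * canon v (l - hi U)))
        (letter U (hi U) * (letter T (k + 1) * canon v (l - hi U - 1)))"
      by (rule sim_mult(1)) simp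
    then show ?thesis by (simp only: canon.simps m r mult.left_commute)
  qed
qed

lemma canon_Cons:
  assumes "lo T \<le> k" "k \<le> hi T" "valid w l"
  shows "sim (tps (T # w)) (letter T k * canon w l) (canon (T # w) (k + l))"
  using assms
proof (induction "hi T - k" arbitrary: k l)
  case 0
  then have "k = hi T" by simp
  then have "min (hi T) (k + l - LO w) = k" "k + l - k = l"
    using 0 by (auto simp: valid_def)
  then show ?case by (simp only: canon.simps sim_refl)
next
  case (Suc n)
  show ?case
  proof (cases "l = LO w")
    case True
    then have "min (hi T) (k + l - LO w) = k" "k + l - k = l"
      using Suc.prems by auto
    then show ?thesis by (simp only: canon.simps sim_refl)
  next
    case False
    then have l: "LO w < l" "l \<le> HI w" using Suc.prems(3) by (auto simp: valid_def)
    have k: "k < hi T" using Suc.hyps(2) by simp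
    have "sim (tps (T # w)) (letter T (k + 1) * canon w (l - 1)) (canon (T # w) (k + 1 + (l - 1)))"
      by (rule Suc.hyps(1)) (use Suc.prems Suc.hyps(2) k l in \<open>auto simp: valid_def\<close>)
    moreover have "k + 1 + (l - 1) = k + l" using l by simp
    ultimately show ?thesis
      using sim_trans[OF canon_swap[OF Suc.prems(1) k l]] by simp
  qed
qed

lemma canon_append:
  assumes "valid u i" "valid v j"
  shows "sim (tps (u @ v)) (canon u i * canon v j) (canon (u @ v) (i + j))"
  using assms(1)
proof (induction u arbitrary: i)
  case Nil
  then show ?case by (simp add: valid_def sim_refl)
next
  case (Cons T u)
  define k where "k = min (hi T) (i - LO u)"
  have k: "lo T \<le> k" "k \<le> hi T" "valid u (i - k)" "k \<le> i"
    using valid_Cons[OF Cons.prems] by (simp_all add: k_def)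
  have "sim (tps (u @ v)) (canon u (i - k) * canon v j) (canon (u @ v) (i - k + j))"
    by (rule Cons.IH[OF k(3)])
  then have 1: "sim (tps (T # u @ v)) (letter T k * (canon u (i - k) * canon v j)) (letter T k * canon (u @ v) (i - k + j))"
    by (rule sim_mult(1)[OF _ filt_letter[OF k(1,2)]]) simp
  have 2: "sim (tps (T # u @ v)) (letter T k * canon (u @ v) (i - k + j)) (canon (T # u @ v) (k + (i - k + j)))"
    by (rule canon_Cons[OF k(1,2)]) (use k(3) assms(2) in \<open>auto simp: valid_def\<close>)
  have 3: "k + (i - k + j) = i + j" using k(4) by simp
  have 4: "canon (T # u) i = letter T k * canon u (i - k)" by (simp add: k_def)
  show ?case
    using sim_trans[OF 1 2] unfolding 3 4 by (simp only: append_Cons mult.assoc)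
qed

lemma valid_append:
  assumes "valid (u @ v) j"
  obtains i l where "valid u i" "valid v l" "j = i + l"
proof
  let ?i = "min (HI u) (j - LO v)"
  show "valid u ?i" "valid v (j - ?i)" "j = ?i + (j - ?i)"
    using assms LO_le_HI[of u] LO_le_HI[of v] by (auto simp: valid_def min_def)
qed

lemma LO_HI_tps_perm: "mset u = mset v \<Longrightarrow> LO u = LO v \<and> HI u = HI v \<and> tps u = tps v"
  unfolding LO_def HI_def tps_def
  by (metis mset_map sum_mset_sum_list)

lemma canon_perm:
  "mset u = mset v \<Longrightarrow> valid u j \<Longrightarrow> sim (tps u) (canon u j) (canon v j)"
proof (induction u arbitrary: v j)
  case Nil
  then show ?case by (simp add: sim_refl)
next
  case (Cons T u)
  have "T \<in> set v" using Cons.prems(1) by (metis list.set_intros(1) set_mset_mset)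
  then obtain a b where v: "v = a @ T # b" by (metis split_list)
  have m: "mset u = mset (a @ b)" using Cons.prems(1) by (simp add: v)
  define k where "k = min (hi T) (j - LO u)"
  have k: "lo T \<le> k" "k \<le> hi T" "valid u (j - k)" "k \<le> j"
    using valid_Cons[OF Cons.prems(2)] by (simp_all add: k_def)
  have tu: "tps u = tps (a @ b)" "LO u = LO (a @ b)" "HI u = HI (a @ b)"
    using LO_HI_tps_perm[OF m] by simp_all
  have "valid (a @ b) (j - k)" using k(3) tu by (simp add: valid_def)
  then obtain i l where il: "valid a i" "valid b l" "j - k = i + l" by (rule valid_append)
  have vT: "valid (T # b) (k + l)" using k il by (simp add: valid_def)
  note lk = filt_letter[OF k(1,2)]
  have "sim (tps u) (canon u (j - k)) (canon (a @ b) (j - k))" by (rule Cons.IH[OF m k(3)])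
  also have "sim (tps u) (canon (a @ b) (j - k)) (canon a i * canon b l)"
    unfolding il(3) tu(1) by (rule sim_sym[OF canon_append[OF il(1,2)]])
  finally (sim_trans) have "sim (tps (T # u)) (letter T k * canon u (j - k)) (letter T k * (canon a i * canon b l))"
    by (rule sim_mult(1)[OF _ lk]) simp
  moreover have "sim (tps (T # u)) (letter T k * (canon a i * canon b l)) (canon a i * canon (T # b) (k + l))"
    unfolding mult.left_commute[of "letter T k"]
    by (rule sim_mult(1)[OF canon_Cons[OF k(1,2) il(2)] filt_canon[OF il(1)]]) (simp add: tu)
  moreover have "sim (tps (T # u)) (canon a i * canon (T # b) (k + l)) (canon v (i + (k + l)))"
    using canon_append[OF il(1) vT] by (simp add: v tu add_ac)
  ultimately have "sim (tps (T # u)) (letter T k * canon u (j - k)) (canon v (i + (k + l)))"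
    by (meson sim_trans)
  moreover have "i + (k + l) = j" using il(3) k(4) by simp
  moreover have "canon (T # u) j = letter T k * canon u (j - k)" by (simp add: k_def)
  ultimately show ?case by (simp only:)
qed

lemma canon_split:
  assumes "mset w = mset (u @ v)" "valid w j" "valid u i" "valid v l" "j = i + l"
  shows "sim (tps w) (canon w j) (canon u i * canon v l)"
proof -
  have "sim (tps w) (canon w j) (canon (u @ v) j)" by (rule canon_perm[OF assms(1,2)])
  moreover have "sim (tps w) (canon (u @ v) j) (canon u i * canon v l)"
    using sim_sym[OF canon_append[OF assms(3,4)]] LO_HI_tps_perm[OF assms(1)] assms(5) by simp
  ultimately show ?thesis by (rule sim_trans)
qed

lemma neg_canon:
  assumes "mset w = mset (u @ v)" "valid w j" "valid u i" "valid v l" "j = i + l" "neg 1 (canon u i)"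
    "tps u = 1"
  shows "neg (tps w) (canon w j)"
proof (rule neg_sim[OF canon_split[OF assms(1-5)]])
  show "neg (tps w) (canon u i * canon v l)"
    using neg_mult[OF assms(6) filt_canon[OF assms(4)]] LO_HI_tps_perm[OF assms(1)] assms(7) by simp
qed

lemma mset_remove1: "T \<in> set w \<Longrightarrow> mset w = add_mset T (mset (remove1 T w))"
  by simp

lemma mset_two:
  assumes "T \<in> set w" "U \<in> set w" "T \<noteq> U"
  shows "mset w = mset ([T, U] @ remove1 U (remove1 T w))"
proof -
  have "U \<in> set (remove1 T w)" using assms by (simp add: in_set_remove1)
  from mset_remove1[OF assms(1)] mset_remove1[OF this] show ?thesis
    by (simp only: mset.simps append.simps)
qed

lemma mset_three:
  assumes "T \<in> set w" "U \<in> set w" "V \<in> set w" "T \<noteq> U" "T \<noteq> V" "U \<noteq> V"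
  shows "mset w = mset ([T, U, V] @ remove1 V (remove1 U (remove1 T w)))"
proof -
  have "U \<in> set (remove1 T w)" "V \<in> set (remove1 U (remove1 T w))"
    using assms by (simp_all add: in_set_remove1)
  from mset_remove1[OF assms(1)] mset_remove1[OF this(1)] mset_remove1[OF this(2)] show ?thesis
    by (simp only: mset.simps append.simps)
qed

lemma neg_CP:
  assumes "TC \<in> set w" "TP \<in> set w" "valid w j"
  shows "neg (tps w) (canon w j)"
proof -
  let ?v = "remove1 TP (remove1 TC w)"
  have m: "mset w = mset ([TC, TP] @ ?v)" by (rule mset_two[OF assms(1,2)]) simp
  have "valid ([TC, TP] @ ?v) j" using LO_HI_tps_perm[OF m] assms(3) by (simp only: valid_def)
  then obtain i l where il: "valid [TC, TP] i" "valid ?v l" "j = i + l" by (rule valid_append)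
  have "i = 0 \<or> i = 1 \<or> i = 2 \<or> i = 3 \<or> i = 4 \<or> i = 5 \<or> i = 6" using il(1) by (auto simp: valid_def)
  then have "neg 1 (canon [TC, TP] i)"
    by (elim disjE) (simp_all add: negligible_CP[unfolded One_nat_def])
  then show ?thesis by (rule neg_canon[OF m assms(3) il]) (simp add: tp_def)
qed

lemma neg_QKP:
  assumes "TQ \<in> set w" "TK \<in> set w" "TP \<in> set w" "LO w < j" "j < HI w"
  shows "neg (tps w) (canon w j)"
proof -
  let ?v = "remove1 TP (remove1 TK (remove1 TQ w))"
  have m: "mset w = mset ([TQ, TK, TP] @ ?v)" by (rule mset_three[OF assms(1-3)]) simp_all
  have b: "LO w = LO ?v" "HI w = 8 + HI ?v" using LO_HI_tps_perm[OF m] by simp_all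
  define i where "i = max 1 (j - HI ?v)"
  have i: "i = 1 \<or> i = 2 \<or> i = 3 \<or> i = 4 \<or> i = 5 \<or> i = 6 \<or> i = 7"
    using assms(4,5) b by (auto simp: i_def max_def)
  have v: "valid ?v (j - i)" "j = i + (j - i)"
    using assms(4,5) b LO_le_HI[of ?v] by (auto simp: valid_def i_def max_def)
  have w: "valid w j" "valid [TQ, TK, TP] i" using assms(4,5) i by (auto simp: valid_def)
  have "neg 1 (canon [TQ, TK, TP] i)"
    using i by (elim disjE) (simp_all add: negligible_QKP[unfolded One_nat_def])
  then show ?thesis by (rule neg_canon[OF m w v]) (simp add: tp_def)
qed

lemma convert_CX:
  assumes "TC \<in> set w" "TX \<in> set w" "valid w j"
  obtains w' where "valid w' j" "tps w' = tps w" "sim (tps w) (canon w j) (canon w' j)"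
    "count_list w' TX < count_list w TX"
proof -
  let ?v = "remove1 TX (remove1 TC w)"
  have m: "mset w = mset ([TC, TX] @ ?v)" by (rule mset_two[OF assms(1,2)]) simp
  have e: "LO w = LO ([TC, TX] @ ?v)" "HI w = HI ([TC, TX] @ ?v)" "tps w = tps ([TC, TX] @ ?v)"
    using LO_HI_tps_perm[OF m] by simp_all
  have "valid ([TC, TX] @ ?v) j" using e assms(3) by (simp only: valid_def)
  then obtain i l where il: "valid [TC, TX] i" "valid ?v l" "j = i + l" by (rule valid_append)
  have i: "i = 1 \<or> i = 2 \<or> i = 3 \<or> i = 4" using il(1) by (auto simp: valid_def)
  have vi: "valid [TQ, TK] i" using i by (auto simp: valid_def)
  have "sim 0 (canon [TC, TX] i) (canon [TQ, TK] i)"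
    using i by (elim disjE) (simp_all add: conversion_CX numeral_eq_Suc)
  then have "sim (tps w) (canon [TC, TX] i * canon ?v l) (canon [TQ, TK] i * canon ?v l)"
    by (rule sim_mult(2)[OF _ filt_canon[OF il(2)]]) (simp add: e tp_def)
  moreover have "sim (tps w) (canon [TQ, TK] i * canon ?v l) (canon ([TQ, TK] @ ?v) j)"
    using canon_append[OF vi il(2)] il(3) e by (simp add: tp_def)
  ultimately have s: "sim (tps w) (canon w j) (canon ([TQ, TK] @ ?v) j)"
    using canon_split[OF m assms(3) il] by (meson sim_trans)
  show thesis
  proof (rule that[OF _ _ s])
    show "valid ([TQ, TK] @ ?v) j" using vi il by (simp add: valid_def)
    show "tps ([TQ, TK] @ ?v) = tps w" by (simp add: e tp_def)
    have "count_list w TX = count_list ([TC, TX] @ ?v) TX"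
      using m by (metis count_mset)
    then show "count_list ([TQ, TK] @ ?v) TX < count_list w TX" by simp
  qed
qed

text \<open>The standard words: the numbers of letters of the five types, in the order of the type \<open>ty\<close>.\<close>

type_synonym exps = "nat \<times> nat \<times> nat \<times> nat \<times> nat"

fun word :: "exps \<Rightarrow> ty list" where
  "word (a, q, k, x, p) = replicate a TC @ replicate q TQ @ replicate k TK @ replicate x TX @ replicate p TP"

fun standard :: "exps \<Rightarrow> nat \<Rightarrow> bool" where
  "standard (a, q, k, x, p) j \<longleftrightarrow> (a = 0 \<or> x = 0 \<and> p = 0) \<and>
     (q = 0 \<or> k = 0 \<or> p = 0 \<or> j = LO (word (a, q, k, x, p)) \<or> j = HI (word (a, q, k, x, p)))"

lemma mset_word:
  "mset w = mset (word (count_list w TC, count_list w TQ, count_list w TK, count_list w TX, count_list w TP))"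
  (is "_ = mset (word ?e)")
proof (rule multiset_eqI)
  fix T
  show "count (mset w) T = count (mset (word ?e)) T"
    by (cases T) (simp_all add: count_mset)
qed

lemma reduce_canon:
  "valid w j \<Longrightarrow> neg (tps w) (canon w j) \<or>
    (\<exists>e. standard e j \<and> valid (word e) j \<and> sim (tps w) (canon w j) (canon (word e) j))"
proof (induction "count_list w TX" arbitrary: w rule: less_induct)
  case less
  note v = less.prems
  consider (CX) "TC \<in> set w" "TX \<in> set w" | (CP) "TC \<in> set w" "TP \<in> set w"
    | (QKP) "TQ \<in> set w" "TK \<in> set w" "TP \<in> set w" "j \<noteq> LO w" "j \<noteq> HI w"
    | (std) "TC \<notin> set w \<or> TX \<notin> set w" "TC \<notin> set w \<or> TP \<notin> set w"
       "TQ \<notin> set w \<or> TK \<notin> set w \<or> TP \<notin> set w \<or> j = LO w \<or> j = HI w"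
    by satx
  then show ?case
  proof cases
    case CX
    obtain w' where w': "valid w' j" "tps w' = tps w" "sim (tps w) (canon w j) (canon w' j)"
      "count_list w' TX < count_list w TX"
      by (rule convert_CX[OF CX v])
    from less.hyps[OF w'(4,1)] show ?thesis
    proof
      assume "neg (tps w') (canon w' j)"
      then have "neg (tps w) (canon w j)" using neg_sim[OF w'(3)] w'(2) by simp
      then show ?thesis ..
    next
      assume "\<exists>e. standard e j \<and> valid (word e) j \<and> sim (tps w') (canon w' j) (canon (word e) j)"
      then obtain e where e: "standard e j" "valid (word e) j" "sim (tps w') (canon w' j) (canon (word e) j)"
        by (elim exE conjE)
      show ?thesis
        by (intro disjI2 exI[of _ e] conjI e(1,2) sim_trans[OF w'(3)]) (use e(3) w'(2) in \<open>simp only:\<close>)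
    qed
  next
    case CP
    then show ?thesis by (intro disjI1 neg_CP v)
  next
    case QKP
    have "LO w < j" "j < HI w" using QKP(4,5) v by (auto simp: valid_def)
    then show ?thesis by (intro disjI1 neg_QKP QKP(1-3))
  next
    case std
    let ?e = "(count_list w TC, count_list w TQ, count_list w TK, count_list w TX, count_list w TP)"
    note m = mset_word[of w]
    have l: "LO w = LO (word ?e)" "HI w = HI (word ?e)" using LO_HI_tps_perm[OF m] by (simp_all only:)
    have "standard ?e j"
      unfolding standard.simps l[symmetric] count_list_0_iff using std by satx
    moreover have "valid (word ?e) j" using v l by (simp only: valid_def)
    ultimately show ?thesis using canon_perm[OF m v] by (intro disjI2 exI[of _ ?e] conjI)
  qed
qed

inductive_set std_span :: "jet_poly set" where
  std: "standard e j \<Longrightarrow> valid (word e) j \<Longrightarrow> Const c * canon (word e) j \<in> std_span"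
| f1: "y \<in> bi_algebra \<Longrightarrow> f1 * y \<in> std_span"
| add: "x \<in> std_span \<Longrightarrow> y \<in> std_span \<Longrightarrow> x + y \<in> std_span"

lemma std_span_scale: "x \<in> std_span \<Longrightarrow> Const c * x \<in> std_span"
proof (induction rule: std_span.induct)
  case (std e j d)
  then show ?case using std_span.std[of e j "c * d"] by (simp add: Const_mult mult.assoc)
next
  case (f1 y)
  then show ?case using std_span.f1[of "Const c * y"] by (simp add: bi_algebra_intros mult.left_commute)
next
  case (add x y)
  then show ?case by (simp add: distrib_left std_span.add)
qed

definition letters_product :: "(ty \<times> nat) list \<Rightarrow> jet_poly" where
  "letters_product ls = (\<Prod>(T, j)\<leftarrow>ls. letter T j)"

definition valid_letters :: "(ty \<times> nat) list \<Rightarrow> bool" where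
  "valid_letters ls \<longleftrightarrow> (\<forall>(T, j)\<in>set ls. lo T \<le> j \<and> j \<le> hi T)"

inductive_set letter_span :: "nat \<Rightarrow> jet_poly set" for p where
  letters: "valid_letters ls \<Longrightarrow> tps (map fst ls) \<le> p \<Longrightarrow> Const c * letters_product ls \<in> letter_span p"
| add: "x \<in> letter_span p \<Longrightarrow> y \<in> letter_span p \<Longrightarrow> x + y \<in> letter_span p"

lemma letters_product_append: "letters_product (u @ v) = letters_product u * letters_product v"
  by (simp add: letters_product_def)

lemma valid_letters_append: "valid_letters (u @ v) \<longleftrightarrow> valid_letters u \<and> valid_letters v"
  by (simp add: valid_letters_def ball_Un)

lemma letter_span_mult:
  assumes "x \<in> letter_span p" "y \<in> letter_span q"
  shows "x * y \<in> letter_span (p + q)"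
  using assms(1)
proof induction
  case (letters u c)
  note u = letters
  show ?case
    using assms(2)
  proof induction
    case (letters v d)
    have "valid_letters (u @ v)" using u(1) letters(1) by (simp add: valid_letters_append)
    moreover have "tps (map fst (u @ v)) \<le> p + q" using u(2) letters(2) by simp
    ultimately have "Const (c * d) * letters_product (u @ v) \<in> letter_span (p + q)"
      by (rule letter_span.letters)
    moreover have "Const (c * d) * letters_product (u @ v)
        = Const c * letters_product u * (Const d * letters_product v)"
      unfolding letters_product_append Const_mult by (simp only: mult.assoc mult.left_commute)
    ultimately show ?case by (simp only:)
  next
    case (add y z)
    show ?case unfolding distrib_left by (rule letter_span.add[OF add.IH])
  qed
next
  case (add x z)
  show ?case unfolding distrib_right by (rule letter_span.add[OF add.IH])
qed

lemma letter_span_mono: "x \<in> letter_span p \<Longrightarrow> p \<le> q \<Longrightarrow> x \<in> letter_span q"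
proof (induction rule: letter_span.induct)
  case (letters ls c)
  show ?case by (rule letter_span.letters[OF letters(1) order_trans[OF letters(2,3)]])
next
  case (add x y)
  show ?case by (rule letter_span.add[OF add.IH[OF add.prems]])
qed

lemma filt_letter_span: "filt p x \<Longrightarrow> x \<in> letter_span p"
proof (induction rule: filt.induct)
  case (filt_Const c)
  then show ?case
    using letter_span.letters[of "[]" 0 c] by (simp add: letters_product_def valid_letters_def)
next
  case (filt_letter T j)
  then show ?case
    using letter_span.letters[of "[(T, j)]" "tp T" 1] by (simp add: letters_product_def valid_letters_def)
next
  case (filt_add p x y)
  then show ?case by (intro letter_span.add)
next
  case (filt_mult p x q y)
  then show ?case using letter_span_mult by simp
next
  case (filt_Suc p x)
  show ?case by (rule letter_span_mono[OF filt_Suc.IH]) simp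
qed

lemma valid_letters_valid: "valid_letters ls \<Longrightarrow> valid (map fst ls) (sum_list (map snd ls))"
proof (induction ls)
  case Nil
  show ?case by (simp add: valid_def)
next
  case (Cons t ls)
  obtain T j where t: "t = (T, j)" by (cases t)
  have "valid (map fst ls) (sum_list (map snd ls))" "lo T \<le> j" "j \<le> hi T"
    using Cons by (simp_all add: valid_letters_def t)
  then show ?case by (simp add: valid_def t add_mono)
qed

lemma letters_product_sim:
  "valid_letters ls \<Longrightarrow>
     sim (tps (map fst ls)) (letters_product ls) (canon (map fst ls) (sum_list (map snd ls)))"
proof (induction ls)
  case Nil
  show ?case by (simp add: letters_product_def sim_refl)
next
  case (Cons t ls)
  obtain T j where t: "t = (T, j)" by (cases t)
  have v: "valid_letters ls" "lo T \<le> j" "j \<le> hi T"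
    using Cons.prems by (simp_all add: valid_letters_def t)
  have "sim (tps (map fst (t # ls))) (letter T j * letters_product ls)
      (letter T j * canon (map fst ls) (sum_list (map snd ls)))"
    by (rule sim_mult(1)[OF Cons.IH[OF v(1)] filt_letter[OF v(2,3)]]) (simp add: t)
  moreover have "sim (tps (map fst (t # ls))) (letter T j * canon (map fst ls) (sum_list (map snd ls)))
      (canon (T # map fst ls) (j + sum_list (map snd ls)))"
    using canon_Cons[OF v(2,3) valid_letters_valid[OF v(1)]] by (simp add: t)
  ultimately have "sim (tps (map fst (t # ls))) (letter T j * letters_product ls)
      (canon (T # map fst ls) (j + sum_list (map snd ls)))"
    by (rule sim_trans)
  then show ?case by (simp add: letters_product_def t)
qed

lemma filt_in_std_span: "filt p x \<Longrightarrow> x \<in> std_span"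
proof (induction p arbitrary: x rule: less_induct)
  case (less p)
  have neg: "y \<in> std_span" if "neg q y" "q \<le> p" for q y
    using that
  proof (induction rule: neg.induct)
    case (neg_f1 y q)
    show ?case by (rule std_span.f1[OF neg_f1.hyps])
  next
    case (neg_low r z q)
    then show ?case using less.IH[of r z] by simp
  next
    case (neg_add q y z)
    show ?case by (rule std_span.add[OF neg_add.IH[OF neg_add.prems]])
  qed
  from filt_letter_span[OF less.prems] show ?case
  proof induction
    case (letters ls c)
    let ?w = "map fst ls" and ?j = "sum_list (map snd ls)"
    have v: "valid ?w ?j" by (rule valid_letters_valid[OF letters(1)])
    note s = letters_product_sim[OF letters(1)]
    have "letters_product ls \<in> std_span"
      using reduce_canon[OF v]
    proof (elim disjE exE conjE)
      assume "neg (tps ?w) (canon ?w ?j)"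
      then show ?thesis using neg[OF neg_sim[OF s]] letters(2) by simp
    next
      fix e assume e: "standard e ?j" "valid (word e) ?j" "sim (tps ?w) (canon ?w ?j) (canon (word e) ?j)"
      obtain d where d: "neg (tps ?w) (letters_product ls - Const d * canon (word e) ?j)"
        using sim_trans[OF s e(3)] unfolding sim_def by (elim exE conjE)
      have "(letters_product ls - Const d * canon (word e) ?j) + Const d * canon (word e) ?j \<in> std_span"
        by (rule std_span.add[OF neg[OF d letters(2)] std_span.std[OF e(1,2)]])
      then show ?thesis by simp
    qed
    then show ?case by (rule std_span_scale)
  qed (rule std_span.add)
qed

lemma bi_algebra_decompose:
  assumes "x \<in> bi_algebra"
  shows "\<exists>p z y. filt p z \<and> y \<in> bi_algebra \<and> x = z + f1 * y"
  using assms unfolding bi_algebra_def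
proof induction
  case (const c)
  show ?case by (rule exI[of _ 0], rule exI[of _ "Const c"], rule exI[of _ 0]) (simp add: filt_Const)
next
  case (gen P)
  show ?case
  proof (cases "P = f1")
    case True
    then show ?thesis
      by (intro exI[of _ 0] exI[of _ 1]) (use filt_Const[of 0] in simp)
  next
    case False
    have P: "filt 1 X21" "filt 1 X23" "filt 1 X25" "filt 1 Y27"
      using filt_letter[of TP 0] filt_letter[of TP 1] filt_letter[of TP 2] filt_letter[of TP 3]
      by (simp_all add: tp_def numeral_2_eq_2 numeral_3_eq_3)
    have "filt 1 P"
      using gen False P filt_letters[THEN filt_Suc, folded One_nat_def] by (elim insertE emptyE) simp_all
    then show ?thesis
      by (intro exI[of _ 1] exI[of _ P] exI[of _ 0]) simp
  qed
next
  case (add P Q)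
  then obtain p z y q z' y' where *: "filt p z" "y \<in> bi_algebra" "P = z + f1 * y"
    "filt q z'" "y' \<in> bi_algebra" "Q = z' + f1 * y'" unfolding bi_algebra_def by (elim exE conjE)
  have "filt (max p q) (z + z')"
    using *(1,4) by (intro filt_add) (auto intro: filt_mono)
  moreover have "y + y' \<in> bi_algebra" using *(2,5) by (rule bi_algebra_intros)
  moreover have "P + Q = (z + z') + f1 * (y + y')" using *(3,6) by (simp add: algebra_simps)
  ultimately show ?case unfolding bi_algebra_def by (intro exI conjI)
next
  case (mult P Q)
  then obtain p z y q z' y' where *: "filt p z" "y \<in> bi_algebra" "P = z + f1 * y"
    "filt q z'" "y' \<in> bi_algebra" "Q = z' + f1 * y'" unfolding bi_algebra_def by (elim exE conjE)
  have "filt (p + q) (z * z')" using *(1,4) by (rule filt_mult)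
  moreover have "z * y' + y * z' + f1 * y * y' \<in> bi_algebra"
    using *(2,5) filt_in_bi_algebra[OF *(1)] filt_in_bi_algebra[OF *(4)] by (intro bi_algebra_intros)
  moreover have "P * Q = (z * z') + f1 * (z * y' + y * z' + f1 * y * y')"
    using *(3,6) by (simp add: algebra_simps)
  ultimately show ?case unfolding bi_algebra_def by (intro exI conjI)
qed

lemma bi_algebra_subset_std_span:
  assumes "x \<in> bi_algebra"
  shows "x \<in> std_span"
proof -
  obtain p z y where "filt p z" "y \<in> bi_algebra" "x = z + f1 * y"
    using bi_algebra_decompose[OF assms] by (elim exE conjE)
  then show ?thesis using std_span.add[OF filt_in_std_span std_span.f1] by simp
qed

lemma std_span_finite_sum:
  assumes "x \<in> std_span"
  shows "\<exists>I c y. finite I \<and> (\<forall>(e, j)\<in>I. standard e j \<and> valid (word e) j) \<and> y \<in> bi_algebra \<and>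
     x = (\<Sum>(e, j)\<in>I. Const (c (e, j)) * canon (word e) j) + f1 * y"
  using assms
proof induction
  case (std e j c)
  then show ?case
    by (intro exI[of _ "{(e, j)}"] exI[of _ "\<lambda>_. c"] exI[of _ 0]) (simp add: bi_algebra_intros)
next
  case (f1 y)
  then show ?case
    by (intro exI[of _ "{}"] exI[of _ "\<lambda>_. 0"] exI[of _ y]) simp
next
  case (add x y)
  obtain I c u where 1: "finite I" "\<forall>(e, j)\<in>I. standard e j \<and> valid (word e) j" "u \<in> bi_algebra"
    "x = (\<Sum>(e, j)\<in>I. Const (c (e, j)) * canon (word e) j) + f1 * u" using add.IH(1) by (elim exE conjE)
  obtain J d v where 2: "finite J" "\<forall>(e, j)\<in>J. standard e j \<and> valid (word e) j" "v \<in> bi_algebra"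
    "y = (\<Sum>(e, j)\<in>J. Const (d (e, j)) * canon (word e) j) + f1 * v" using add.IH(2) by (elim exE conjE)
  define g where "g t = (if t \<in> I then c t else 0) + (if t \<in> J then d t else 0)" for t
  have split: "(\<Sum>(e, j)\<in>I \<union> J. Const (g (e, j)) * canon (word e) j) =
     (\<Sum>(e, j)\<in>I. Const (c (e, j)) * canon (word e) j) + (\<Sum>(e, j)\<in>J. Const (d (e, j)) * canon (word e) j)"
  proof -
    have "(\<Sum>(e, j)\<in>I \<union> J. Const (if (e, j) \<in> I then c (e, j) else 0) * canon (word e) j)
        = (\<Sum>(e, j)\<in>I. Const (c (e, j)) * canon (word e) j)"
      by (rule sum.mono_neutral_cong_right) (use 1(1) 2(1) in auto)
    moreover have "(\<Sum>(e, j)\<in>I \<union> J. Const (if (e, j) \<in> J then d (e, j) else 0) * canon (word e) j)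
        = (\<Sum>(e, j)\<in>J. Const (d (e, j)) * canon (word e) j)"
      by (rule sum.mono_neutral_cong_right) (use 1(1) 2(1) in auto)
    ultimately show ?thesis
      by (simp add: g_def Const_add distrib_right sum.distrib case_prod_unfold)
  qed
  have "x + y = (\<Sum>(e, j)\<in>I \<union> J. Const (g (e, j)) * canon (word e) j) + f1 * (u + v)"
    unfolding split 1(4) 2(4) by (simp add: algebra_simps)
  moreover have "finite (I \<union> J)" "u + v \<in> bi_algebra" "\<forall>(e, j)\<in>I \<union> J. standard e j \<and> valid (word e) j"
    using 1(1-3) 2(1-3) by (auto intro: bi_algebra_intros)
  ultimately show ?case by (intro exI conjI)
qed

section \<open>Linear independence at $f_1' = 0$\<close>

text \<open>
  The points with $f_1' = 0$ at which $\Lambda^3 = c$, $\Lambda^5 = 3cs$, $M^8 = M$ and $N^{12} = N$.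
\<close>

definition special_point :: "complex \<Rightarrow> complex \<Rightarrow> complex \<Rightarrow> complex \<Rightarrow> jet_coord \<Rightarrow> complex" where
  "special_point c s M N v =
    (if v = Jet 2 1 then c / s else if v = Jet 1 2 then - s
     else if v = Jet 1 4 then - M * s / (3 * c ^ 2) else if v = Jet 1 5 then - N * s / (9 * c ^ 3) else 0)"

lemma special_point_simps [simp]:
  "special_point c s M N (Jet 1 1) = 0" "special_point c s M N (Jet (Suc 0) (Suc 0)) = 0"
  "special_point c s M N (Jet 1 2) = - s" "special_point c s M N (Jet (Suc 0) 2) = - s"
  "special_point c s M N (Jet (Suc 0) (Suc (Suc 0))) = - s"
  "special_point c s M N (Jet 1 3) = 0" "special_point c s M N (Jet (Suc 0) 3) = 0"
  "special_point c s M N (Jet 1 4) = - M * s / (3 * c ^ 2)"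
  "special_point c s M N (Jet (Suc 0) 4) = - M * s / (3 * c ^ 2)"
  "special_point c s M N (Jet 1 5) = - N * s / (9 * c ^ 3)"
  "special_point c s M N (Jet (Suc 0) 5) = - N * s / (9 * c ^ 3)"
  "special_point c s M N (Jet 2 1) = c / s" "special_point c s M N (Jet 2 (Suc 0)) = c / s"
  "special_point c s M N (Jet 2 2) = 0" "special_point c s M N (Jet 2 3) = 0"
  "special_point c s M N (Jet 2 4) = 0" "special_point c s M N (Jet 2 5) = 0"
  by (simp_all add: special_point_def)

lemma ev_relation_at_0:
  assumes "x (Jet 1 1) = 0" "\<And>a b c d. ev (slice a b c d) X = ev (slice a b c d) Y + ev (slice a b c d) A"
    "bi_invariant m X" "bi_invariant m Y" "bi_invariant m (f1 * A)"
  shows "ev x X = ev x Y"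
proof -
  have "X = Y + f1 * A"
    by (rule bi_invariant_eqI[OF assms(3) bi_invariant_add[OF assms(4,5)]]) (simp add: assms(2))
  then have "ev x X = ev x (Y + f1 * A)" by (rule arg_cong)
  then show ?thesis using assms(1) by simp
qed

lemma letter_relations_at_0:
  assumes x: "x (Jet 1 1) = 0"
  shows
    "ev x (3 * (\<Lambda>3 * \<Lambda>7)) = ev x (5 * (\<Lambda>5 * \<Lambda>5))"
    "ev x (3 * (\<Lambda>3 * \<Lambda>9)) = ev x (7 * (\<Lambda>5 * \<Lambda>7))"
    "ev x (3 * (\<Lambda>3 * M10)) = ev x (8 * (\<Lambda>5 * M8))"
    "ev x (24 * (\<Lambda>3 * K12)) = ev x (5 * (\<Lambda>5 * M10))"
    "ev x (3 * (\<Lambda>3 * H14)) = ev x (5 * (N12 * \<Lambda>5))"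
    "ev x (3 * (\<Lambda>3 * F16)) = ev x (7 * (\<Lambda>5 * H14))"
    "ev x (3 * (\<Lambda>3 * X18)) = ev x (35 * (\<Lambda>5 * F16))"
    "ev x (3 * (\<Lambda>3 * X19)) = ev x (30 * (N12 * M10))"
    "ev x (3 * (\<Lambda>3 * X21)) = ev x (- (5 * (N12 * N12)) - 64 * (M8 * M8 * M8))"
    "ev x (3 * (\<Lambda>3 * X23)) = ev x (- (7 * (N12 * H14)) - 8 * (M8 * M8 * M10))"
    "ev x (3 * (\<Lambda>3 * X25)) = ev x (- (49 * (H14 * H14)) - 5 * (M8 * M10 * M10))"
    "ev x (24 * (\<Lambda>3 * Y27)) = ev x (- (441 * (H14 * F16)) + 7 * (N12 * X18) - 5 * (M10 * M10 * M10))"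
proof -
  show "ev x (3 * (\<Lambda>3 * \<Lambda>7)) = ev x (5 * (\<Lambda>5 * \<Lambda>5))"
    by (rule ev_relation_at_0[where m = 10 and A = "f1 * M8" and x = x, OF x],
        simp only: slice_values, algebra, (rule relation_intros | simp)+)
  show "ev x (3 * (\<Lambda>3 * \<Lambda>9)) = ev x (7 * (\<Lambda>5 * \<Lambda>7))"
    by (rule ev_relation_at_0[where m = 12 and A = "f1 * M10" and x = x, OF x],
        simp only: slice_values, algebra, (rule relation_intros | simp)+)
  show "ev x (3 * (\<Lambda>3 * M10)) = ev x (8 * (\<Lambda>5 * M8))"
    by (rule ev_relation_at_0[where m = 13 and A = "N12" and x = x, OF x],
        simp only: slice_values, algebra, (rule relation_intros | simp)+)
  show "ev x (24 * (\<Lambda>3 * K12)) = ev x (5 * (\<Lambda>5 * M10))"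
    by (rule ev_relation_at_0[where m = 15 and A = "7 * H14" and x = x, OF x],
        simp only: slice_values, algebra, (rule relation_intros | simp)+)
  show "ev x (3 * (\<Lambda>3 * H14)) = ev x (5 * (N12 * \<Lambda>5))"
    by (rule ev_relation_at_0[where m = 17 and A = "- (8 * (M8 * M8))" and x = x, OF x],
        simp only: slice_values, algebra, (rule relation_intros | simp)+)
  show "ev x (3 * (\<Lambda>3 * F16)) = ev x (7 * (\<Lambda>5 * H14))"
    by (rule ev_relation_at_0[where m = 19 and A = "- (M8 * M10)" and x = x, OF x],
        simp only: slice_values, algebra, (rule relation_intros | simp)+)
  show "ev x (3 * (\<Lambda>3 * X18)) = ev x (35 * (\<Lambda>5 * F16))"
    by (rule ev_relation_at_0[where m = 21 and A = "- (5 * (M10 * M10)) + 56 * (M8 * K12)" and x = x, OF x],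
        simp only: slice_values, algebra, (rule relation_intros | simp)+)
  show "ev x (3 * (\<Lambda>3 * X19)) = ev x (30 * (N12 * M10))"
    by (rule ev_relation_at_0[where m = 22 and A = "7 * X21" and x = x, OF x],
        simp only: slice_values, algebra, (rule relation_intros | simp)+)
  show "ev x (3 * (\<Lambda>3 * X21)) = ev x (- (5 * (N12 * N12)) - 64 * (M8 * M8 * M8))"
    by (rule ev_relation_at_0[where m = 24 and A = 0 and x = x, OF x],
        simp only: slice_values, algebra, (rule relation_intros | simp)+)
  show "ev x (3 * (\<Lambda>3 * X23)) = ev x (- (7 * (N12 * H14)) - 8 * (M8 * M8 * M10))"
    by (rule ev_relation_at_0[where m = 26 and A = 0 and x = x, OF x],
        simp only: slice_values, algebra, (rule relation_intros | simp)+)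
  show "ev x (3 * (\<Lambda>3 * X25)) = ev x (- (49 * (H14 * H14)) - 5 * (M8 * M10 * M10))"
    by (rule ev_relation_at_0[where m = 28 and A = 0 and x = x, OF x],
        simp only: slice_values, algebra, (rule relation_intros | simp)+)
  show "ev x (24 * (\<Lambda>3 * Y27)) = ev x (- (441 * (H14 * F16)) + 7 * (N12 * X18) - 5 * (M10 * M10 * M10))"
    by (rule ev_relation_at_0[where m = 30 and A = 0 and x = x, OF x],
        simp only: slice_values, algebra, (rule relation_intros | simp)+)
qed

lemma special_point_values:
  assumes "c \<noteq> 0" "s \<noteq> 0"
  shows
    "ev (special_point c s M N) \<Lambda>3 = c"
    "ev (special_point c s M N) \<Lambda>5 = 3 * c * s"
    "ev (special_point c s M N) \<Lambda>7 = 15 * c * s ^ 2"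
    "ev (special_point c s M N) \<Lambda>9 = 105 * c * s ^ 3"
    "ev (special_point c s M N) M8 = M"
    "ev (special_point c s M N) M10 = 8 * s * M"
    "ev (special_point c s M N) K12 = 5 * s ^ 2 * M"
    "ev (special_point c s M N) N12 = N"
    "ev (special_point c s M N) H14 = 5 * s * N"
    "ev (special_point c s M N) F16 = 35 * s ^ 2 * N"
    "ev (special_point c s M N) X18 = 1225 * s ^ 3 * N"
    "ev (special_point c s M N) X19 = 80 * s * (M * N) / c"
    "ev (special_point c s M N) X21 = (- 1 / 3) * (64 * M ^ 3 + 5 * N ^ 2) / c"
    "ev (special_point c s M N) X23 = (- 1 / 3) * s * (64 * M ^ 3 + 5 * 7 * N ^ 2) / c"
    "ev (special_point c s M N) X25 = (- 5 / 3) * s ^ 2 * (64 * M ^ 3 + 5 * 7 ^ 2 * N ^ 2) / c"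
    "ev (special_point c s M N) Y27 = (- 5 / 3) * s ^ 3 * (64 * M ^ 3 + 5 * 7 ^ 3 * N ^ 2) / c"
proof -
  let ?x = "special_point c s M N"
  note R = letter_relations_at_0[of ?x, simplified]
  have n: "Suc (Suc 0) = 2" "Suc 2 = 3" "Suc 3 = 4" "Suc 4 = 5" by simp_all
  have D3: "ev ?x (D \<Lambda>3) = 0" by (simp add: \<Lambda>3_def D_simps n)
  show 3: "ev ?x \<Lambda>3 = c" using assms by (simp add: \<Lambda>3_def)
  show 5: "ev ?x \<Lambda>5 = 3 * c * s" by (simp add: \<Lambda>5_def bracket_def D_simps 3 n)
  show 8: "ev ?x M8 = M" using assms by (simp add: M8_eq field_simps power2_eq_square)
  have D8: "ev ?x (D M8) = N / (3 * c)"
    using assms by (simp add: M8_eq D_simps n power2_eq_square power3_eq_cube field_simps)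
  show 12: "ev ?x N12 = N"
    using assms by (simp add: N12_def bracket_def D3 D8 8 3)
  show 7: "ev ?x \<Lambda>7 = 15 * c * s ^ 2"
    using R(1) assms by (simp add: 3 5 power2_eq_square)
  show 9: "ev ?x \<Lambda>9 = 105 * c * s ^ 3"
    using R(2) assms by (simp add: 3 5 7 power2_eq_square power3_eq_cube)
  show 10: "ev ?x M10 = 8 * s * M"
    using R(3) assms by (simp add: 3 5 8)
  show K: "ev ?x K12 = 5 * s ^ 2 * M"
    using R(4) assms by (simp add: 3 5 10 power2_eq_square)
  show 14: "ev ?x H14 = 5 * s * N"
    using R(5) assms by (simp add: 3 5 12)
  show 16: "ev ?x F16 = 35 * s ^ 2 * N"
    using R(6) assms by (simp add: 3 5 14 power2_eq_square)
  show 18: "ev ?x X18 = 1225 * s ^ 3 * N"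
    using R(7) assms by (simp add: 3 5 16 power2_eq_square power3_eq_cube)
  show "ev ?x X19 = 80 * s * (M * N) / c"
    using R(8) assms by (simp add: 3 10 12 field_simps)
  show "ev ?x X21 = (- 1 / 3) * (64 * M ^ 3 + 5 * N ^ 2) / c"
    using R(9) assms by (simp add: 3 8 12 field_simps power2_eq_square power3_eq_cube)
  show "ev ?x X23 = (- 1 / 3) * s * (64 * M ^ 3 + 5 * 7 * N ^ 2) / c"
    using R(10) assms by (simp add: 3 8 10 12 14 field_simps power2_eq_square power3_eq_cube)
  show "ev ?x X25 = (- 5 / 3) * s ^ 2 * (64 * M ^ 3 + 5 * 7 ^ 2 * N ^ 2) / c"
    using R(11) assms by (simp add: 3 8 10 14 field_simps power2_eq_square power3_eq_cube)
      (simp add: eq_neg_iff_add_eq_0 ac_simps)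
  show "ev ?x Y27 = (- 5 / 3) * s ^ 3 * (64 * M ^ 3 + 5 * 7 ^ 3 * N ^ 2) / c"
  proof -
    have "24 * (ev ?x Y27 * c) = 24 * ((- 5 / 3) * s ^ 3 * (64 * M ^ 3 + 5 * 7 ^ 3 * N ^ 2))"
      using R(12) unfolding 3 10 12 14 16 18 by (simp add: algebra_simps power2_eq_square power3_eq_cube)
        (simp add: eq_neg_iff_add_eq_0 ac_simps)
    then have "ev ?x Y27 * c = (- 5 / 3) * s ^ 3 * (64 * M ^ 3 + 5 * 7 ^ 3 * N ^ 2)"
      by (simp only: mult_cancel_left) simp
    then show ?thesis by (simp only: nonzero_eq_divide_eq[OF assms(1)])
  qed
qed

fun letter_c :: "ty \<Rightarrow> complex \<Rightarrow> complex" where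
  "letter_c TC c = c" | "letter_c TQ c = 1" | "letter_c TK c = 1" | "letter_c TX c = 1 / c" | "letter_c TP c = 1 / c"

fun letter_MN :: "ty \<Rightarrow> nat \<Rightarrow> complex \<Rightarrow> complex \<Rightarrow> complex" where
  "letter_MN TC j M N = 1" | "letter_MN TQ j M N = M" | "letter_MN TK j M N = N" | "letter_MN TX j M N = M * N"
| "letter_MN TP j M N = 64 * M ^ 3 + 5 * 7 ^ j * N ^ 2"

lemma letter_value:
  assumes "lo T \<le> j" "j \<le> hi T"
  shows "\<exists>\<gamma>. \<gamma> \<noteq> 0 \<and> (\<forall>c s M N. c \<noteq> 0 \<longrightarrow> s \<noteq> 0 \<longrightarrow>
      ev (special_point c s M N) (letter T j) = \<gamma> * letter_c T c * s ^ j * letter_MN T j M N)"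
proof -
  have j: "j = 0 \<or> j = 1 \<or> j = 2 \<or> j = 3" using assms by (cases T) auto
  define \<gamma> :: complex where "\<gamma> = (case T of TC \<Rightarrow> [1, 3, 15, 105] ! j | TQ \<Rightarrow> [1, 8, 5] ! j | TK \<Rightarrow> [1, 5, 35, 1225] ! j
    | TX \<Rightarrow> 80 | TP \<Rightarrow> [- 1 / 3, - 1 / 3, - 5 / 3, - 5 / 3] ! j)"
  have "\<gamma> \<noteq> 0" using j assms by (cases T; elim disjE; simp add: \<gamma>_def)
  moreover have "ev (special_point c s M N) (letter T j) = \<gamma> * letter_c T c * s ^ j * letter_MN T j M N"
    if "c \<noteq> 0" "s \<noteq> 0" for c s M N
    using j assms by (cases T; elim disjE; simp add: \<gamma>_def special_point_values[OF that])
  ultimately show ?thesis by (intro exI conjI allI impI)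
qed

lemma canon_value:
  "valid w j \<Longrightarrow> \<exists>\<gamma> js. \<gamma> \<noteq> 0 \<and> length js = count_list w TP \<and>
     (j = LO w \<longrightarrow> (\<forall>i\<in>set js. i = 0)) \<and> (j = HI w \<longrightarrow> (\<forall>i\<in>set js. i = 3)) \<and>
     (\<forall>c s M N. c \<noteq> 0 \<longrightarrow> s \<noteq> 0 \<longrightarrow> ev (special_point c s M N) (canon w j) =
       \<gamma> * (c ^ count_list w TC / c ^ (count_list w TX + count_list w TP)) * s ^ j *
       (M ^ (count_list w TQ + count_list w TX) * N ^ (count_list w TK + count_list w TX) *
        (\<Prod>i\<leftarrow>js. 64 * M ^ 3 + 5 * 7 ^ i * N ^ 2)))"
proof (induction w arbitrary: j)
  case Nil
  then show ?case by (intro exI[of _ 1] exI[of _ "[]"]) (simp add: valid_def)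
next
  case (Cons T w)
  define k where "k = min (hi T) (j - LO w)"
  have k: "lo T \<le> k" "k \<le> hi T" "valid w (j - k)" "k \<le> j"
    using valid_Cons[OF Cons.prems] by (simp_all add: k_def)
  obtain \<gamma> js where g: "\<gamma> \<noteq> 0" "length js = count_list w TP"
    "j - k = LO w \<longrightarrow> (\<forall>i\<in>set js. i = 0)" "j - k = HI w \<longrightarrow> (\<forall>i\<in>set js. i = 3)"
    "\<forall>c s M N. c \<noteq> 0 \<longrightarrow> s \<noteq> 0 \<longrightarrow> ev (special_point c s M N) (canon w (j - k)) =
       \<gamma> * (c ^ count_list w TC / c ^ (count_list w TX + count_list w TP)) * s ^ (j - k) *
       (M ^ (count_list w TQ + count_list w TX) * N ^ (count_list w TK + count_list w TX) *
        (\<Prod>i\<leftarrow>js. 64 * M ^ 3 + 5 * 7 ^ i * N ^ 2))"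
    using Cons.IH[OF k(3)] by (elim exE conjE)
  obtain \<delta> where d: "\<delta> \<noteq> 0" "\<forall>c s M N. c \<noteq> 0 \<longrightarrow> s \<noteq> 0 \<longrightarrow>
      ev (special_point c s M N) (letter T k) = \<delta> * letter_c T c * s ^ k * letter_MN T k M N"
    using letter_value[OF k(1,2)] by (elim exE conjE)
  define js' where "js' = (if T = TP then k # js else js)"
  have LO: "j = LO (T # w) \<Longrightarrow> k = lo T \<and> j - k = LO w"
    using lo_le_hi[of T] by (auto simp: k_def)
  have HI: "j = HI (T # w) \<Longrightarrow> k = hi T \<and> j - k = HI w"
    using LO_le_HI[of w] by (auto simp: k_def)
  have val: "ev (special_point c s M N) (canon (T # w) j) =
       (\<delta> * \<gamma>) * (c ^ count_list (T # w) TC / c ^ (count_list (T # w) TX + count_list (T # w) TP)) * s ^ j *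
       (M ^ (count_list (T # w) TQ + count_list (T # w) TX) * N ^ (count_list (T # w) TK + count_list (T # w) TX) *
        (\<Prod>i\<leftarrow>js'. 64 * M ^ 3 + 5 * 7 ^ i * N ^ 2))" if cs: "c \<noteq> 0" "s \<noteq> 0" for c s M N
  proof -
    have c: "canon (T # w) j = letter T k * canon w (j - k)" by (simp add: k_def)
    have s: "s ^ j = s ^ k * s ^ (j - k)" using k(4) by (simp flip: power_add)
    show ?thesis
      unfolding c ev_simps d(2)[rule_format, OF cs] g(5)[rule_format, OF cs] s
      by (cases T) (simp_all add: js'_def)
  qed
  show ?case
  proof (intro exI[of _ "\<delta> * \<gamma>"] exI[of _ js'] conjI allI impI)
    show "\<delta> * \<gamma> \<noteq> 0" using d(1) g(1) by simp
    show "length js' = count_list (T # w) TP" using g(2) by (simp add: js'_def)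
    show "\<forall>i\<in>set js'. i = 0" if "j = LO (T # w)" using LO[OF that] mp[OF g(3) conjunct2[OF LO[OF that]]] by (simp add: js'_def)
    show "\<forall>i\<in>set js'. i = 3" if "j = HI (T # w)" using HI[OF that] mp[OF g(4) conjunct2[OF HI[OF that]]] by (simp add: js'_def)
  qed (rule val)
qed

fun exp_C :: "exps \<Rightarrow> nat" where "exp_C (a, q, k, x, p) = a"
fun exp_Q :: "exps \<Rightarrow> nat" where "exp_Q (a, q, k, x, p) = q"
fun exp_K :: "exps \<Rightarrow> nat" where "exp_K (a, q, k, x, p) = k"
fun exp_X :: "exps \<Rightarrow> nat" where "exp_X (a, q, k, x, p) = x"
fun exp_P :: "exps \<Rightarrow> nat" where "exp_P (a, q, k, x, p) = p"

lemma exps_eqI: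
  "exp_C e = exp_C f \<Longrightarrow> exp_Q e = exp_Q f \<Longrightarrow> exp_K e = exp_K f \<Longrightarrow> exp_X e = exp_X f \<Longrightarrow> exp_P e = exp_P f \<Longrightarrow> e = f"
  by (cases e; cases f) simp

lemma count_list_replicate: "count_list (replicate n x) y = (if x = y then n else 0)"
  by (induction n) auto

lemma word_counts:
  "count_list (word e) TC = exp_C e" "count_list (word e) TQ = exp_Q e" "count_list (word e) TK = exp_K e"
  "count_list (word e) TX = exp_X e" "count_list (word e) TP = exp_P e"
  by (cases e; simp add: count_list_replicate)+

lemma LO_HI_replicate: "LO (replicate n T) = n * lo T" "HI (replicate n T) = n * hi T"
  by (induction n) simp_all

lemma LO_HI_word:
  "LO (word e) = exp_X e" "HI (word e) = 3 * exp_C e + 2 * exp_Q e + 3 * exp_K e + exp_X e + 3 * exp_P e"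
  by (cases e; simp add: LO_HI_replicate mult.commute)+

lemma standard_iff:
  "standard e j \<longleftrightarrow> (exp_C e = 0 \<or> exp_X e = 0 \<and> exp_P e = 0) \<and>
     (exp_Q e = 0 \<or> exp_K e = 0 \<or> exp_P e = 0 \<or> j = LO (word e) \<or> j = HI (word e))"
  by (cases e) simp

lemma isCont_eq_0:
  fixes g :: "complex \<Rightarrow> complex"
  assumes "isCont g 0" "\<And>z. z \<noteq> 0 \<Longrightarrow> g z = 0"
  shows "g 0 = 0"
proof -
  have "g \<midarrow>0\<rightarrow> g 0" using assms(1) by (simp add: isCont_def)
  moreover have "g \<midarrow>0\<rightarrow> 0"
    using tendsto_cong[of g "\<lambda>_. 0" "at 0" 0] assms(2) by (simp add: eventually_at_filter)
  ultimately show ?thesis by (rule LIM_unique)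
qed

lemma vanish_at_0:
  fixes g :: "'i \<Rightarrow> complex \<Rightarrow> complex"
  assumes "finite J" "\<And>z. z \<noteq> 0 \<Longrightarrow> (\<Sum>t\<in>J. z ^ n t * g t z) = 0"
    "\<And>t. t \<in> J \<Longrightarrow> isCont (g t) 0" "\<And>t. t \<in> J \<Longrightarrow> m \<le> n t"
  shows "(\<Sum>t | t \<in> J \<and> n t = m. g t 0) = 0"
proof -
  define h where "h z = (\<Sum>t\<in>J. z ^ (n t - m) * g t z)" for z
  have "h z = 0" if "z \<noteq> 0" for z
  proof -
    have "z ^ m * (z ^ (n t - m) * g t z) = z ^ n t * g t z" if "t \<in> J" for t
      using assms(4)[OF that] by (simp only: mult.assoc[symmetric] power_add[symmetric] le_add_diff_inverse)
    then have "z ^ m * h z = (\<Sum>t\<in>J. z ^ n t * g t z)"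
      unfolding h_def sum_distrib_left by (rule sum.cong[OF refl])
    then show ?thesis using assms(2)[OF that] that by simp
  qed
  moreover have "isCont h 0"
    unfolding h_def using assms(3) by (intro continuous_intros)
  ultimately have "h 0 = 0" by (rule isCont_eq_0[rotated])
  moreover have "h 0 = (\<Sum>t\<in>J. if n t = m then g t 0 else 0)"
    unfolding h_def
  proof (rule sum.cong[OF refl])
    fix t assume "t \<in> J"
    then have "n t = m \<or> n t - m \<noteq> 0" using assms(4) by fastforce
    then show "0 ^ (n t - m) * g t 0 = (if n t = m then g t 0 else 0)" by auto
  qed
  moreover have "J \<inter> {t. n t = m} = {t. t \<in> J \<and> n t = m}" by (simp only: Int_def mem_Collect_eq)
  ultimately show ?thesis by (simp only: sum.If_cases[OF assms(1)] sum.neutral_const add_0_right)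
qed

lemma isCont_prod_list:
  fixes f :: "'i \<Rightarrow> complex \<Rightarrow> complex"
  assumes "\<And>i. isCont (f i) x"
  shows "isCont (\<lambda>z. \<Prod>i\<leftarrow>js. f i z) x"
proof (induction js)
  case (Cons i js)
  show ?case using continuous_mult[OF assms Cons.IH, of i] by simp
qed simp

text \<open>
  Comparing the powers of \<open>c\<close> and \<open>s\<close> and the weights, one is left with words which agree in the number of letters
  \<open>TC\<close> and in that of \<open>TX\<close> and \<open>TP\<close> together. Among those with the most letters \<open>TP\<close>, one without \<open>TK\<close> or \<open>TQ\<close>
  is isolated by letting $N \to 0$ or $M \to 0$; otherwise all words have the same factor coming from the letters \<open>TP\<close>.
\<close>

lemma canon_independent:
  assumes fin: "finite I" and st: "\<And>e j. (e, j) \<in> I \<Longrightarrow> standard e j \<and> valid (word e) j"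
    and zero: "\<And>c s M N. c \<noteq> 0 \<Longrightarrow> s \<noteq> 0 \<Longrightarrow>
      (\<Sum>t\<in>I. a t * ev (special_point c s M N) (canon (word (fst t)) (snd t))) = 0"
    and "t0 \<in> I"
  shows "a t0 = 0"
proof (rule ccontr)
  assume "a t0 \<noteq> 0"
  define I' where "I' = {t \<in> I. a t \<noteq> 0}"
  have t0: "t0 \<in> I'" and I': "finite I'" using \<open>t0 \<in> I\<close> \<open>a t0 \<noteq> 0\<close> fin by (auto simp: I'_def)
  have nz: "a t \<noteq> 0" if "t \<in> I'" for t using that by (simp add: I'_def)
  have stI: "standard (fst t) (snd t)" "valid (word (fst t)) (snd t)" if "t \<in> I'" for t
    using st[of "fst t" "snd t"] that by (simp_all add: I'_def)
  define A Q K X P where defs: "A t = exp_C (fst t)" "Q t = exp_Q (fst t)" "K t = exp_K (fst t)"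
    "X t = exp_X (fst t)" "P t = exp_P (fst t)" for t :: "exps \<times> nat"
  define W where "W t = 2 * Q t + 3 * K t + 5 * X t + 6 * P t" for t
  define B where "B js t M N = M ^ (Q t + X t) * N ^ (K t + X t) * (\<Prod>i\<leftarrow>js. 64 * M ^ 3 + 5 * 7 ^ i * N ^ 2)"
    for js t and M N :: complex
  define R where "R t \<gamma> js \<longleftrightarrow> \<gamma> \<noteq> 0 \<and> length js = P t \<and>
     (snd t = X t \<longrightarrow> (\<forall>i\<in>set js. i = 0)) \<and> (snd t = HI (word (fst t)) \<longrightarrow> (\<forall>i\<in>set js. i = 3)) \<and>
     (\<forall>c s M N. c \<noteq> 0 \<longrightarrow> s \<noteq> 0 \<longrightarrow> ev (special_point c s M N) (canon (word (fst t)) (snd t)) =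
       \<gamma> * (c ^ A t / c ^ (X t + P t)) * s ^ snd t * B js t M N)" for t \<gamma> js
  have "\<exists>\<gamma> js. R t \<gamma> js" if "t \<in> I'" for t
    using canon_value[OF stI(2)[OF that]] unfolding word_counts LO_HI_word(1) B_def defs R_def .
  then have "\<forall>t\<in>I'. \<exists>\<gamma> js. R t \<gamma> js" by (rule ballI)
  from bchoice[OF this] obtain \<gamma> where "\<forall>t\<in>I'. \<exists>js. R t (\<gamma> t) js" by (elim exE)
  from bchoice[OF this] obtain js where "\<forall>t\<in>I'. R t (\<gamma> t) (js t)" by (elim exE)
  then have R: "R t (\<gamma> t) (js t)" if "t \<in> I'" for t using that by (rule bspec)
  have g: "\<And>t. t \<in> I' \<Longrightarrow> \<gamma> t \<noteq> 0" "\<And>t. t \<in> I' \<Longrightarrow> length (js t) = P t"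
     "\<And>t i. t \<in> I' \<Longrightarrow> snd t = X t \<Longrightarrow> i \<in> set (js t) \<Longrightarrow> i = 0"
     "\<And>t i. t \<in> I' \<Longrightarrow> snd t = HI (word (fst t)) \<Longrightarrow> i \<in> set (js t) \<Longrightarrow> i = 3"
     "\<And>t c s M N. t \<in> I' \<Longrightarrow> c \<noteq> 0 \<Longrightarrow> s \<noteq> 0 \<Longrightarrow> ev (special_point c s M N) (canon (word (fst t)) (snd t)) =
       \<gamma> t * (c ^ A t / c ^ (X t + P t)) * s ^ snd t * B (js t) t M N"
    using R[unfolded R_def] by simp_all
  define L where "L = (\<Sum>t\<in>I'. X t + P t)"
  have L: "X t + P t \<le> L" if "t \<in> I'" for t
    unfolding L_def by (rule member_le_sum[OF that _ I']) simp
  have z1: "(\<Sum>t\<in>I'. c ^ (L + A t - (X t + P t)) * (s ^ snd t * (a t * \<gamma> t * B (js t) t M N))) = 0"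
    if cs: "c \<noteq> 0" "s \<noteq> 0" for c s M N
  proof -
    have "(\<Sum>t\<in>I'. a t * ev (special_point c s M N) (canon (word (fst t)) (snd t))) = 0"
      unfolding zero[OF cs, of M N, symmetric] by (rule sum.mono_neutral_left) (use fin in \<open>auto simp: I'_def\<close>)
    then have "c ^ L * (\<Sum>t\<in>I'. a t * ev (special_point c s M N) (canon (word (fst t)) (snd t))) = 0"
      by simp
    moreover have "c ^ L * (a t * ev (special_point c s M N) (canon (word (fst t)) (snd t))) =
        c ^ (L + A t - (X t + P t)) * (s ^ snd t * (a t * \<gamma> t * B (js t) t M N))" if "t \<in> I'" for t
    proof -
      have "L + A t = (L + A t - (X t + P t)) + (X t + P t)" using L[OF that] by simp
      then have "c ^ L * c ^ A t = c ^ (L + A t - (X t + P t)) * c ^ (X t + P t)"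
        by (simp flip: power_add)
      then have "c ^ L * (c ^ A t / c ^ (X t + P t)) = c ^ (L + A t - (X t + P t))"
        using cs by (simp add: field_simps)
      from this[symmetric] show ?thesis unfolding g(5)[OF that cs] by (simp only: mult_ac)
    qed
    ultimately show ?thesis by (simp only: sum_distrib_left cong: sum.cong)
  qed
  define J1 where "J1 = {t \<in> I'. L + A t - (X t + P t) = L + A t0 - (X t0 + P t0)}"
  have J1: "finite J1" using I' by (simp add: J1_def)
  have z2: "(\<Sum>t\<in>J1. s ^ snd t * (a t * \<gamma> t * B (js t) t M N)) = 0" if "s \<noteq> 0" for s M N
    unfolding J1_def by (rule separate_exponents[OF I', of "{0}"]) (use z1 that in auto)
  define J2 where "J2 = {t \<in> J1. snd t = snd t0}"
  have J2: "finite J2" using J1 by (simp add: J2_def)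
  have z3: "(\<Sum>t\<in>J2. a t * \<gamma> t * B (js t) t M N) = 0" for M N
    unfolding J2_def by (rule separate_exponents[OF J1, of "{0}"]) (use z2 in auto)
  have homogeneous: "B js t (z ^ 2 * M) (z ^ 3 * N) = z ^ W t * B js t M N" if "length js = P t" for js t z M N
  proof -
    have "(\<Prod>i\<leftarrow>js. 64 * (z ^ 2 * M) ^ 3 + 5 * 7 ^ i * (z ^ 3 * N) ^ 2) =
        z ^ (6 * length js) * (\<Prod>i\<leftarrow>js. 64 * M ^ 3 + 5 * 7 ^ i * N ^ 2)" for js :: "nat list"
      by (induction js) (simp_all add: algebra_simps power_mult_distrib power_add flip: power_mult)
    note prod = this[of js, unfolded that]
    have "W t = 2 * (Q t + X t) + 3 * (K t + X t) + 6 * P t" by (simp add: W_def)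
    then have W: "z ^ W t = (z ^ 2) ^ (Q t + X t) * (z ^ 3) ^ (K t + X t) * z ^ (6 * P t)"
      by (simp only: power_add power_mult)
    show ?thesis
      unfolding B_def prod W power_mult_distrib[of _ M "Q t + X t"] power_mult_distrib[of _ N "K t + X t"]
      by (simp only: mult_ac)
  qed
  define J where "J = {t \<in> J2. W t = W t0}"
  have J: "finite J" using J2 by (simp add: J_def)
  have z4: "(\<Sum>t\<in>J. a t * \<gamma> t * B (js t) t M N) = 0" for M N
    unfolding J_def
  proof (rule separate_exponents[OF J2, of "{}"])
    fix z
    have "(\<Sum>t\<in>J2. z ^ W t * (a t * \<gamma> t * B (js t) t M N)) =
        (\<Sum>t\<in>J2. a t * \<gamma> t * B (js t) t (z ^ 2 * M) (z ^ 3 * N))"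
      by (rule sum.cong) (use homogeneous g(2) in \<open>simp_all add: J2_def J1_def\<close>)
    then show "(\<Sum>t\<in>J2. z ^ W t * (a t * \<gamma> t * B (js t) t M N)) = 0" using z3 by simp
  qed simp
  have t0J: "t0 \<in> J" using t0 by (simp add: J_def J2_def J1_def)
  have JI: "t \<in> I'" "snd t = snd t0" "W t = W t0" if "t \<in> J" for t
    using that by (simp_all add: J_def J2_def J1_def)
  have AXP: "A t = A t0" "X t + P t = X t0 + P t0" if "t \<in> J" for t
  proof -
    have "L + A t - (X t + P t) = L + A t0 - (X t0 + P t0)"
      using that by (simp add: J_def J2_def J1_def)
    moreover have "A u = 0 \<or> X u = 0 \<and> P u = 0" if "u \<in> I'" for u
      using stI(1)[OF that] unfolding standard_iff defs by (rule conjunct1)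
    note this[OF t0] this[OF JI(1)[OF that]]
    ultimately show "A t = A t0" "X t + P t = X t0 + P t0"
      using L[OF t0] L[OF JI(1)[OF that]] by linarith+
  qed
  have eqI: "t = u" if "t \<in> J" "u \<in> J" "P t = P u" "K t = K u \<or> Q t = Q u" for t u
  proof -
    have "X t = X u" "A t = A u" using AXP[OF that(1)] AXP[OF that(2)] that(3) by simp_all
    moreover have "K t = K u" "Q t = Q u"
      using JI(3)[OF that(1)] JI(3)[OF that(2)] that(3,4) \<open>X t = X u\<close> unfolding W_def by linarith+
    ultimately have "fst t = fst u" using that(3) unfolding defs by (intro exps_eqI)
    then show ?thesis using JI(2)[OF that(1)] JI(2)[OF that(2)] by (simp add: prod_eq_iff)
  qed
  define p where "p = Max (P ` J)"
  have Pp: "P t \<le> p" if "t \<in> J" for t unfolding p_def by (rule Max_ge) (use J that in auto)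
  have "p \<in> P ` J" unfolding p_def by (rule Max_in) (use J t0J in auto)
  then obtain u where u: "u \<in> J" "P u = p" by auto
  have Xu: "X u \<le> X t" "X t = X u \<longleftrightarrow> P t = p" if "t \<in> J" for t
    using AXP(2)[OF that] AXP(2)[OF u(1)] Pp[OF that] u(2) by linarith+
  have XK: "n + X t = X u \<longleftrightarrow> P t = p \<and> n = 0" if "t \<in> J" for t n using Xu[OF that] by linarith
  have single: False if "\<And>t. t \<in> J \<Longrightarrow> P t = p \<Longrightarrow> n t = n u \<Longrightarrow> K t = K u \<or> Q t = Q u"
     "(\<Sum>t | t \<in> J \<and> P t = p \<and> n t = n u. a t * \<gamma> t * b t) = 0" "b u \<noteq> 0" for n :: "exps \<times> nat \<Rightarrow> nat" and b
  proof -
    have "{t. t \<in> J \<and> P t = p \<and> n t = n u} = {u}"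
      using eqI[OF _ u(1)] u that(1) by auto
    then show False using that(2,3) nz[OF JI(1)[OF u(1)]] g(1)[OF JI(1)[OF u(1)]] by simp
  qed
  have K0: "K u \<noteq> 0"
  proof
    assume "K u = 0"
    have "(\<Sum>t | t \<in> J \<and> K t + X t = X u. a t * \<gamma> t * (\<Prod>i\<leftarrow>js t. 64 + 5 * 7 ^ i * 0 ^ 2)) = 0"
    proof (rule vanish_at_0[OF J])
      fix z :: complex
      show "(\<Sum>t\<in>J. z ^ (K t + X t) * (a t * \<gamma> t * (\<Prod>i\<leftarrow>js t. 64 + 5 * 7 ^ i * z ^ 2))) = 0"
        using z4[of 1 z] by (simp add: B_def algebra_simps)
      show "isCont (\<lambda>z. a t * \<gamma> t * (\<Prod>i\<leftarrow>js t. 64 + 5 * 7 ^ i * z ^ 2)) 0" for t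
        by (intro continuous_intros isCont_prod_list)
      show "X u \<le> K t + X t" if "t \<in> J" for t using Xu(1)[OF that] by simp
    qed
    moreover have "{t. t \<in> J \<and> K t + X t = X u} = {t. t \<in> J \<and> P t = p \<and> K t = K u}"
      by (simp only: XK \<open>K u = 0\<close> cong: conj_cong)
    ultimately have "(\<Sum>t | t \<in> J \<and> P t = p \<and> K t = K u. a t * \<gamma> t * (\<Prod>i\<leftarrow>js t. 64 + 5 * 7 ^ i * 0 ^ 2)) = 0"
      by simp
    then show False by (rule single[rotated]) (auto simp: prod_list_zero_iff)
  qed
  have Q0: "Q u \<noteq> 0"
  proof
    assume "Q u = 0"
    have "(\<Sum>t | t \<in> J \<and> Q t + X t = X u. a t * \<gamma> t * (\<Prod>i\<leftarrow>js t. 64 * 0 ^ 3 + 5 * 7 ^ i)) = 0"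
    proof (rule vanish_at_0[OF J])
      fix z :: complex
      show "(\<Sum>t\<in>J. z ^ (Q t + X t) * (a t * \<gamma> t * (\<Prod>i\<leftarrow>js t. 64 * z ^ 3 + 5 * 7 ^ i))) = 0"
        using z4[of z 1] by (simp add: B_def algebra_simps)
      show "isCont (\<lambda>z. a t * \<gamma> t * (\<Prod>i\<leftarrow>js t. 64 * z ^ 3 + 5 * 7 ^ i)) 0" for t
        by (intro continuous_intros isCont_prod_list)
      show "X u \<le> Q t + X t" if "t \<in> J" for t using Xu(1)[OF that] by simp
    qed
    moreover have "{t. t \<in> J \<and> Q t + X t = X u} = {t. t \<in> J \<and> P t = p \<and> Q t = Q u}"
      by (simp only: XK \<open>Q u = 0\<close> cong: conj_cong)
    ultimately have "(\<Sum>t | t \<in> J \<and> P t = p \<and> Q t = Q u. a t * \<gamma> t * (\<Prod>i\<leftarrow>js t. 64 * 0 ^ 3 + 5 * 7 ^ i)) = 0"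
      by simp
    then show False by (rule single[rotated]) (auto simp: prod_list_zero_iff)
  qed
  have cases: "p = 0 \<or> snd u = X u \<or> snd u = HI (word (fst u))"
    using stI(1)[OF JI(1)[OF u(1)]] K0 Q0 u(2) unfolding standard_iff LO_HI_word(1) defs by simp
  have HIW: "HI (word (fst t)) + X t + 3 * (X t + P t) = W t + 3 * A t" for t
    unfolding LO_HI_word W_def defs by simp
  have "\<exists>i0. \<forall>t\<in>J. P t = p \<and> (\<forall>i\<in>set (js t). i = i0)"
    using cases
  proof (elim disjE)
    assume p: "p = 0"
    have "P t = p" if "t \<in> J" for t using Pp[OF that] p by simp
    moreover have "js t = []" if "t \<in> J" for t using g(2)[OF JI(1)[OF that]] Pp[OF that] p by simp
    ultimately show ?thesis by simp
  next
    assume s: "snd u = X u"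
    have "snd t = X t \<and> P t = p" if "t \<in> J" for t
    proof -
      have "X t \<le> snd t" using stI(2)[OF JI(1)[OF that]] by (simp add: valid_def LO_HI_word defs)
      moreover have "snd t = X u" using s JI(2)[OF that] JI(2)[OF u(1)] by simp
      ultimately show ?thesis using Xu[OF that] by simp
    qed
    then show ?thesis using g(3) JI(1) by blast
  next
    assume s: "snd u = HI (word (fst u))"
    have "snd t = HI (word (fst t)) \<and> P t = p" if "t \<in> J" for t
    proof -
      have "snd t \<le> HI (word (fst t))" using stI(2)[OF JI(1)[OF that]] by (simp add: valid_def)
      moreover have "snd t = HI (word (fst u))" using s JI(2)[OF that] JI(2)[OF u(1)] by simp
      moreover have "HI (word (fst t)) + X t = HI (word (fst u)) + X u"
        using HIW[of t] HIW[of u]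
        unfolding JI(3)[OF that] JI(3)[OF u(1)] AXP[OF that] AXP[OF u(1)] by simp
      ultimately show ?thesis using Xu[OF that] by linarith
    qed
    then show ?thesis using g(4) JI(1) by blast
  qed
  then obtain i0 where i0: "\<And>t. t \<in> J \<Longrightarrow> P t = p" "\<And>t i. t \<in> J \<Longrightarrow> i \<in> set (js t) \<Longrightarrow> i = i0" by blast
  define F :: "complex set" where "F = {z. poly [:64, 0, 5 * 7 ^ i0:] z = 0}"
  have "(\<Sum>t | t \<in> J \<and> K t + X t = K u + X u. a t * \<gamma> t) = 0"
  proof (rule separate_exponents[OF J])
    show "finite F" unfolding F_def by (rule poly_roots_finite) simp
    fix z assume "z \<notin> F"
    then have F: "64 + 5 * 7 ^ i0 * z ^ 2 \<noteq> 0" by (simp add: F_def algebra_simps power2_eq_square)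
    have "(64 + 5 * 7 ^ i0 * z ^ 2) ^ p * (z ^ (K t + X t) * (a t * \<gamma> t)) = a t * \<gamma> t * B (js t) t 1 z"
      if "t \<in> J" for t
    proof -
      have "js t = replicate p i0"
        using replicate_length_same[of "js t" i0] i0[OF that] g(2)[OF JI(1)[OF that]] by simp
      then show ?thesis by (simp add: B_def)
    qed
    then have "(64 + 5 * 7 ^ i0 * z ^ 2) ^ p * (\<Sum>t\<in>J. z ^ (K t + X t) * (a t * \<gamma> t)) = 0"
      using z4[of 1 z] by (simp only: sum_distrib_left cong: sum.cong)
    then show "(\<Sum>t\<in>J. z ^ (K t + X t) * (a t * \<gamma> t)) = 0" using F by simp
  qed
  moreover have "{t. t \<in> J \<and> K t + X t = K u + X u} = {t. t \<in> J \<and> P t = p \<and> K t = K u}"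

  proof (rule Collect_cong, rule conj_cong[OF refl])
    fix t assume t: "t \<in> J"
    have "X t = X u" using Xu(2)[OF t] i0(1)[OF t] by simp
    then show "K t + X t = K u + X u \<longleftrightarrow> P t = p \<and> K t = K u" using i0(1)[OF t] by simp
  qed
  ultimately have "(\<Sum>t | t \<in> J \<and> P t = p \<and> K t = K u. a t * \<gamma> t * 1) = 0" by simp
  then show False by (rule single[rotated]) simp_all
qed

section \<open>Generation of the bi-invariants\<close>

lemma bi_algebra_cancel_f1:
  assumes "f1 * P \<in> bi_algebra"
  shows "P \<in> bi_algebra"
proof -
  obtain I c y where I: "finite I" "\<forall>(e, j)\<in>I. standard e j \<and> valid (word e) j" "y \<in> bi_algebra"
    "f1 * P = (\<Sum>(e, j)\<in>I. Const (c (e, j)) * canon (word e) j) + f1 * y"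
    using std_span_finite_sum[OF bi_algebra_subset_std_span[OF assms]] by (elim exE conjE)
  have eq: "f1 * P = (\<Sum>t\<in>I. Const (c t) * canon (word (fst t)) (snd t)) + f1 * y"
    unfolding I(4) by (intro arg_cong[of _ _ "\<lambda>z. z + f1 * y"] sum.cong) (simp_all add: case_prod_beta)
  have "c t = 0" if "t \<in> I" for t
  proof (rule canon_independent[OF I(1) _ _ that])
    show "standard e j \<and> valid (word e) j" if "(e, j) \<in> I" for e j
      using I(2) that by (elim ballE[of _ _ "(e, j)"]) simp_all
    show "(\<Sum>t\<in>I. c t * ev (special_point b s M N) (canon (word (fst t)) (snd t))) = 0" for b s M N
    proof -
      have "ev (special_point b s M N) (f1 * P) =
        ev (special_point b s M N) ((\<Sum>t\<in>I. Const (c t) * canon (word (fst t)) (snd t)) + f1 * y)"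
        by (rule arg_cong[OF eq])
      then show ?thesis by simp
    qed
  qed
  then have "(\<Sum>t\<in>I. Const (c t) * canon (word (fst t)) (snd t)) = 0"
    by (intro sum.neutral ballI) (simp only: Const_0 mult_zero_left)
  then have "f1 * P = f1 * y" using eq by (simp only: add_0_left)
  then have "P = y" using f1_nonzero by simp
  then show ?thesis using I(3) by simp
qed

lemma bi_invariant_in_bi_algebra:
  assumes "bi_invariant m P"
  shows "P \<in> bi_algebra"
proof -
  obtain N where N: "f1 ^ N * P \<in> generated_algebra {f1, \<Lambda>3, \<Lambda>5, \<Lambda>7, \<Lambda>9}"
    by (rule clear_denominators[OF assms])
  then have "f1 ^ N * P \<in> bi_algebra"
  proof induction
    case (gen P)
    then show ?case by (elim insertE emptyE) (hypsubst, rule bi_algebra_intros)+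
  qed (rule bi_algebra_intros; assumption)+
  then show ?thesis
  proof (induction N)
    case (Suc N)
    then have "f1 * (f1 ^ N * P) \<in> bi_algebra" by (simp only: power_Suc mult.assoc)
    then show ?case by (rule Suc.IH[OF bi_algebra_cancel_f1])
  qed simp
qed

lemma E_weight_iff: "P \<in> E_weight 5 m \<longleftrightarrow> P \<in> jet_ring 5 \<and> jet_invariant m P"
  by (auto simp: E_weight_def reparametrization_invariant_iff)

lemma E_weight_subset_E: "P \<in> E_weight \<kappa> m \<Longrightarrow> P \<in> E \<kappa>"
  unfolding E_def by (rule CollectI, intro exI[of _ "{m}"] exI[of _ "\<lambda>_. P"]) simp

lemma sum_Un_add:
  fixes f g :: "'i \<Rightarrow> 'a::comm_monoid_add"
  assumes "finite I" "finite J"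
  shows "(\<Sum>k\<in>I \<union> J. (if k \<in> I then f k else 0) + (if k \<in> J then g k else 0)) = sum f I + sum g J"
  using assms by (simp add: sum.distrib Un_Int_eq flip: sum.inter_restrict)

lemma E_add:
  assumes "P \<in> E 5" "Q \<in> E 5"
  shows "P + Q \<in> E 5"
proof -
  obtain I p where P: "P = sum p I" "finite I" "\<And>m. m \<in> I \<Longrightarrow> p m \<in> E_weight 5 m"
    using assms(1) unfolding E_def by auto
  obtain J q where Q: "Q = sum q J" "finite J" "\<And>m. m \<in> J \<Longrightarrow> q m \<in> E_weight 5 m"
    using assms(2) unfolding E_def by auto
  define r where "r m = (if m \<in> I then p m else 0) + (if m \<in> J then q m else 0)" for m
  have "sum r (I \<union> J) = sum p I + sum q J"
    unfolding r_def by (rule sum_Un_add[OF P(2) Q(2)])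
  moreover have "r m \<in> E_weight 5 m" for m
    using P(3) Q(3) by (simp add: r_def E_weight_iff jet_ring_intros jet_invariant_add jet_invariant_0)
  ultimately show ?thesis
    unfolding E_def P(1) Q(1) using P(2) Q(2) by (intro CollectI exI[of _ "I \<union> J"] exI[of _ r]) simp
qed

lemma E_0: "0 \<in> E 5"
  by (rule E_weight_subset_E[of _ _ 0]) (simp add: E_weight_iff jet_ring_intros jet_invariant_0)

lemma E_sum: "(\<And>i. i \<in> I \<Longrightarrow> f i \<in> E 5) \<Longrightarrow> sum f I \<in> E 5"
  by (induction I rule: infinite_finite_induct) (simp_all add: E_0 E_add)

lemma E_mult:
  assumes "P \<in> E 5" "Q \<in> E 5"
  shows "P * Q \<in> E 5"
proof -
  obtain I p where P: "P = sum p I" "\<And>m. m \<in> I \<Longrightarrow> p m \<in> E_weight 5 m"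
    using assms(1) unfolding E_def by auto
  obtain J q where Q: "Q = sum q J" "\<And>m. m \<in> J \<Longrightarrow> q m \<in> E_weight 5 m"
    using assms(2) unfolding E_def by auto
  have "p i * q j \<in> E 5" if "i \<in> I" "j \<in> J" for i j
    by (rule E_weight_subset_E[of _ _ "i + j"])
      (use P(2)[OF that(1)] Q(2)[OF that(2)] in \<open>simp add: E_weight_iff jet_ring_mult jet_invariant_mult\<close>)
  then show ?thesis unfolding P(1) Q(1) sum_product by (intro E_sum)
qed

lemma E_Const: "Const c \<in> E 5"
  by (rule E_weight_subset_E[of _ _ 0]) (simp add: E_weight_iff jet_ring_Const jet_invariant_Const)

lemma generated_algebra_subset_E: "S \<subseteq> E 5 \<Longrightarrow> P \<in> generated_algebra S \<Longrightarrow> P \<in> E 5"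
  by (rotate_tac, induction rule: generated_algebra.induct) (simp_all add: subset_iff E_Const E_add E_mult)

lemma compose_jet_shear: "compose_jet (shear u x) p = shear u (compose_jet x p)"
  unfolding compose_jet_def shear_def faa_di_bruno_def by (rule ext) (simp add: algebra_simps)

lemma UE_eq_bi_algebra: "UE 5 = bi_algebra"
proof (rule set_eqI, rule iffI)
  fix P assume "P \<in> UE 5"
  then have PE: "P \<in> E 5" and uni: "unipotent_invariant P"
    by (simp_all add: UE_def unipotent_invariant_iff)
  obtain I p where P: "P = sum p I" "finite I" "\<And>m. m \<in> I \<Longrightarrow> p m \<in> E_weight 5 m"
    using PE unfolding E_def by auto
  have inv: "p m \<in> jet_ring 5" "jet_invariant m (p m)" if "m \<in> I" for m
    using P(3)[OF that] by (simp_all add: E_weight_iff)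
  have "unipotent_invariant (p n)" if n: "n \<in> I" for n
    unfolding unipotent_invariant_def
  proof (intro allI)
    fix u x
    have "(\<Sum>m | m \<in> I \<and> m = n. ev (shear u x) (p m) - ev x (p m)) = 0"
    proof (rule separate_exponents[OF P(2), of "{0}"])
      fix z :: complex assume "z \<notin> {0}"
      define q :: "nat \<Rightarrow> complex" where "q i = (if i = 1 then z else 0)" for i
      have "z ^ m * (ev (shear u x) (p m) - ev x (p m)) =
          ev (shear u (compose_jet x q)) (p m) - ev (compose_jet x q) (p m)" if "m \<in> I" for m
      proof -
        have "ev (compose_jet y q) (p m) = z ^ m * ev y (p m)" for y
          using inv(2)[OF that] \<open>z \<notin> {0}\<close> unfolding jet_invariant_def by (simp add: q_def)
        then show ?thesis by (simp add: right_diff_distrib flip: compose_jet_shear)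
      qed
      then have "(\<Sum>m\<in>I. z ^ m * (ev (shear u x) (p m) - ev x (p m))) =
          ev (shear u (compose_jet x q)) P - ev (compose_jet x q) P"
        by (simp add: P(1) flip: sum_subtractf)
      then show "(\<Sum>m\<in>I. z ^ m * (ev (shear u x) (p m) - ev x (p m))) = 0"
        using uni by (simp add: unipotent_invariant_def)
    qed simp
    moreover have "{m. m \<in> I \<and> m = n} = {n}" using n by auto
    ultimately show "ev (shear u x) (p n) = ev x (p n)" by simp
  qed
  then have "p m \<in> bi_algebra" if "m \<in> I" for m
    using bi_invariant_in_bi_algebra[of m "p m"] inv[OF that] that by (simp add: bi_invariant_def)
  then show "P \<in> bi_algebra" unfolding P(1) bi_algebra_def by (rule generated_algebra_sum)
next
  fix P assume "P \<in> bi_algebra"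
  then have "P \<in> E 5 \<and> unipotent_invariant P"
    unfolding bi_algebra_def
  proof induction
    case (gen P)
    have *: "Q \<in> E 5 \<and> unipotent_invariant Q" if "bi_invariant m Q" for m Q
      using that E_weight_subset_E[of Q 5 m] by (simp add: bi_invariant_def E_weight_iff)
    have "\<exists>m. bi_invariant m P"
      using gen by (elim insertE emptyE) (hypsubst, rule exI, rule bi_invariant_generators)+
    then show ?case using * by (elim exE)
  qed (simp_all add: E_Const E_add E_mult unipotent_invariant_def)
  then show "P \<in> UE 5" by (simp add: UE_def unipotent_invariant_iff)
qed

section \<open>The action of the Lie algebra\<close>

definition gl_derivation :: "complex \<Rightarrow> complex \<Rightarrow> complex \<Rightarrow> complex \<Rightarrow> jet_poly \<Rightarrow> jet_poly" where
  "gl_derivation a b c d = derivation (\<lambda>v.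
     if component v = 1 then Const a * coord 1 (level v) + Const b * coord 2 (level v)
     else if component v = 2 then Const c * coord 1 (level v) + Const d * coord 2 (level v) else 0)"

definition gl_point :: "complex \<Rightarrow> complex \<Rightarrow> complex \<Rightarrow> complex \<Rightarrow> (jet_coord \<Rightarrow> complex) \<Rightarrow> jet_coord \<Rightarrow> complex" where
  "gl_point a b c d x v =
    (if component v = 1 then a * x (Jet 1 (level v)) + b * x (Jet 2 (level v))
     else if component v = 2 then c * x (Jet 1 (level v)) + d * x (Jet 2 (level v)) else 0)"

abbreviation lowering :: "jet_poly \<Rightarrow> jet_poly" where "lowering \<equiv> polarization_operator"
definition raising :: "jet_poly \<Rightarrow> jet_poly" where "raising = gl_derivation 0 0 1 0"
definition weight_operator :: "jet_poly \<Rightarrow> jet_poly" where "weight_operator = gl_derivation 1 0 0 (- 1)"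

lemma lowering_eq: "lowering = gl_derivation 0 1 0 0"
  unfolding polarization_operator_def gl_derivation_def
  by (rule arg_cong[of _ _ derivation]) (simp add: fun_eq_iff)

lemma gl_derivation_linear [simp]:
  "gl_derivation a b c d (P + Q) = gl_derivation a b c d P + gl_derivation a b c d Q"
  "gl_derivation a b c d (P - Q) = gl_derivation a b c d P - gl_derivation a b c d Q"
  "gl_derivation a b c d (- P) = - gl_derivation a b c d P"
  "gl_derivation a b c d (sum f I) = (\<Sum>i\<in>I. gl_derivation a b c d (f i))"
  "gl_derivation a b c d (Const z * P) = Const z * gl_derivation a b c d P"
  "gl_derivation a b c d 0 = 0" "gl_derivation a b c d (Const z) = 0" "gl_derivation a b c d 1 = 0"
  by (simp_all add: gl_derivation_def derivation_add derivation_diff derivation_uminus derivation_sum derivation_mult)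

lemma gl_derivation_mult:
  "gl_derivation a b c d (P * Q) = gl_derivation a b c d P * Q + P * gl_derivation a b c d Q"
  by (simp add: gl_derivation_def derivation_mult)

lemma gl_derivation_coord [simp]:
  "gl_derivation a b c d (coord k l) =
    (if k = 1 then Const a * coord 1 l + Const b * coord 2 l
     else if k = 2 then Const c * coord 1 l + Const d * coord 2 l else 0)"
  by (simp add: gl_derivation_def)

lemma gl_derivation_commutator:
  "gl_derivation a b c d (gl_derivation a' b' c' d' P) - gl_derivation a' b' c' d' (gl_derivation a b c d P) =
   gl_derivation (b' * c - b * c') (a' * b + b' * d - a * b' - b * d')
     (c' * a + d' * c - c * a' - d * c') (c' * b - c * b') P"
proof (induction P rule: jet_poly_induct)
  case (coord k l)
  show ?case
    by (rule ev_eqI) (simp add: algebra_simps)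
next
  case (mult P R)
  show ?case
    unfolding gl_derivation_mult gl_derivation_linear mult.IH[symmetric] by (simp add: algebra_simps)
next
  case (add P R)
  show ?case unfolding gl_derivation_linear add.IH[symmetric] by simp
qed simp

lemma raising_lowering: "raising (lowering P) = lowering (raising P) + weight_operator P"
  using gl_derivation_commutator[of 0 0 1 0 0 1 0 0 P]
  by (simp add: raising_def weight_operator_def lowering_eq algebra_simps)

lemma weight_lowering: "weight_operator (lowering P) = lowering (weight_operator P) - 2 * lowering P"
proof -
  have "gl_derivation 0 (- 2) 0 0 P = - 2 * gl_derivation 0 1 0 0 P"
    by (induction P rule: jet_poly_induct) (simp_all add: gl_derivation_mult algebra_simps Const_minus Const_numeral)
  then show ?thesis
    using gl_derivation_commutator[of 1 0 0 "- 1" 0 1 0 0 P]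
    by (simp add: weight_operator_def lowering_eq algebra_simps)
qed

lemma weight_raising: "weight_operator (raising P) = raising (weight_operator P) + 2 * raising P"
proof -
  have "gl_derivation 0 0 2 0 P = 2 * gl_derivation 0 0 1 0 P"
    by (induction P rule: jet_poly_induct) (simp_all add: gl_derivation_mult algebra_simps Const_minus Const_numeral)
  then show ?thesis
    using gl_derivation_commutator[of 1 0 0 "- 1" 0 0 1 0 P]
    by (simp add: weight_operator_def raising_def algebra_simps)
qed

lemma jet_ring_gl_derivation: "P \<in> jet_ring 5 \<Longrightarrow> gl_derivation a b c d P \<in> jet_ring 5"
  unfolding gl_derivation_def
  by (rule jet_ring_derivation[of _ 5]) (auto intro!: jet_ring_intros jet_ring_coord)

lemma jet_invariant_gl_derivation:
  assumes "jet_invariant m P"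
  shows "jet_invariant m (gl_derivation a b c d P)"
  unfolding jet_invariant_def
proof (intro allI impI)
  fix x :: "jet_coord \<Rightarrow> complex" and p :: "nat \<Rightarrow> complex" assume p: "p 1 \<noteq> 0"
  define flow where "flow x u v = x v + u * gl_point a b c d x v" for x u v
  have deriv: "((\<lambda>u. ev (flow x u) P) has_field_derivative ev x (gl_derivation a b c d P)) (at 0)" for x
  proof -
    have x: "flow x 0 = x" by (simp add: flow_def fun_eq_iff)
    have "((\<lambda>u. ev (flow x u) P) has_field_derivative ev (flow x 0) (gl_derivation a b c d P)) (at 0)"
      unfolding gl_derivation_def
    proof (rule has_field_derivative_ev)
      fix v
      show "((\<lambda>u. flow x u v) has_field_derivative ev (flow x 0)
        (if component v = 1 then Const a * coord 1 (level v) + Const b * coord 2 (level v)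
         else if component v = 2 then Const c * coord 1 (level v) + Const d * coord 2 (level v) else 0)) (at 0)"
        unfolding x by (auto simp: flow_def gl_point_def intro!: derivative_eq_intros)
    qed
    then show ?thesis unfolding x .
  qed
  have comp: "compose_jet (flow x u) p = flow (compose_jet x p) u" for u
    by (rule ext) (simp add: compose_jet_def flow_def gl_point_def faa_di_bruno_def algebra_simps)
  have "((\<lambda>u. ev (flow (compose_jet x p) u) P) has_field_derivative p 1 ^ m * ev x (gl_derivation a b c d P)) (at 0)"
    using DERIV_cmult[OF deriv[of x], of "p 1 ^ m"] assms p
    unfolding jet_invariant_def by (simp flip: comp)
  then show "ev (compose_jet x p) (gl_derivation a b c d P) = p 1 ^ m * ev x (gl_derivation a b c d P)"
    by (rule DERIV_unique[OF deriv])
qed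

lemma E_weight_gl_derivation: "P \<in> E_weight 5 m \<Longrightarrow> gl_derivation a b c d P \<in> E_weight 5 m"
  by (simp add: E_weight_iff jet_ring_gl_derivation jet_invariant_gl_derivation)

lemma E_weight_linear:
  "0 \<in> E_weight 5 m" "P \<in> E_weight 5 m \<Longrightarrow> Q \<in> E_weight 5 m \<Longrightarrow> P + Q \<in> E_weight 5 m"
  "P \<in> E_weight 5 m \<Longrightarrow> Q \<in> E_weight 5 m \<Longrightarrow> P - Q \<in> E_weight 5 m"
  "P \<in> E_weight 5 m \<Longrightarrow> Const c * P \<in> E_weight 5 m"
  "(\<And>i. i \<in> I \<Longrightarrow> f i \<in> E_weight 5 m) \<Longrightarrow> sum f I \<in> E_weight 5 m"
  by (simp_all add: E_weight_iff jet_ring_intros jet_ring_sum jet_invariant_0 jet_invariant_add jet_invariant_diff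
      jet_invariant_scale jet_invariant_sum)

lemma unipotent_invariant_iff_raising: "unipotent_invariant P \<longleftrightarrow> raising P = 0"
proof -
  have deriv: "((\<lambda>u. ev (shear u x) P) has_field_derivative ev (shear u x) (raising P)) (at u)" for u x
    unfolding raising_def gl_derivation_def
  proof (rule has_field_derivative_ev)
    fix v
    show "((\<lambda>u. shear u x v) has_field_derivative ev (shear u x)
      (if component v = 1 then Const 0 * coord 1 (level v) + Const 0 * coord 2 (level v)
       else if component v = 2 then Const 1 * coord 1 (level v) + Const 0 * coord 2 (level v) else 0)) (at u)"
      by (auto simp: shear_def intro!: derivative_eq_intros)
  qed
  have shear_0: "shear 0 x = x" for x by (simp add: shear_def fun_eq_iff)
  show ?thesis
  proof
    assume inv: "unipotent_invariant P"
    show "raising P = 0"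
    proof (rule ev_eqI)
      fix x
      have "((\<lambda>u. ev x P) has_field_derivative ev x (raising P)) (at 0)"
        using deriv[of x 0] inv unfolding unipotent_invariant_def by (simp add: shear_0)
      from DERIV_unique[OF this DERIV_const] show "ev x (raising P) = ev x 0" by simp
    qed
  next
    assume "raising P = 0"
    then have d: "((\<lambda>u. ev (shear u x) P) has_field_derivative 0) (at u)" for u x
      using deriv[of x u] by simp
    have "ev (shear u x) P = ev (shear 0 x) P" for u x
    proof -
      have "\<exists>c. \<forall>u\<in>UNIV. ev (shear u x) P = c"
        by (rule has_field_derivative_zero_constant) (simp_all add: d)
      then show ?thesis by (elim exE) simp
    qed
    then show "unipotent_invariant P" by (simp add: unipotent_invariant_def shear_0)
  qed
qed

lemma gl_derivation_locally_nilpotent: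
  assumes "\<And>k l. \<exists>n. (gl_derivation a b c d ^^ n) (coord k l) = 0"
  shows "\<exists>n. (gl_derivation a b c d ^^ n) P = 0"
proof -
  let ?d = "gl_derivation a b c d"
  have z: "(?d ^^ i) 0 = 0" for i by (induction i) simp_all
  have sum: "(?d ^^ i) (P + Q) = (?d ^^ i) P + (?d ^^ i) Q" for i P Q by (induction i) simp_all
  have stable: "(?d ^^ (i + j)) P = 0" if "(?d ^^ i) P = 0" for i j P
    using that z unfolding add.commute[of i] funpow_add by simp
  have prod: "(?d ^^ i) P = 0 \<Longrightarrow> (?d ^^ j) R = 0 \<Longrightarrow> i + j = n \<Longrightarrow> (?d ^^ n) (P * R) = 0" for i j n P R
  proof (induction n arbitrary: i j P R)
    case (Suc n)
    show ?case
    proof (cases "i = 0 \<or> j = 0")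
      case True
      then have "P * R = 0" using Suc.prems(1,2) by (elim disjE) simp_all
      then show ?thesis by (simp only: z)
    next
      case False
      then obtain i' j' where ij: "i = Suc i'" "j = Suc j'" by (cases i; cases j) simp_all
      have "(?d ^^ i') (?d P) = 0" "(?d ^^ j') (?d R) = 0"
        using Suc.prems(1,2) by (simp_all only: ij funpow_Suc_right o_apply)
      then have "(?d ^^ n) (?d P * R) = 0" "(?d ^^ n) (P * ?d R) = 0"
        using Suc.IH[of i' "?d P" j R] Suc.IH[of i P j' "?d R"] Suc.prems ij by simp_all
      then show ?thesis by (simp only: funpow_Suc_right o_apply gl_derivation_mult sum add_0_left)
    qed
  qed simp
  show ?thesis
  proof (induction P rule: jet_poly_induct)
    case (const z)
    show ?case by (rule exI[of _ 1]) simp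
  next
    case (add P R)
    then obtain i j where ij: "(?d ^^ i) P = 0" "(?d ^^ j) R = 0" by (elim exE)
    have "(?d ^^ (i + j)) (P + R) = 0"
      unfolding sum stable[OF ij(1)] using stable[OF ij(2), of i] by (simp only: add.commute[of i] add_0_left)
    then show ?case by (rule exI)
  next
    case (mult P R)
    then obtain i j where "(?d ^^ i) P = 0" "(?d ^^ j) R = 0" by (elim exE)
    from prod[OF this refl] show ?case by (rule exI)
  qed (rule assms)
qed

lemma raising_nilpotent: "\<exists>n. (raising ^^ n) P = 0"
  unfolding raising_def
  by (rule gl_derivation_locally_nilpotent, rule exI[of _ 2]) (simp add: numeral_2_eq_2)

lemma lowering_nilpotent: "\<exists>n. (lowering ^^ n) P = 0"
  unfolding lowering_eq
  by (rule gl_derivation_locally_nilpotent, rule exI[of _ 2]) (simp add: numeral_2_eq_2)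

section \<open>Highest weight vectors\<close>

lemmas lowering_linear = gl_derivation_linear[of 0 1 0 0, folded lowering_eq]
lemmas raising_linear = gl_derivation_linear[of 0 0 1 0, folded raising_def]
lemmas weight_linear = gl_derivation_linear[of 1 0 0 "- 1", folded weight_operator_def]

abbreviation lowering_power :: "nat \<Rightarrow> jet_poly \<Rightarrow> jet_poly" where
  "lowering_power j \<equiv> lowering ^^ j"

definition eigenvector :: "int \<Rightarrow> jet_poly \<Rightarrow> bool" where
  "eigenvector h P \<longleftrightarrow> weight_operator P = Const (of_int h) * P"

lemma lowering_power_linear:
  "lowering_power j 0 = 0" "lowering_power j (P + Q) = lowering_power j P + lowering_power j Q"
  "lowering_power j (Const c * P) = Const c * lowering_power j P"
  "lowering_power j (sum f I) = (\<Sum>i\<in>I. lowering_power j (f i))"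
  by (induction j) (simp_all add: lowering_linear)

lemma eigenvector_linear:
  "eigenvector h 0" "eigenvector h P \<Longrightarrow> eigenvector h Q \<Longrightarrow> eigenvector h (P + Q)"
  "eigenvector h P \<Longrightarrow> eigenvector h Q \<Longrightarrow> eigenvector h (P - Q)"
  "eigenvector h P \<Longrightarrow> eigenvector h (Const c * P)"
  "(\<And>i. i \<in> I \<Longrightarrow> eigenvector h (f i)) \<Longrightarrow> eigenvector h (sum f I)"
  by (simp_all add: eigenvector_def weight_linear distrib_left right_diff_distrib sum_distrib_left mult.left_commute)

lemma eigenvector_lowering_power:
  assumes "eigenvector h P"
  shows "eigenvector (h - 2 * int j) (lowering_power j P)"
proof (induction j)
  case (Suc j)
  show ?case
    using Suc.IH
    by (simp add: eigenvector_def weight_lowering lowering_linear)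
      (rule ev_eqI, simp add: algebra_simps)
qed (simp add: assms)

lemma eigenvector_raising:
  assumes "eigenvector h P"
  shows "eigenvector (h + 2) (raising P)"
  using assms by (simp add: eigenvector_def weight_raising raising_linear Const_add Const_numeral distrib_right)

lemma raising_lowering_power:
  assumes "eigenvector h P" "lowering (raising P) = 0"
  shows "raising (lowering_power (Suc j) P) = Const (of_int ((int j + 1) * (h - int j))) * lowering_power j P"
proof (induction j)
  case 0
  then show ?case using assms by (simp add: raising_lowering eigenvector_def)
next
  case (Suc j)
  have "raising (lowering_power (Suc (Suc j)) P) =
      lowering (raising (lowering_power (Suc j) P)) + weight_operator (lowering_power (Suc j) P)"
    by (simp add: raising_lowering)
  also have "\<dots> = Const (of_int ((int j + 1) * (h - int j))) * lowering_power (Suc j) P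
      + Const (of_int (h - 2 * int (Suc j))) * lowering_power (Suc j) P"
    unfolding Suc.IH lowering_linear eigenvector_lowering_power[OF assms(1), unfolded eigenvector_def] by simp
  also have "\<dots> = Const (of_int ((int (Suc j) + 1) * (h - int (Suc j)))) * lowering_power (Suc j) P"
    by (rule ev_eqI) (simp add: algebra_simps)
  finally show ?case .
qed

lemma eigenvector_eq_0:
  assumes "eigenvector h P" "lowering (raising P) = 0" "h < 0"
  shows "P = 0"
proof -
  have "lowering_power n P = 0 \<Longrightarrow> P = 0" for n
  proof (induction n)
    case (Suc n)
    have "Const (of_int ((int n + 1) * (h - int n))) * lowering_power n P = 0"
      unfolding raising_lowering_power[OF assms(1,2), symmetric] Suc.prems by (simp add: raising_linear)
    moreover have "Const (of_int ((int n + 1) * (h - int n))) \<noteq> 0"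
    proof
      assume "Const (of_int ((int n + 1) * (h - int n))) = 0"
      then have "ev undefined (Const (of_int ((int n + 1) * (h - int n)))) = ev undefined 0" by (rule arg_cong)
      then have "(int n + 1) * (h - int n) = 0" by (simp only: ev_simps of_int_eq_0_iff)
      then show False using assms(3) by simp
    qed
    ultimately show ?case using Suc.IH by simp
  qed simp
  then show ?thesis using lowering_nilpotent[of P] by (elim exE)
qed

lemma highest_weight_lowering_power:
  assumes "eigenvector (int n) P" "raising P = 0"
  shows "lowering_power (Suc n) P = 0"
proof (rule eigenvector_eq_0)
  show "eigenvector (int n - 2 * int (Suc n)) (lowering_power (Suc n) P)"
    by (rule eigenvector_lowering_power[OF assms(1)])
  have "raising (lowering_power (Suc n) P) = 0"
    using raising_lowering_power[OF assms(1), of n] assms(2) by (simp add: lowering_linear)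
  then show "lowering (raising (lowering_power (Suc n) P)) = 0" by (simp only: lowering_linear)
qed simp

inductive_set eigenspan :: "jet_poly set" where
  eigenvector: "eigenvector h P \<Longrightarrow> P \<in> eigenspan"
| add: "P \<in> eigenspan \<Longrightarrow> Q \<in> eigenspan \<Longrightarrow> P + Q \<in> eigenspan"

lemma eigenvector_mult:
  assumes "eigenvector h P" "eigenvector k Q"
  shows "eigenvector (h + k) (P * Q)"
  using assms unfolding eigenvector_def weight_operator_def gl_derivation_mult
  by (simp add: Const_add algebra_simps)

lemma eigenspan_mult:
  assumes "P \<in> eigenspan" "Q \<in> eigenspan"
  shows "P * Q \<in> eigenspan"
  using assms(1)
proof induction
  case P: (eigenvector h P)
  show ?case using assms(2)
  proof induction
    case (eigenvector k Q)
    show ?case by (rule eigenspan.eigenvector[OF eigenvector_mult[OF P eigenvector]])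
  next
    case (add Q R)
    then show ?case unfolding distrib_left by (intro eigenspan.add)
  qed
next
  case (add P R)
  then show ?case unfolding distrib_right by (intro eigenspan.add)
qed

lemma eigenspan_UNIV: "P \<in> eigenspan"
proof (induction P rule: jet_poly_induct)
  case (const c)
  show ?case by (rule eigenspan.eigenvector[of 0]) (simp add: eigenvector_def weight_linear)
next
  case (coord k l)
  show ?case
    by (rule eigenspan.eigenvector[of "if k = 1 then 1 else if k = 2 then - 1 else 0"])
      (simp add: eigenvector_def weight_operator_def)
qed (auto intro: eigenspan.add eigenspan_mult)

lemma eigenvector_decomposition:
  "\<exists>I p. finite I \<and> P = sum p I \<and> (\<forall>h\<in>I. eigenvector h (p h))"
  using eigenspan_UNIV[of P]
proof induction
  case (eigenvector h P)
  show ?case by (intro exI[of _ "{h}"] exI[of _ "\<lambda>_. P"]) (simp add: eigenvector)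
next
  case (add P Q)
  then obtain I p J q where P: "finite I" "P = sum p I" "\<And>h. h \<in> I \<Longrightarrow> eigenvector h (p h)"
    and Q: "finite J" "Q = sum q J" "\<And>h. h \<in> J \<Longrightarrow> eigenvector h (q h)"
    by (elim exE conjE) blast
  show ?case
  proof (intro exI conjI ballI)
    show "finite (I \<union> J)" using P(1) Q(1) by simp
    show "P + Q = (\<Sum>k\<in>I \<union> J. (if k \<in> I then p k else 0) + (if k \<in> J then q k else 0))"
      unfolding sum_Un_add[OF P(1) Q(1)] P(2) Q(2) ..
    show "eigenvector h ((if h \<in> I then p h else 0) + (if h \<in> J then q h else 0))" for h
      using P(3) Q(3) by (intro eigenvector_linear(2)) (simp_all add: eigenvector_linear(1))
  qed
qed

lemma eigenvector_component:
  assumes "finite I" "\<And>h. h \<in> I \<Longrightarrow> eigenvector h (p h)" "sum p I \<in> E_weight 5 m" "h \<in> I"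
  shows "p h \<in> E_weight 5 m"
  using assms
proof (induction I arbitrary: p h)
  case (insert j I)
  let ?P = "sum p (insert j I)"
  have "weight_operator ?P - Const (of_int j) * ?P = (\<Sum>k\<in>I. Const (of_int (k - j)) * p k)"
  proof -
    have "weight_operator (p k) = Const (of_int k) * p k" if "k \<in> insert j I" for k
      using insert.prems(1)[OF that] by (simp add: eigenvector_def)
    then have "weight_operator ?P = (\<Sum>k\<in>insert j I. Const (of_int k) * p k)"
      unfolding weight_linear by (intro sum.cong refl)
    then have "weight_operator ?P - Const (of_int j) * ?P =
        (\<Sum>k\<in>insert j I. Const (of_int k) * p k - Const (of_int j) * p k)"
      by (simp only: sum_distrib_left sum_subtractf)
    also have "\<dots> = (\<Sum>k\<in>I. Const (of_int k) * p k - Const (of_int j) * p k)"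
      using insert.hyps by simp
    also have "\<dots> = (\<Sum>k\<in>I. Const (of_int (k - j)) * p k)"
      by (intro sum.cong refl ev_eqI) (simp add: algebra_simps)
    finally show ?thesis .
  qed
  moreover have "weight_operator ?P - Const (of_int j) * ?P \<in> E_weight 5 m"
    unfolding weight_operator_def
    by (intro E_weight_linear E_weight_gl_derivation insert.prems(2))
  ultimately have sum: "(\<Sum>k\<in>I. Const (of_int (k - j)) * p k) \<in> E_weight 5 m" by simp
  have pk: "p k \<in> E_weight 5 m" if k: "k \<in> I" for k
  proof -
    have "Const (of_int (k - j)) * p k \<in> E_weight 5 m"
      by (rule insert.IH[OF _ sum k]) (use insert.prems(1) in \<open>simp add: eigenvector_linear(4)\<close>)
    then have "Const (1 / of_int (k - j)) * (Const (of_int (k - j)) * p k) \<in> E_weight 5 m"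
      by (rule E_weight_linear)
    moreover have "Const (1 / of_int (k - j)) * (Const (of_int (k - j)) * p k) = p k"
      using k insert.hyps(2) by (intro ev_eqI) (auto simp: field_simps)
    ultimately show ?thesis by (simp only:)
  qed
  show ?case
  proof (cases "h = j")
    case True
    have "?P - sum p I \<in> E_weight 5 m" by (rule E_weight_linear(3)[OF insert.prems(2) E_weight_linear(5)[OF pk]])
    then show ?thesis using True insert.hyps by simp
  next
    case False
    then show ?thesis using insert.prems(3) pk by simp
  qed
qed simp

lemma E_weight_lowering_power: "P \<in> E_weight 5 m \<Longrightarrow> lowering_power j P \<in> E_weight 5 m"
  by (induction j) (simp_all add: lowering_eq E_weight_gl_derivation)

lemma highest_weight_decomposition:
  assumes "P \<in> E_weight 5 m" "eigenvector h P" "(raising ^^ n) P = 0"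
  shows "\<exists>N K. P = (\<Sum>i<N. lowering_power i (K i)) \<and>
    (\<forall>i<N. K i \<in> E_weight 5 m \<and> raising (K i) = 0 \<and> eigenvector (h + 2 * int i) (K i))"
  using assms
proof (induction n arbitrary: P h)
  case 0
  then show ?case by (intro exI[of _ 0]) simp
next
  case (Suc n)
  have "raising P \<in> E_weight 5 m" unfolding raising_def by (rule E_weight_gl_derivation[OF Suc.prems(1)])
  moreover have "(raising ^^ n) (raising P) = 0" using Suc.prems(3) by (simp only: funpow_Suc_right o_apply)
  ultimately obtain N K where K: "raising P = (\<Sum>i<N. lowering_power i (K i))"
    "\<And>i. i < N \<Longrightarrow> K i \<in> E_weight 5 m" "\<And>i. i < N \<Longrightarrow> raising (K i) = 0"
    "\<And>i. i < N \<Longrightarrow> eigenvector (h + 2 + 2 * int i) (K i)"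
    using Suc.IH[OF _ eigenvector_raising[OF Suc.prems(2)]] by blast
  define a :: "nat \<Rightarrow> complex" where
    "a i = (if h + 2 + int i = 0 then 0 else 1 / of_int ((int i + 1) * (h + 2 + int i)))" for i
  define R where "R = P - (\<Sum>i<N. Const (a i) * lowering_power (Suc i) (K i))"
  have R: "eigenvector h R"
    unfolding R_def
  proof (intro eigenvector_linear(3-5) Suc.prems(2))
    fix i assume "i \<in> {..<N}"
    then have "eigenvector (h + 2 + 2 * int i - 2 * int (Suc i)) (lowering_power (Suc i) (K i))"
      by (intro eigenvector_lowering_power K(4)) simp
    then show "eigenvector h (lowering_power (Suc i) (K i))" by simp
  qed
  have "raising R = (\<Sum>i<N. lowering_power i (K i) - Const (a i) * raising (lowering_power (Suc i) (K i)))"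
    by (simp only: R_def raising_linear K(1) sum_subtractf)
  also have "\<dots> = (\<Sum>i<N. if h + 2 + int i = 0 then lowering_power i (K i) else 0)"
  proof (rule sum.cong[OF refl])
    fix i assume "i \<in> {..<N}"
    then have i: "i < N" by simp
    have *: "raising (lowering_power (Suc i) (K i)) = Const (of_int ((int i + 1) * (h + 2 + int i))) * lowering_power i (K i)"
    proof -
      have "h + 2 + 2 * int i - int i = h + 2 + int i" by simp
      from raising_lowering_power[OF K(4)[OF i], of i, unfolded this] show ?thesis
        by (simp only: K(3)[OF i] lowering_linear)
    qed
    show "lowering_power i (K i) - Const (a i) * raising (lowering_power (Suc i) (K i)) =
      (if h + 2 + int i = 0 then lowering_power i (K i) else 0)"
    proof (cases "h + 2 + int i = 0")
      case True
      then show ?thesis by (simp add: a_def)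
    next
      case False
      then have "(int i + 1) * (h + 2 + int i) \<noteq> 0" by simp
      then have "a i * of_int ((int i + 1) * (h + 2 + int i)) = 1"
        using False unfolding a_def if_not_P[OF False]
        by (simp only: nonzero_eq_divide_eq[symmetric] times_divide_eq_left mult_1 of_int_eq_0_iff divide_self_if if_False)
      then have "Const (a i) * raising (lowering_power (Suc i) (K i)) = lowering_power i (K i)"
        unfolding * mult.assoc[symmetric] Const_mult[symmetric] by simp
      then show ?thesis using False by simp
    qed
  qed
  finally have raising_R: "raising R = (\<Sum>i<N. if h + 2 + int i = 0 then lowering_power i (K i) else 0)" .
  have "raising R = 0"
  proof (cases "h < 0")
    case True
    have "lowering (if h + 2 + int i = 0 then lowering_power i (K i) else 0) = 0" if "i < N" for i
    proof (cases "h + 2 + int i = 0")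
      case eq: True
      then have "h + 2 + 2 * int i = int i" by simp
      then have "eigenvector (int i) (K i)" using K(4)[OF that] by (simp only:)
      from highest_weight_lowering_power[OF this K(3)[OF that]] eq show ?thesis by simp
    qed (simp add: lowering_linear)
    then have "lowering (raising R) = 0"
      unfolding raising_R lowering_linear by (intro sum.neutral ballI) simp
    then show ?thesis using eigenvector_eq_0[OF R _ True] by (simp add: raising_linear)
  next
    case False
    then show ?thesis unfolding raising_R by (intro sum.neutral ballI) simp
  qed
  define K' where "K' i = (case i of 0 \<Rightarrow> R | Suc j \<Rightarrow> Const (a j) * K j)" for i
  have "P = (\<Sum>i<Suc N. lowering_power i (K' i))"
    unfolding sum.lessThan_Suc_shift
    by (simp add: K'_def R_def lowering_power_linear lowering_linear)
  moreover have "K' i \<in> E_weight 5 m \<and> raising (K' i) = 0 \<and> eigenvector (h + 2 * int i) (K' i)" if "i < Suc N" for i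
  proof (cases i)
    case 0
    have "lowering_power (Suc j) (K j) \<in> E_weight 5 m" if "j < N" for j
      by (rule E_weight_lowering_power[OF K(2)[OF that]])
    then have "R \<in> E_weight 5 m"
      unfolding R_def by (intro E_weight_linear(3-5) Suc.prems(1)) simp
    then show ?thesis using 0 R \<open>raising R = 0\<close> by (simp add: K'_def)
  next
    case (Suc j)
    then have "j < N" using that by simp
    have "h + 2 + 2 * int j = h + 2 * int i" using Suc by simp
    from K(4)[OF \<open>j < N\<close>, unfolded this] show ?thesis
      using K(2,3)[OF \<open>j < N\<close>] Suc by (simp add: K'_def E_weight_linear(4) eigenvector_linear(4) raising_linear)
  qed
  ultimately show ?case by (intro exI[of _ "Suc N"] exI[of _ K']) simp
qed

section \<open>Polarizations\<close>

lemma eigenvector_f1_cancel: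
  assumes "eigenvector (h + 1) (f1 * P)"
  shows "eigenvector h P"
proof -
  have "f1 * weight_operator P = f1 * (Const (of_int h) * P)"
    using assms by (simp add: eigenvector_def weight_operator_def gl_derivation_mult Const_add algebra_simps)
  then show ?thesis using f1_nonzero by (simp only: eigenvector_def mult_cancel_left) simp
qed

lemma weight_operator_D: "weight_operator (D P) = D (weight_operator P)"
proof (induction P rule: jet_poly_induct)
  case (coord k l)
  show ?case by (simp add: weight_operator_def D_simps)
qed (simp_all add: weight_operator_def D_simps gl_derivation_mult)

lemma eigenvector_D: "eigenvector h P \<Longrightarrow> eigenvector h (D P)"
  by (simp add: eigenvector_def weight_operator_D D_simps)

lemma eigenvector_of_nat: "eigenvector h P \<Longrightarrow> eigenvector h (of_nat n * P)"
  by (simp add: eigenvector_linear(4) flip: Const_of_nat)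

lemma eigenvector_numeral: "eigenvector h P \<Longrightarrow> eigenvector h (numeral n * P)"
  by (simp add: eigenvector_linear(4) flip: Const_numeral)

lemma eigenvector_bracket:
  "eigenvector h P \<Longrightarrow> eigenvector k Q \<Longrightarrow> l = h + k \<Longrightarrow> eigenvector l (bracket p P q Q)"
  unfolding bracket_def
  by (simp only:) (intro eigenvector_linear(3) eigenvector_mult eigenvector_of_nat eigenvector_D)

lemma eigenvector_uminus: "eigenvector h P \<Longrightarrow> eigenvector h (- P)"
  by (simp add: eigenvector_def weight_linear)

lemma eigenvector_mult': "eigenvector h P \<Longrightarrow> eigenvector k Q \<Longrightarrow> l = h + k \<Longrightarrow> eigenvector l (P * Q)"
  by (simp only: eigenvector_mult)

lemma generator_weights:
  "eigenvector 1 f1" "eigenvector 0 \<Lambda>3" "eigenvector 1 \<Lambda>5" "eigenvector 2 \<Lambda>7" "eigenvector 3 \<Lambda>9"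
  "eigenvector 0 M8" "eigenvector 1 M10" "eigenvector 2 K12" "eigenvector 0 N12" "eigenvector 1 H14"
  "eigenvector 2 F16" "eigenvector 3 X18" "eigenvector 1 X19" "eigenvector 0 X21" "eigenvector 1 X23"
  "eigenvector 2 X25" "eigenvector 3 Y27"
proof -
  show f: "eigenvector 1 f1" by (simp add: eigenvector_def weight_operator_def)
  show 3: "eigenvector 0 \<Lambda>3"
    by (simp add: eigenvector_def weight_operator_def \<Lambda>3_def gl_derivation_mult Const_minus)
  show 5: "eigenvector 1 \<Lambda>5" unfolding \<Lambda>5_def by (rule eigenvector_bracket[OF 3 f]) simp
  show 7: "eigenvector 2 \<Lambda>7" unfolding \<Lambda>7_def by (rule eigenvector_bracket[OF 5 f]) simp
  show 9: "eigenvector 3 \<Lambda>9" unfolding \<Lambda>9_def by (rule eigenvector_bracket[OF 7 f]) simp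
  have "eigenvector (0 + 1 + 1) (f1 * (f1 * M8))"
    unfolding mult.assoc[symmetric] power2_eq_square[symmetric] f1_M8
    by (rule eigenvector_linear(3); rule eigenvector_mult', rule eigenvector_numeral, (rule 3 5 7)+, simp)
  then show 8: "eigenvector 0 M8" by (rule eigenvector_f1_cancel[OF eigenvector_f1_cancel])
  show 10: "eigenvector 1 M10" unfolding M10_def by (rule eigenvector_bracket[OF 8 f]) simp
  show 12: "eigenvector 0 N12" unfolding N12_def by (rule eigenvector_bracket[OF 8 3]) simp
  show 14: "eigenvector 1 H14" unfolding H14_def by (rule eigenvector_bracket[OF 8 5]) simp
  show 16: "eigenvector 2 F16" unfolding F16_def by (rule eigenvector_bracket[OF 8 7]) simp
  have "eigenvector (2 + 1) (f1 * K12)" unfolding K12(1) by (rule eigenvector_bracket[OF 7 5]) simp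
  then show K: "eigenvector 2 K12" by (rule eigenvector_f1_cancel)
  have neg: "eigenvector h (- numeral n * P)" if "eigenvector h P" for h n P
    using eigenvector_uminus[OF eigenvector_numeral[OF that]] by simp
  have step: "eigenvector h R"
    if "f1 * R = - numeral m * P * Q + S * T" "eigenvector i P" "eigenvector j Q" "h + 1 = i + j"
      "eigenvector k S" "eigenvector l T" "h + 1 = k + l" for h i j k l m P Q R S T
  proof (rule eigenvector_f1_cancel)
    show "eigenvector (h + 1) (f1 * R)"
      unfolding that(1)
      by (rule eigenvector_linear(2); rule eigenvector_mult', (rule neg that(2-7))+)
  qed
  show X18: "eigenvector 3 X18" by (rule step[OF X18(1) 9 10 _ eigenvector_numeral[OF 7] K]) simp_all
  show "eigenvector 1 X19" by (rule step[OF X19(1) 10 10 _ eigenvector_numeral[OF 8] K]) simp_all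
  show "eigenvector 0 X21" by (rule step[OF X21(1) 10 12 _ eigenvector_numeral[OF 8] 14]) simp_all
  show "eigenvector 1 X23" by (rule step[OF X23(1) 12 K _ 8 16]) simp_all
  show "eigenvector 2 X25" by (rule step[OF X25(1) K 14 _ eigenvector_numeral[OF 10] 16]) simp_all
  show "eigenvector 3 Y27" by (rule step[OF Y27(1) K 16 _ 10 X18]) simp_all
qed

lemma bi_invariants_weights:
  assumes "(P, r) \<in> set bi_invariants"
  shows "\<exists>m. bi_invariant m P" "eigenvector (int r) P"
proof -
  show "\<exists>m. bi_invariant m P"
    using assms unfolding bi_invariants_def list.set
    by (elim insertE emptyE Pair_inject) (hypsubst, rule exI, rule bi_invariant_generators)+
  show "eigenvector (int r) P"
    using assms unfolding bi_invariants_def list.set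
    by (elim insertE emptyE Pair_inject) (hypsubst, simp only: of_nat_0 of_nat_1 of_nat_numeral generator_weights)+
qed

lemma polarization_mem:
  assumes "(P, r) \<in> set bi_invariants" "is \<in> index_lists r"
  shows "polarization P is \<in> labelled_polarization ` polarization_labels"
proof -
  obtain n where n: "n < length bi_invariants" "bi_invariants ! n = (P, r)"
    using assms(1) unfolding in_set_conv_nth by (elim exE conjE)
  show ?thesis
    by (rule image_eqI[of _ _ "(n, is)"])
      (use n assms(2) in \<open>simp_all add: labelled_polarization_def polarization_labels_def\<close>)
qed

lemma polarization_labels_cases:
  assumes "Q \<in> labelled_polarization ` polarization_labels"
  obtains P r "is" where "(P, r) \<in> set bi_invariants" "Q = polarization P is"
proof -
  obtain n "is" where n: "n < length bi_invariants" "is \<in> index_lists (snd (bi_invariants ! n))"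
    "Q = polarization (fst (bi_invariants ! n)) is"
    using assms by (auto simp: labelled_polarization_def polarization_labels_def)
  show thesis
    by (rule that[of "fst (bi_invariants ! n)" "snd (bi_invariants ! n)" "is"]) (use n in simp_all)
qed

definition standard_index :: "nat \<Rightarrow> nat \<Rightarrow> nat list" where
  "standard_index r s = replicate (r - s) 1 @ replicate s 2"

lemma standard_index:
  assumes "s \<le> r"
  shows "standard_index r s \<in> index_lists r"
    "polarization P (standard_index r s) = Const (fact (r - s) / fact r) * lowering_power s P"
  using assms
  by (auto simp: standard_index_def index_lists_def polarization_def count_list_replicate Let_def)

definition polarization_algebra :: "jet_poly set" where
  "polarization_algebra = generated_algebra (labelled_polarization ` polarization_labels)"

lemma lowering_power_mem:
  assumes "(P, r) \<in> set bi_invariants"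
  shows "lowering_power s P \<in> polarization_algebra"
proof (cases "s \<le> r")
  case True
  have "polarization P (standard_index r s) \<in> polarization_algebra"
    unfolding polarization_algebra_def
    by (intro generated_algebra.gen polarization_mem[OF assms] standard_index True)
  then have "Const (fact r / fact (r - s)) * polarization P (standard_index r s) \<in> polarization_algebra"
    unfolding polarization_algebra_def by (intro generated_algebra.mult generated_algebra.const)
  also have "Const (fact r / fact (r - s)) * polarization P (standard_index r s) = lowering_power s P"
    unfolding standard_index(2)[OF True] by (rule ev_eqI) simp
  finally show ?thesis .
next
  case False
  obtain m where "bi_invariant m P" using bi_invariants_weights(1)[OF assms] by (elim exE)
  then have "raising P = 0" by (simp add: bi_invariant_def unipotent_invariant_iff_raising)
  then have "lowering_power (Suc r) P = 0"
    by (rule highest_weight_lowering_power[OF bi_invariants_weights(2)[OF assms]])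
  then have "lowering_power (s - Suc r + Suc r) P = 0" by (simp only: funpow_add o_apply lowering_power_linear)
  moreover have "s - Suc r + Suc r = s" using False by simp
  ultimately show ?thesis by (simp add: polarization_algebra_def)
qed

lemma polarization_algebra_lowering:
  assumes "P \<in> polarization_algebra"
  shows "lowering P \<in> polarization_algebra"
  using assms unfolding polarization_algebra_def
proof induction
  case (gen Q)
  obtain P r "is" where P: "(P, r) \<in> set bi_invariants" "Q = polarization P is"
    by (rule polarization_labels_cases[OF gen])
  have "lowering Q = Const (fact (length is - count_list is 2) / fact (length is)) * lowering_power (Suc (count_list is 2)) P"
    unfolding P(2) polarization_def Let_def lowering_linear by simp
  then show ?case
    using lowering_power_mem[OF P(1)] unfolding polarization_algebra_def
    by (simp only:) (intro generated_algebra.mult generated_algebra.const)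
next
  case (mult P Q)
  then show ?case
    unfolding lowering_eq gl_derivation_mult by (intro generated_algebra.add generated_algebra.mult)
qed (simp_all add: lowering_linear generated_algebra.add)

lemma bi_algebra_subset_polarization_algebra:
  assumes "P \<in> bi_algebra"
  shows "P \<in> polarization_algebra"
  using assms unfolding bi_algebra_def polarization_algebra_def
proof induction
  case (gen P)
  then have "\<exists>r. (P, r) \<in> set bi_invariants"
    unfolding bi_invariants_def list.set
    by (elim insertE emptyE) (hypsubst, rule exI, (rule insertI1 | rule insertI2)+)+
  then obtain r where "(P, r) \<in> set bi_invariants" by (elim exE)
  from lowering_power_mem[OF this, of 0] show ?case by (simp add: polarization_algebra_def)
qed (rule generated_algebra.intros; assumption)+

lemma E_eq_polarization_algebra: "E 5 = polarization_algebra"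
proof (rule set_eqI, rule iffI)
  fix P assume "P \<in> E 5"
  then obtain I p where P: "P = sum p I" "\<And>m. m \<in> I \<Longrightarrow> p m \<in> E_weight 5 m"
    unfolding E_def by auto
  have E_weight: "Q \<in> polarization_algebra" if Q: "Q \<in> E_weight 5 m" for Q m
  proof -
    obtain J q where q: "finite J" "Q = sum q J" "\<And>h. h \<in> J \<Longrightarrow> eigenvector h (q h)"
      using eigenvector_decomposition[of Q] by (elim exE conjE) (rule, assumption, assumption, erule bspec)
    have "q h \<in> polarization_algebra" if h: "h \<in> J" for h
    proof -
      have "q h \<in> E_weight 5 m"
        by (rule eigenvector_component[OF q(1) q(3) _ h]; (rule Q[unfolded q(2)] | assumption))
      moreover obtain n where "(raising ^^ n) (q h) = 0" using raising_nilpotent[of "q h"] by (elim exE)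
      ultimately obtain N K where K: "q h = (\<Sum>i<N. lowering_power i (K i))"
        "\<forall>i<N. K i \<in> E_weight 5 m \<and> raising (K i) = 0 \<and> eigenvector (h + 2 * int i) (K i)"
        using highest_weight_decomposition[OF _ q(3)[OF h]] by blast
      have "lowering_power i (K i) \<in> polarization_algebra" if "i < N" for i
      proof -
        have "bi_invariant m (K i)"
          using K(2) that by (simp add: bi_invariant_def E_weight_iff unipotent_invariant_iff_raising)
        then have "K i \<in> polarization_algebra"
          by (intro bi_algebra_subset_polarization_algebra bi_invariant_in_bi_algebra)
        then have "lowering_power j (K i) \<in> polarization_algebra" for j
          by (induction j) (simp_all add: polarization_algebra_lowering)
        then show ?thesis .
      qed
      then show ?thesis
        unfolding K(1) polarization_algebra_def by (intro generated_algebra_sum) simp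
    qed
    then show ?thesis unfolding q(2) polarization_algebra_def by (intro generated_algebra_sum) simp
  qed
  show "P \<in> polarization_algebra"
    unfolding P(1) polarization_algebra_def
    by (rule generated_algebra_sum, rule E_weight[OF P(2), unfolded polarization_algebra_def])
next
  fix P assume P: "P \<in> polarization_algebra"
  have "Q \<in> E 5" if Q: "Q \<in> labelled_polarization ` polarization_labels" for Q
  proof -
    obtain P r "is" where P: "(P, r) \<in> set bi_invariants" "Q = polarization P is"
      by (rule polarization_labels_cases[OF Q])
    obtain m where "bi_invariant m P" using bi_invariants_weights(1)[OF P(1)] by (elim exE)
    then have "P \<in> E_weight 5 m" by (simp add: bi_invariant_def E_weight_iff)
    then have "Q \<in> E_weight 5 m"
      unfolding P(2) polarization_def Let_def by (intro E_weight_linear(4) E_weight_lowering_power)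
    then show ?thesis by (rule E_weight_subset_E)
  qed
  then show "P \<in> E 5"
    using P unfolding polarization_algebra_def by (intro generated_algebra_subset_E) auto
qed

section \<open>Mutual independence\<close>

type_synonym exponents = "nat \<times> nat \<times> nat"

definition test_point :: "complex \<Rightarrow> complex \<Rightarrow> complex \<Rightarrow> jet_coord \<Rightarrow> complex" where
  "test_point z b c v = (if v = Jet 1 1 then z else if v = Jet 2 3 then b / z else if v = Jet 2 4 then c / z else 0)"

lemma test_point_value:
  assumes "bi_invariant m P" "z \<noteq> 0"
  shows "ev (test_point z b c) P = z ^ m * ev (slice 0 (b / z ^ 4) (c / z ^ 5) 0) P"
proof -
  define p :: "nat \<Rightarrow> complex" where "p i = (if i = 1 then z else 0)" for i
  have "compose_jet (slice 0 (b / z ^ 4) (c / z ^ 5) 0) p v = test_point z b c v"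
    if "v \<in> jet_vars P" for v
  proof -
    obtain k l where v: "v = Jet k l" by (cases v)
    have "k = 1 \<or> k = 2" "l = 1 \<or> l = 2 \<or> l = 3 \<or> l = 4 \<or> l = 5"
      using assms(1) that unfolding bi_invariant_def jet_ring_iff v by auto
    then show ?thesis
      using assms(2)
      by (elim disjE) (simp_all add: v compose_jet_def faa_di_bruno_def test_point_def p_def slice_def
          power_numeral_reduce field_simps)
  qed
  then have "ev (test_point z b c) P = ev (compose_jet (slice 0 (b / z ^ 4) (c / z ^ 5) 0) p) P"
    by (intro ev_cong) simp
  then show ?thesis using assms by (simp add: bi_invariant_def jet_invariant_def p_def)
qed

fun monomial_value :: "exponents \<Rightarrow> complex \<Rightarrow> complex \<Rightarrow> complex \<Rightarrow> complex" where
  "monomial_value (i, j, n) z b c = z ^ n * (b ^ i * c ^ j)"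

inductive_set supported :: "exponents set \<Rightarrow> jet_poly set" for T where
  mono: "e \<in> T \<Longrightarrow> (\<And>z b c. z \<noteq> 0 \<Longrightarrow> ev (test_point z b c) P = k * monomial_value e z b c) \<Longrightarrow> P \<in> supported T"
| add: "P \<in> supported T \<Longrightarrow> Q \<in> supported T \<Longrightarrow> P + Q \<in> supported T"

lemma supported_mult:
  assumes T: "\<And>e f. e \<in> T \<Longrightarrow> f \<in> T \<Longrightarrow> e + f \<in> T" and "P \<in> supported T" "Q \<in> supported T"
  shows "P * Q \<in> supported T"
  using assms(2)
proof induction
  case P: (mono e P k)
  show ?case using assms(3)
  proof induction
    case (mono f Q l)
    show ?case
    proof (rule supported.mono[OF T[OF P(1) mono(1)], of _ "k * l"])
      show "ev (test_point z b c) (P * Q) = k * l * monomial_value (e + f) z b c" if "z \<noteq> 0" for z b c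
        using P(2)[OF that] mono(2)[OF that] by (cases e; cases f) (simp add: power_add)
    qed
  next
    case (add Q R)
    then show ?case unfolding distrib_left by (intro supported.add)
  qed
next
  case (add P R)
  then show ?case unfolding distrib_right by (intro supported.add)
qed

lemma generated_algebra_supported:
  assumes T: "\<And>e f. e \<in> T \<Longrightarrow> f \<in> T \<Longrightarrow> e + f \<in> T" "0 \<in> T" and "S \<subseteq> supported T"
    and "P \<in> generated_algebra S"
  shows "P \<in> supported T"
  using assms(4)
proof induction
  case (const c)
  show ?case by (rule supported.mono[OF T(2), of _ c]) (simp add: zero_prod_def)
next
  case (mult P Q)
  show ?case by (rule supported_mult[OF T(1) mult.IH])
qed (use assms(3) in \<open>auto intro: supported.add\<close>)

lemma supported_finite_sum:
  "P \<in> supported T \<Longrightarrow> \<exists>V a. finite V \<and> V \<subseteq> T \<and>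
     (\<forall>z b c. z \<noteq> 0 \<longrightarrow> ev (test_point z b c) P = (\<Sum>e\<in>V. a e * monomial_value e z b c))"
proof (induction rule: supported.induct)
  case (mono e P k)
  then show ?case by (intro exI[of _ "{e}"] exI[of _ "\<lambda>_. k"]) simp
next
  case (add P Q)
  then obtain V a W b where V: "finite V" "V \<subseteq> T"
      "\<forall>z x y. z \<noteq> 0 \<longrightarrow> ev (test_point z x y) P = (\<Sum>e\<in>V. a e * monomial_value e z x y)"
    and W: "finite W" "W \<subseteq> T"
      "\<forall>z x y. z \<noteq> 0 \<longrightarrow> ev (test_point z x y) Q = (\<Sum>e\<in>W. b e * monomial_value e z x y)"
    by (elim exE conjE) (rule, assumption+)
  show ?case
  proof (intro exI[of _ "V \<union> W"] exI[of _ "\<lambda>e. (if e \<in> V then a e else 0) + (if e \<in> W then b e else 0)"]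
      conjI allI impI)
    show "ev (test_point z x y) (P + Q) =
      (\<Sum>e\<in>V \<union> W. ((if e \<in> V then a e else 0) + (if e \<in> W then b e else 0)) * monomial_value e z x y)" if "z \<noteq> 0" for z x y
    proof -
      have "ev (test_point z x y) (P + Q) = (\<Sum>e\<in>V. a e * monomial_value e z x y) + (\<Sum>e\<in>W. b e * monomial_value e z x y)"
        using V(3) W(3) that by simp
      also have "\<dots> = (\<Sum>e\<in>V \<union> W. (if e \<in> V then a e * monomial_value e z x y else 0) + (if e \<in> W then b e * monomial_value e z x y else 0))"
        by (rule sum_Un_add[OF V(1) W(1), symmetric])
      also have "\<dots> = (\<Sum>e\<in>V \<union> W. ((if e \<in> V then a e else 0) + (if e \<in> W then b e else 0)) * monomial_value e z x y)"
        by (intro sum.cong refl) (simp add: distrib_right)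
      finally show ?thesis .
    qed
  qed (use V W in auto)
qed

lemma mono_independent:
  assumes V: "finite V" and zero: "\<And>z b c. z \<noteq> 0 \<Longrightarrow> (\<Sum>e\<in>V. a e * monomial_value e z b c) = 0" and "e0 \<in> V"
  shows "a e0 = 0"
proof -
  let ?i = "fst :: exponents \<Rightarrow> nat" and ?j = "(\<lambda>e. fst (snd e)) :: exponents \<Rightarrow> nat"
    and ?n = "(\<lambda>e. snd (snd e)) :: exponents \<Rightarrow> nat"
  have mono_eq: "monomial_value e z b c = z ^ ?n e * (b ^ ?i e * c ^ ?j e)" for e z b c by (cases e) simp
  define V1 where "V1 = {e. e \<in> V \<and> ?n e = ?n e0}"
  define V2 where "V2 = {e. e \<in> V1 \<and> ?i e = ?i e0}"
  have fin: "finite V1" "finite V2" using V by (simp_all add: V1_def V2_def)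
  have 1: "(\<Sum>e\<in>V1. b ^ ?i e * (c ^ ?j e * a e)) = 0" for b c
    unfolding V1_def
  proof (rule separate_exponents[OF V, of "{0}"])
    fix z :: complex assume "z \<notin> {0}"
    then have "(\<Sum>e\<in>V. a e * monomial_value e z b c) = 0" by (intro zero) simp
    then show "(\<Sum>e\<in>V. z ^ ?n e * (b ^ ?i e * (c ^ ?j e * a e))) = 0" unfolding mono_eq by (simp only: mult_ac)
  qed simp
  have 2: "(\<Sum>e\<in>V2. c ^ ?j e * a e) = 0" for c
    unfolding V2_def by (rule separate_exponents[OF fin(1), of "{}"]) (simp_all only: 1 finite.emptyI)
  have "(\<Sum>e | e \<in> V2 \<and> ?j e = ?j e0. a e) = 0"
    by (rule separate_exponents[OF fin(2), of "{}"]) (simp_all only: 2 finite.emptyI)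
  moreover have "{e. e \<in> V2 \<and> ?j e = ?j e0} = {e0}"
    using \<open>e0 \<in> V\<close> by (auto simp: V2_def V1_def prod_eq_iff)
  ultimately show ?thesis by simp
qed

lemma not_supported:
  assumes "e \<notin> T" "k \<noteq> 0" "\<And>z b c. z \<noteq> 0 \<Longrightarrow> ev (test_point z b c) P = k * monomial_value e z b c"
  shows "P \<notin> supported T"
proof
  assume "P \<in> supported T"
  from supported_finite_sum[OF this] obtain V a where V: "finite V" "V \<subseteq> T"
      "\<forall>z x y. z \<noteq> 0 \<longrightarrow> ev (test_point z x y) P = (\<Sum>e\<in>V. a e * monomial_value e z x y)"
    by (elim exE conjE)
  have e: "e \<notin> V" using assms(1) V(2) by auto
  have "(a(e := - k)) e = 0"
  proof (rule mono_independent[where V = "insert e V" and a = "a(e := - k)" and ?e0.0 = e])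
    fix z b c :: complex assume z: "z \<noteq> 0"
    have "(\<Sum>f\<in>V. (a(e := - k)) f * monomial_value f z b c) = (\<Sum>f\<in>V. a f * monomial_value f z b c)"
      by (rule sum.cong) (use e in auto)
    also have "\<dots> = k * monomial_value e z b c" using V(3)[rule_format, OF z] assms(3)[OF z] by (simp only:)
    finally show "(\<Sum>f\<in>insert e V. (a(e := - k)) f * monomial_value f z b c) = 0"
      using V(1) e by simp
  qed (use V(1) in simp_all)
  then show False using assms(2) by simp
qed

text \<open>
  The nonzero values of the generators at \<open>test_point\<close> are monomials whose exponents are indecomposable in this
  additive monoid.
\<close>

definition exponent_monoid :: "exponents set" where
  "exponent_monoid = {(i, j, n). j \<le> i + n \<and> 4 * j \<le> i + 6 * n \<and> 5 * j \<le> 2 * i + 6 * n \<and>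
     \<not> (n = 0 \<and> i = 4 * j + 1) \<and> \<not> (j = 4 * i + 1 \<and> n = 3 * i + 1)}"

definition indecomposable :: "exponents \<Rightarrow> bool" where
  "indecomposable e \<longleftrightarrow> (\<forall>f\<in>exponent_monoid. \<forall>g\<in>exponent_monoid. f + g = e \<longrightarrow> f = 0 \<or> g = 0)"

lemma exponent_monoid_add:
  assumes "e \<in> exponent_monoid" "f \<in> exponent_monoid"
  shows "e + f \<in> exponent_monoid"
proof -
  obtain i j n where e: "e = (i, j, n)" by (cases e)
  obtain i' j' n' where f: "f = (i', j', n')" by (cases f)
  have ineq: "j \<le> i + n" "j' \<le> i' + n'" "4 * j \<le> i + 6 * n" "4 * j' \<le> i' + 6 * n'"
      "5 * j \<le> 2 * i + 6 * n" "5 * j' \<le> 2 * i' + 6 * n'"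
    and neq: "n \<noteq> 0 \<or> i \<noteq> 4 * j + 1" "n' \<noteq> 0 \<or> i' \<noteq> 4 * j' + 1"
      "j \<noteq> 4 * i + 1 \<or> n \<noteq> 3 * i + 1" "j' \<noteq> 4 * i' + 1 \<or> n' \<noteq> 3 * i' + 1"
    using assms unfolding e f exponent_monoid_def by simp_all
  have "\<not> (n + n' = 0 \<and> i + i' = 4 * (j + j') + 1)"
  proof (rule notI, elim conjE)
    assume "n + n' = 0" "i + i' = 4 * (j + j') + 1"
    moreover from this have "4 * j \<le> i" "4 * j' \<le> i'" "i \<noteq> 4 * j + 1" "i' \<noteq> 4 * j' + 1"
      using neq(1,2) ineq(3,4) by simp_all
    moreover from this have "i = 4 * j \<or> i \<ge> 4 * j + 2" "i' = 4 * j' \<or> i' \<ge> 4 * j' + 2" by linarith+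
    ultimately show False unfolding distrib_left by (elim disjE) linarith+
  qed
  moreover have "\<not> (j + j' = 4 * (i + i') + 1 \<and> n + n' = 3 * (i + i') + 1)"
  proof (rule notI, elim conjE)
    assume eq: "j + j' = 4 * (i + i') + 1" "n + n' = 3 * (i + i') + 1"
    note eq = eq[unfolded distrib_left]
    have "j = i + n" "j' = i' + n'" using eq ineq(1,2) by linarith+
    with neq(3,4) have "n \<noteq> 3 * i + 1" "n' \<noteq> 3 * i' + 1" by linarith+
    then show False using eq ineq(5,6) \<open>j = i + n\<close> \<open>j' = i' + n'\<close> by linarith
  qed
  ultimately have "\<not> (n + n' = 0 \<and> i + i' = 4 * (j + j') + 1)"
    "\<not> (j + j' = 4 * (i + i') + 1 \<and> n + n' = 3 * (i + i') + 1)" by this+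
  moreover have "j + j' \<le> (i + i') + (n + n')" "4 * (j + j') \<le> (i + i') + 6 * (n + n')"
    "5 * (j + j') \<le> 2 * (i + i') + 6 * (n + n')"
    using ineq unfolding distrib_left by linarith+
  ultimately show ?thesis unfolding e f exponent_monoid_def by (simp only: mem_Collect_eq case_prod_conv add_Pair simp_thms)
qed

lemma not_generated:
  assumes "indecomposable e" "e \<in> exponent_monoid" "e \<noteq> 0" "k \<noteq> 0"
    "\<And>z b c. z \<noteq> 0 \<Longrightarrow> ev (test_point z b c) P = k * monomial_value e z b c"
    and S: "S \<subseteq> supported (exponent_monoid - {e})"
  shows "P \<notin> generated_algebra S"
proof
  assume "P \<in> generated_algebra S"
  then have "P \<in> supported (exponent_monoid - {e})"
  proof (rule generated_algebra_supported[rotated 3])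
    show "f + g \<in> exponent_monoid - {e}" if "f \<in> exponent_monoid - {e}" "g \<in> exponent_monoid - {e}" for f g
    proof -
      have "f + g \<noteq> e"
      proof
        assume "f + g = e"
        moreover from this have "f = 0 \<or> g = 0" using assms(1) that unfolding indecomposable_def by blast
        ultimately show False using that by auto
      qed
      then show ?thesis using that exponent_monoid_add by simp
    qed
    show "0 \<in> exponent_monoid - {e}" using assms(3) by (simp add: exponent_monoid_def zero_prod_def)
  qed (rule S)
  moreover have "P \<notin> supported (exponent_monoid - {e})"
    by (rule not_supported[OF _ assms(4,5)]) simp_all
  ultimately show False by simp
qed

lemma test_point_monomial:
  assumes "bi_invariant m P" "\<And>b c. ev (slice 0 b c 0) P = k * (b ^ i * c ^ j)" "m = n + 4 * i + 5 * j" "z \<noteq> 0"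
  shows "ev (test_point z b c) P = k * monomial_value (i, j, n) z b c"
proof -
  have "ev (test_point z b c) P = z ^ (n + 4 * i + 5 * j) * (k * ((b / z ^ 4) ^ i * (c / z ^ 5) ^ j))"
    unfolding test_point_value[OF assms(1,4)] assms(2,3) ..
  also have "\<dots> = k * (z ^ n * (b ^ i * c ^ j))"
    using assms(4) by (simp add: power_add power_mult power_divide)
  finally show ?thesis by simp
qed

lemma generator_monomials:
  assumes "z \<noteq> 0"
  shows
    "ev (test_point z b c) f1 = 1 * monomial_value (0, 0, 1) z b c"
    "ev (test_point z b c) \<Lambda>3 = 0 * monomial_value (0, 0, 0) z b c"
    "ev (test_point z b c) \<Lambda>5 = 1 * monomial_value (1, 0, 1) z b c"
    "ev (test_point z b c) \<Lambda>7 = 1 * monomial_value (0, 1, 2) z b c"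
    "ev (test_point z b c) \<Lambda>9 = 0 * monomial_value (0, 0, 0) z b c"
    "ev (test_point z b c) M8 = (- 5) * monomial_value (2, 0, 0) z b c"
    "ev (test_point z b c) M10 = (- 7) * monomial_value (1, 1, 1) z b c"
    "ev (test_point z b c) K12 = (- 7) * monomial_value (0, 2, 2) z b c"
    "ev (test_point z b c) N12 = 40 * monomial_value (3, 0, 0) z b c"
    "ev (test_point z b c) H14 = 5 * monomial_value (2, 1, 1) z b c"
    "ev (test_point z b c) F16 = (- 49) * monomial_value (1, 2, 2) z b c"
    "ev (test_point z b c) X18 = (- 392) * monomial_value (0, 3, 3) z b c"
    "ev (test_point z b c) X19 = 1995 * monomial_value (2, 2, 1) z b c"
    "ev (test_point z b c) X21 = 1200 * monomial_value (4, 1, 0) z b c"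
    "ev (test_point z b c) X23 = 2205 * monomial_value (3, 2, 1) z b c"
    "ev (test_point z b c) X25 = 3675 * monomial_value (2, 3, 2) z b c"
    "ev (test_point z b c) Y27 = (- 16464) * monomial_value (1, 4, 3) z b c"
proof -
  show "ev (test_point z b c) f1 = 1 * monomial_value (0, 0, 1) z b c"
    by (rule test_point_monomial[OF bi_invariant_f1 _ _ assms], simp only: slice_values, algebra, simp)
  show "ev (test_point z b c) \<Lambda>3 = 0 * monomial_value (0, 0, 0) z b c"
    by (simp add: test_point_value[OF bi_invariant_\<Lambda>3 assms] slice_\<Lambda>)
  show "ev (test_point z b c) \<Lambda>5 = 1 * monomial_value (1, 0, 1) z b c"
    by (rule test_point_monomial[OF bi_invariant_\<Lambda>(1) _ _ assms], simp only: slice_values, algebra, simp)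
  show "ev (test_point z b c) \<Lambda>7 = 1 * monomial_value (0, 1, 2) z b c"
    by (rule test_point_monomial[OF bi_invariant_\<Lambda>(2) _ _ assms], simp only: slice_values, algebra, simp)
  show "ev (test_point z b c) \<Lambda>9 = 0 * monomial_value (0, 0, 0) z b c"
    by (simp add: test_point_value[OF bi_invariant_\<Lambda>(3) assms] slice_\<Lambda>)
  show "ev (test_point z b c) M8 = (- 5) * monomial_value (2, 0, 0) z b c"
    by (rule test_point_monomial[OF bi_invariant_M8 _ _ assms], simp only: slice_values, algebra, simp)
  show "ev (test_point z b c) M10 = (- 7) * monomial_value (1, 1, 1) z b c"
    by (rule test_point_monomial[OF bi_invariant_M10 _ _ assms], simp only: slice_values, algebra, simp)
  show "ev (test_point z b c) K12 = (- 7) * monomial_value (0, 2, 2) z b c"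
    by (rule test_point_monomial[OF K12(2) _ _ assms], simp only: slice_values, algebra, simp)
  show "ev (test_point z b c) N12 = 40 * monomial_value (3, 0, 0) z b c"
    by (rule test_point_monomial[OF bi_invariant_N12 _ _ assms], simp only: slice_values, algebra, simp)
  show "ev (test_point z b c) H14 = 5 * monomial_value (2, 1, 1) z b c"
    by (rule test_point_monomial[OF bi_invariant_H14 _ _ assms], simp only: slice_values, algebra, simp)
  show "ev (test_point z b c) F16 = (- 49) * monomial_value (1, 2, 2) z b c"
    by (rule test_point_monomial[OF bi_invariant_F16 _ _ assms], simp only: slice_values, algebra, simp)
  show "ev (test_point z b c) X18 = (- 392) * monomial_value (0, 3, 3) z b c"
    by (rule test_point_monomial[OF X18(2) _ _ assms], simp only: slice_values, algebra, simp)
  show "ev (test_point z b c) X19 = 1995 * monomial_value (2, 2, 1) z b c"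
    by (rule test_point_monomial[OF X19(2) _ _ assms], simp only: slice_values, algebra, simp)
  show "ev (test_point z b c) X21 = 1200 * monomial_value (4, 1, 0) z b c"
    by (rule test_point_monomial[OF X21(2) _ _ assms], simp only: slice_values, algebra, simp)
  show "ev (test_point z b c) X23 = 2205 * monomial_value (3, 2, 1) z b c"
    by (rule test_point_monomial[OF X23(2) _ _ assms], simp only: slice_values, algebra, simp)
  show "ev (test_point z b c) X25 = 3675 * monomial_value (2, 3, 2) z b c"
    by (rule test_point_monomial[OF X25(2) _ _ assms], simp only: slice_values, algebra, simp)
  show "ev (test_point z b c) Y27 = (- 16464) * monomial_value (1, 4, 3) z b c"
    by (rule test_point_monomial[OF Y27(2) _ _ assms], simp only: slice_values, algebra, simp)
qed

lemma generator_supported: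
  "(0, 0, 1) \<in> T \<Longrightarrow> f1 \<in> supported T"
  "(0, 0, 0) \<in> T \<Longrightarrow> \<Lambda>3 \<in> supported T"
  "(1, 0, 1) \<in> T \<Longrightarrow> \<Lambda>5 \<in> supported T"
  "(0, 1, 2) \<in> T \<Longrightarrow> \<Lambda>7 \<in> supported T"
  "(0, 0, 0) \<in> T \<Longrightarrow> \<Lambda>9 \<in> supported T"
  "(2, 0, 0) \<in> T \<Longrightarrow> M8 \<in> supported T"
  "(1, 1, 1) \<in> T \<Longrightarrow> M10 \<in> supported T"
  "(0, 2, 2) \<in> T \<Longrightarrow> K12 \<in> supported T"
  "(3, 0, 0) \<in> T \<Longrightarrow> N12 \<in> supported T"
  "(2, 1, 1) \<in> T \<Longrightarrow> H14 \<in> supported T"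
  "(1, 2, 2) \<in> T \<Longrightarrow> F16 \<in> supported T"
  "(0, 3, 3) \<in> T \<Longrightarrow> X18 \<in> supported T"
  "(2, 2, 1) \<in> T \<Longrightarrow> X19 \<in> supported T"
  "(4, 1, 0) \<in> T \<Longrightarrow> X21 \<in> supported T"
  "(3, 2, 1) \<in> T \<Longrightarrow> X23 \<in> supported T"
  "(2, 3, 2) \<in> T \<Longrightarrow> X25 \<in> supported T"
  "(1, 4, 3) \<in> T \<Longrightarrow> Y27 \<in> supported T"
  by (rule supported.mono, assumption, rule generator_monomials, assumption)+

lemma indecomposableI:
  assumes "\<forall>i\<in>{..I}. \<forall>j\<in>{..J}. \<forall>n\<in>{..N}. (i, j, n) \<in> exponent_monoid \<longrightarrow> (I - i, J - j, N - n) \<in> exponent_monoid \<longrightarrow>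
     (i, j, n) = (0, 0, 0) \<or> (i, j, n) = (I, J, N)"
  shows "indecomposable (I, J, N)"
  unfolding indecomposable_def
proof (intro ballI impI)
  fix f g assume fg: "f \<in> exponent_monoid" "g \<in> exponent_monoid" "f + g = (I, J, N)"
  obtain i j n where f: "f = (i, j, n)" by (cases f)
  obtain i' j' n' where g: "g = (i', j', n')" by (cases g)
  have eq: "I = i + i'" "J = j + j'" "N = n + n'" using fg(3) unfolding f g by simp_all
  have "(i, j, n) = (0, 0, 0) \<or> (i, j, n) = (I, J, N)"
    using assms[THEN bspec[of _ _ i], THEN bspec[of _ _ j], THEN bspec[of _ _ n]] fg(1,2) unfolding f g eq by simp
  then show "f = 0 \<or> g = 0" unfolding f g eq by (auto simp: zero_prod_def)
qed

lemma generator_indecomposable: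
  "indecomposable (0, 0, 1)"
  "indecomposable (1, 0, 1)"
  "indecomposable (0, 1, 2)"
  "indecomposable (2, 0, 0)"
  "indecomposable (1, 1, 1)"
  "indecomposable (0, 2, 2)"
  "indecomposable (3, 0, 0)"
  "indecomposable (2, 1, 1)"
  "indecomposable (1, 2, 2)"
  "indecomposable (0, 3, 3)"
  "indecomposable (2, 2, 1)"
  "indecomposable (4, 1, 0)"
  "indecomposable (3, 2, 1)"
  "indecomposable (2, 3, 2)"
  "indecomposable (1, 4, 3)"
  by (rule indecomposableI, simp add: exponent_monoid_def atMost_nat_numeral atMost_Suc)+

lemma ev_eq_on_generated_algebra:
  assumes "P \<in> generated_algebra S" "\<And>Q. Q \<in> S \<Longrightarrow> ev x Q = ev y Q"
  shows "ev x P = ev y P"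
  using assms by induction simp_all

fun independent_from :: "jet_poly list \<Rightarrow> jet_poly list \<Rightarrow> bool" where
  "independent_from us [] \<longleftrightarrow> True"
| "independent_from us (P # vs) \<longleftrightarrow> P \<notin> generated_algebra (set us \<union> set vs) \<and> independent_from (P # us) vs"

lemma generated_algebra_mono: "P \<in> generated_algebra S \<Longrightarrow> S \<subseteq> T \<Longrightarrow> P \<in> generated_algebra T"
  by (induction rule: generated_algebra.induct) (auto intro: generated_algebra.intros)

lemma independent_from_nth:
  "independent_from us vs \<Longrightarrow> i < length vs \<Longrightarrow>
     vs ! i \<notin> generated_algebra (set us \<union> {vs ! j |j. j < length vs \<and> j \<noteq> i})"
proof (induction vs arbitrary: us i)
  case (Cons P vs)
  show ?case
  proof (cases i)
    case 0
    have "{(P # vs) ! j |j. j < length (P # vs) \<and> j \<noteq> i} \<subseteq> set vs"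
      using 0 by (auto simp: nth_Cons')
    then show ?thesis
      using Cons.prems(1) 0 generated_algebra_mono[of P "set us \<union> {(P # vs) ! j |j. j < length (P # vs) \<and> j \<noteq> i}" "set us \<union> set vs"]
      by auto
  next
    case (Suc k)
    have "{(P # vs) ! j |j. j < length (P # vs) \<and> j \<noteq> i} \<subseteq> insert P {vs ! j |j. j < length vs \<and> j \<noteq> k}"
      using Suc by (force simp: nth_Cons split: nat.splits)
    moreover have "vs ! k \<notin> generated_algebra (set (P # us) \<union> {vs ! j |j. j < length vs \<and> j \<noteq> k})"
      by (rule Cons.IH) (use Cons.prems Suc in simp_all)
    ultimately show ?thesis
      using Suc generated_algebra_mono[of "vs ! k" "set us \<union> {(P # vs) ! j |j. j < length (P # vs) \<and> j \<noteq> i}"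
        "set (P # us) \<union> {vs ! j |j. j < length vs \<and> j \<noteq> k}"]
      by auto
  qed
qed simp

lemma mutually_independentI: "independent_from [] Ps \<Longrightarrow> mutually_independent Ps"
  using independent_from_nth[of "[]" Ps] by (simp add: mutually_independent_def)

lemma generators_mutually_independent:
  "mutually_independent
     [f1, \<Lambda>3, \<Lambda>5, \<Lambda>7, \<Lambda>9, M8, M10, K12, N12, H14, F16, X18, X19, X21, X23, X25, Y27]"
proof (rule mutually_independentI, unfold independent_from.simps, intro conjI)
  show "f1 \<notin> generated_algebra (set [] \<union> set [\<Lambda>3, \<Lambda>5, \<Lambda>7, \<Lambda>9, M8, M10, K12, N12, H14, F16, X18, X19, X21, X23, X25, Y27])"
    by (rule not_generated[OF generator_indecomposable(1) _ _ _ generator_monomials(1)])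
      (simp add: exponent_monoid_def, simp add: zero_prod_def, simp, assumption, unfold list.set,
        (intro Un_least insert_subsetI empty_subsetI; rule generator_supported; simp add: exponent_monoid_def))
  show "\<Lambda>3 \<notin> generated_algebra (set [f1] \<union> set [\<Lambda>5, \<Lambda>7, \<Lambda>9, M8, M10, K12, N12, H14, F16, X18, X19, X21, X23, X25, Y27])"
    by (rule notI, drule ev_eq_on_generated_algebra[where x = "slice 1 0 0 0" and y = "slice 0 0 0 0"])
      (auto simp: slice_values)
  show "\<Lambda>5 \<notin> generated_algebra (set [\<Lambda>3, f1] \<union> set [\<Lambda>7, \<Lambda>9, M8, M10, K12, N12, H14, F16, X18, X19, X21, X23, X25, Y27])"
    by (rule not_generated[OF generator_indecomposable(2) _ _ _ generator_monomials(3)])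
      (simp add: exponent_monoid_def, simp add: zero_prod_def, simp, assumption, unfold list.set,
        (intro Un_least insert_subsetI empty_subsetI; rule generator_supported; simp add: exponent_monoid_def))
  show "\<Lambda>7 \<notin> generated_algebra (set [\<Lambda>5, \<Lambda>3, f1] \<union> set [\<Lambda>9, M8, M10, K12, N12, H14, F16, X18, X19, X21, X23, X25, Y27])"
    by (rule not_generated[OF generator_indecomposable(3) _ _ _ generator_monomials(4)])
      (simp add: exponent_monoid_def, simp add: zero_prod_def, simp, assumption, unfold list.set,
        (intro Un_least insert_subsetI empty_subsetI; rule generator_supported; simp add: exponent_monoid_def))
  show "\<Lambda>9 \<notin> generated_algebra (set [\<Lambda>7, \<Lambda>5, \<Lambda>3, f1] \<union> set [M8, M10, K12, N12, H14, F16, X18, X19, X21, X23, X25, Y27])"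
    by (rule notI, drule ev_eq_on_generated_algebra[where x = "slice 0 0 0 1" and y = "slice 0 0 0 0"])
      (auto simp: slice_values)
  show "M8 \<notin> generated_algebra (set [\<Lambda>9, \<Lambda>7, \<Lambda>5, \<Lambda>3, f1] \<union> set [M10, K12, N12, H14, F16, X18, X19, X21, X23, X25, Y27])"
    by (rule not_generated[OF generator_indecomposable(4) _ _ _ generator_monomials(6)])
      (simp add: exponent_monoid_def, simp add: zero_prod_def, simp, assumption, unfold list.set,
        (intro Un_least insert_subsetI empty_subsetI; rule generator_supported; simp add: exponent_monoid_def))
  show "M10 \<notin> generated_algebra (set [M8, \<Lambda>9, \<Lambda>7, \<Lambda>5, \<Lambda>3, f1] \<union> set [K12, N12, H14, F16, X18, X19, X21, X23, X25, Y27])"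
    by (rule not_generated[OF generator_indecomposable(5) _ _ _ generator_monomials(7)])
      (simp add: exponent_monoid_def, simp add: zero_prod_def, simp, assumption, unfold list.set,
        (intro Un_least insert_subsetI empty_subsetI; rule generator_supported; simp add: exponent_monoid_def))
  show "K12 \<notin> generated_algebra (set [M10, M8, \<Lambda>9, \<Lambda>7, \<Lambda>5, \<Lambda>3, f1] \<union> set [N12, H14, F16, X18, X19, X21, X23, X25, Y27])"
    by (rule not_generated[OF generator_indecomposable(6) _ _ _ generator_monomials(8)])
      (simp add: exponent_monoid_def, simp add: zero_prod_def, simp, assumption, unfold list.set,
        (intro Un_least insert_subsetI empty_subsetI; rule generator_supported; simp add: exponent_monoid_def))
  show "N12 \<notin> generated_algebra (set [K12, M10, M8, \<Lambda>9, \<Lambda>7, \<Lambda>5, \<Lambda>3, f1] \<union> set [H14, F16, X18, X19, X21, X23, X25, Y27])"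
    by (rule not_generated[OF generator_indecomposable(7) _ _ _ generator_monomials(9)])
      (simp add: exponent_monoid_def, simp add: zero_prod_def, simp, assumption, unfold list.set,
        (intro Un_least insert_subsetI empty_subsetI; rule generator_supported; simp add: exponent_monoid_def))
  show "H14 \<notin> generated_algebra (set [N12, K12, M10, M8, \<Lambda>9, \<Lambda>7, \<Lambda>5, \<Lambda>3, f1] \<union> set [F16, X18, X19, X21, X23, X25, Y27])"
    by (rule not_generated[OF generator_indecomposable(8) _ _ _ generator_monomials(10)])
      (simp add: exponent_monoid_def, simp add: zero_prod_def, simp, assumption, unfold list.set,
        (intro Un_least insert_subsetI empty_subsetI; rule generator_supported; simp add: exponent_monoid_def))
  show "F16 \<notin> generated_algebra (set [H14, N12, K12, M10, M8, \<Lambda>9, \<Lambda>7, \<Lambda>5, \<Lambda>3, f1] \<union> set [X18, X19, X21, X23, X25, Y27])"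
    by (rule not_generated[OF generator_indecomposable(9) _ _ _ generator_monomials(11)])
      (simp add: exponent_monoid_def, simp add: zero_prod_def, simp, assumption, unfold list.set,
        (intro Un_least insert_subsetI empty_subsetI; rule generator_supported; simp add: exponent_monoid_def))
  show "X18 \<notin> generated_algebra (set [F16, H14, N12, K12, M10, M8, \<Lambda>9, \<Lambda>7, \<Lambda>5, \<Lambda>3, f1] \<union> set [X19, X21, X23, X25, Y27])"
    by (rule not_generated[OF generator_indecomposable(10) _ _ _ generator_monomials(12)])
      (simp add: exponent_monoid_def, simp add: zero_prod_def, simp, assumption, unfold list.set,
        (intro Un_least insert_subsetI empty_subsetI; rule generator_supported; simp add: exponent_monoid_def))
  show "X19 \<notin> generated_algebra (set [X18, F16, H14, N12, K12, M10, M8, \<Lambda>9, \<Lambda>7, \<Lambda>5, \<Lambda>3, f1] \<union> set [X21, X23, X25, Y27])"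
    by (rule not_generated[OF generator_indecomposable(11) _ _ _ generator_monomials(13)])
      (simp add: exponent_monoid_def, simp add: zero_prod_def, simp, assumption, unfold list.set,
        (intro Un_least insert_subsetI empty_subsetI; rule generator_supported; simp add: exponent_monoid_def))
  show "X21 \<notin> generated_algebra (set [X19, X18, F16, H14, N12, K12, M10, M8, \<Lambda>9, \<Lambda>7, \<Lambda>5, \<Lambda>3, f1] \<union> set [X23, X25, Y27])"
    by (rule not_generated[OF generator_indecomposable(12) _ _ _ generator_monomials(14)])
      (simp add: exponent_monoid_def, simp add: zero_prod_def, simp, assumption, unfold list.set,
        (intro Un_least insert_subsetI empty_subsetI; rule generator_supported; simp add: exponent_monoid_def))
  show "X23 \<notin> generated_algebra (set [X21, X19, X18, F16, H14, N12, K12, M10, M8, \<Lambda>9, \<Lambda>7, \<Lambda>5, \<Lambda>3, f1] \<union> set [X25, Y27])"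
    by (rule not_generated[OF generator_indecomposable(13) _ _ _ generator_monomials(15)])
      (simp add: exponent_monoid_def, simp add: zero_prod_def, simp, assumption, unfold list.set,
        (intro Un_least insert_subsetI empty_subsetI; rule generator_supported; simp add: exponent_monoid_def))
  show "X25 \<notin> generated_algebra (set [X23, X21, X19, X18, F16, H14, N12, K12, M10, M8, \<Lambda>9, \<Lambda>7, \<Lambda>5, \<Lambda>3, f1] \<union> set [Y27])"
    by (rule not_generated[OF generator_indecomposable(14) _ _ _ generator_monomials(16)])
      (simp add: exponent_monoid_def, simp add: zero_prod_def, simp, assumption, unfold list.set,
        (intro Un_least insert_subsetI empty_subsetI; rule generator_supported; simp add: exponent_monoid_def))
  show "Y27 \<notin> generated_algebra (set [X25, X23, X21, X19, X18, F16, H14, N12, K12, M10, M8, \<Lambda>9, \<Lambda>7, \<Lambda>5, \<Lambda>3, f1] \<union> set [])"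
    by (rule not_generated[OF generator_indecomposable(15) _ _ _ generator_monomials(17)])
      (simp add: exponent_monoid_def, simp add: zero_prod_def, simp, assumption, unfold list.set,
        (intro Un_least insert_subsetI empty_subsetI; rule generator_supported; simp add: exponent_monoid_def))
qed (rule TrueI)

lemma card_index_lists: "finite (index_lists r)" "card (index_lists r) = 2 ^ r"
proof -
  have "index_lists r = {is. set is \<subseteq> {1, 2} \<and> length is = r}" by (auto simp: index_lists_def)
  then show "finite (index_lists r)" "card (index_lists r) = 2 ^ r"
    using finite_lists_length_eq[of "{1, 2 :: nat}" r] card_lists_length_eq[of "{1, 2 :: nat}" r]
    by (simp_all add: numeral_2_eq_2)
qed

lemma card_polarization_labels: "card polarization_labels = 56"
proof -
  have "card polarization_labels = (\<Sum>n<length bi_invariants. 2 ^ snd (bi_invariants ! n))"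
    unfolding polarization_labels_def by (simp add: card_SigmaI card_index_lists)
  also have "\<dots> = sum_list (map (\<lambda>(P, r). 2 ^ r) bi_invariants)"
    by (simp add: sum_list_sum_nth atLeast0LessThan case_prod_beta)
  also have "\<dots> = 56" by (simp add: bi_invariants_def)
  finally show ?thesis .
qed

theorem mainTheorem9:
  shows "UE 5 = generated_algebra
           {f1, \<Lambda>3, \<Lambda>5, \<Lambda>7, \<Lambda>9, M8, M10, K12, N12, H14, F16, X18, X19, X21, X23, X25, Y27} \<and>
         mutually_independent
           [f1, \<Lambda>3, \<Lambda>5, \<Lambda>7, \<Lambda>9, M8, M10, K12, N12, H14, F16, X18, X19, X21, X23, X25, Y27] \<and>
         E 5 = generated_algebra (labelled_polarization ` polarization_labels) \<and>
         map (\<lambda>(P, r). card (index_lists r)) bi_invariants =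
           [2, 1, 2, 4, 8, 1, 2, 4, 1, 2, 4, 8, 2, 1, 2, 4, 8] \<and>
         card polarization_labels = 56"
proof (intro conjI)
  show "UE 5 = generated_algebra
      {f1, \<Lambda>3, \<Lambda>5, \<Lambda>7, \<Lambda>9, M8, M10, K12, N12, H14, F16, X18, X19, X21, X23, X25, Y27}"
    using UE_eq_bi_algebra unfolding bi_algebra_def .
  show "mutually_independent
      [f1, \<Lambda>3, \<Lambda>5, \<Lambda>7, \<Lambda>9, M8, M10, K12, N12, H14, F16, X18, X19, X21, X23, X25, Y27]"
    by (rule generators_mutually_independent)
  show "E 5 = generated_algebra (labelled_polarization ` polarization_labels)"
    using E_eq_polarization_algebra unfolding polarization_algebra_def .
  show "map (\<lambda>(P, r). card (index_lists r)) bi_invariants =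
      [2, 1, 2, 4, 8, 1, 2, 4, 1, 2, 4, 8, 2, 1, 2, 4, 8]"
    by (simp add: bi_invariants_def card_index_lists)
  show "card polarization_labels = 56"
    by (rule card_polarization_labels)
qed

end
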